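(* There is a constant $\nu>0$, independent of the mesh-size $h$, such that $$\inf_{u_h\in V_h^{nc}\setminus\{0\}}\ \sup_{v_h\in V_h^{nc}\setminus\{0\}}\ \frac{A_h^{nc}(u_h,v_h)}{|||u_h|||_{NLPSD}\,|||v_h|||_{NLPSD}}\ \ge\ \nu .$$
   Context: Setting. $\Omega\subset\mathbb{R}^2$ is a bounded polygonal domain, $\mathbf{b}\in[W^1_\infty(\Omega)]^2$, $\mu\in L_\infty(\Omega)$, and there is $\alpha>0$ with $\mu-\tfrac12\operatorname{div}\mathbf{b}\ge\alpha$ a.e. in $\Omega$. For real $w$, $w^{\ominus}:=\tfrac12(|w|-w)$. $(\cdot,\cdot)$ and $\|\cdot\|$ are the $L_2(\Omega)$ inner product and norm. Meshes. $\mathcal{T}_h$ is a member of a family of shape-regular, (locally) quasi-uniform triangulations of $\Omega$; $h_K=\operatorname{diam}(K)$, $h=\max_K h_K$; $h_{\mathcal T}|_K=h_K$. $\mathcal{E}_h=\mathcal{E}_h^I\cup\mathcal{E}_h^B$ is the set of all edges (interior and boundary), $h_E=\operatorname{diam}(E)$. On a boundary edge $\mathbf{n}$ is the unit outward normal to $\partial\Omega$; on an interior edge $E$ shared by $K^+$ and $K^-$, $\mathbf{n}$ is the unit normal oriented from $K^+$ to $K^-$, and with $v^\pm=v|_{K^\pm}$, $\{v\}=\tfrac12(v^+|_E+v^-|_E)$, $[v]=v^+|_E-v^-|_E$. For $E\in\mathcal{E}_h$, $\mathcal{M}_E$ is the union of all triangles sharing the edge $E$, and $|\mathcal{M}_E|$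 its measure. $\nabla_h$ is the element-wise gradient. Space. $V_h^{nc}=\{v\in L_2(\Omega): v|_K\in\mathbb{P}_1(K)\ \forall K\in\mathcal{T}_h,\ \int_E[v]\,ds=0\ \forall E\in\mathcal{E}_h^I\}$ (Crouzeix–Raviart). Stabilization. $\kappa_E(u):=\mathbf{b}\cdot\nabla_h u-\frac{1}{|\mathcal{M}_E|}\int_{\mathcal{M}_E}\mathbf{b}\cdot\nabla_h u\,dx$ on $\mathcal{M}_E$, and $S_h^{nc}(u,v):=\sum_{E\in\mathcal{E}_h}\beta_E(\kappa_E(u),\kappa_E(v))_{L_2(\mathcal{M}_E)}$ with $\beta_E=\beta h_E$, where the stabilization constant $\beta>0$ is independent of $h$ and required to satisfy $\beta|_{\mathcal{M}_E}\sim1/\|\mathbf{b}\|_{W^1_\infty(\mathcal{M}_E)}$ (two-sided bounds with mesh-independent constants). Bilinear form. $$A_h^{nc}(u,v):=(\mathbf{b}\cdot\nabla_h u,v)+(\mu u,v)+\sum_{E\in\mathcal{E}_h^B}\int_E(\mathbf{b}\cdot\mathbf{n})^{\ominus}uv\,ds-\sum_{E\in\mathcal{E}_h^I}\int_E(\mathbf{b}\cdot\mathbf{n})[u]\{v\}\,ds+\sum_{E\in\mathcal{E}_h^I}\int_E\frac{|\mathbf{b}\cdot\mathbf{n}|}{2}[u][v]\,ds+S_h^{nc}(u,v).$$ Norm. $$|||v|||_{NLPSD}^2:=\alpha\|v\|^2+\sum_{E\in\mathcal{E}_h^B}\int_E\frac{|\mathbf{b}\cdot\mathbf{n}|}{2}v^2\,ds+S_h^{nc}(v,v)+\sum_{E\in\mathcal{E}_h^I}\int_E\frac{|\mathbf{b}\cdot\mathbf{n}|}{2}[v]^2\,ds+\|h_{\mathcal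 T}^{1/2}(\mathbf{b}\cdot\nabla_h v)\|^2.$$ Independence of $h$ means that the constant is the same for all meshes of the family; it may depend on the shape-regularity and quasi-uniformity constants and on the data $\Omega,\mathbf{b},\mu,\alpha,\beta$. *)

theory Defs
  imports "HOL-Analysis.Analysis" "HOL-Probability.Essential_Supremum"
begin

type_synonym plane = "real^2"

section \<open>Polygonal domains\<close>

definition simple_closed_polygon :: "plane set \<Rightarrow> bool" where
  "simple_closed_polygon P \<longleftrightarrow>
     (\<exists>g. simple_path g \<and> pathfinish g = pathstart g \<and> path_image g = P) \<and>
     (\<exists>S. finite S \<and> P = (\<Union>(p, q)\<in>S. closed_segment p q))"

text \<open>The boundary curves are simple and mutually disjoint, so the domain may have holes but no
  slits and no two boundary parts touching at a vertex: it is a Lipschitz domain.\<close>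

definition polygonal_domain :: "plane set \<Rightarrow> bool" where
  "polygonal_domain \<Omega> \<longleftrightarrow> open \<Omega> \<and> connected \<Omega> \<and> bounded \<Omega> \<and> \<Omega> \<noteq> {} \<and>
     (\<exists>\<P>. finite \<P> \<and> disjoint \<P> \<and> (\<forall>P\<in>\<P>. simple_closed_polygon P) \<and> frontier \<Omega> = \<Union>\<P>)"

section \<open>Lebesgue and Sobolev spaces\<close>

definition in_L2 :: "plane set \<Rightarrow> (plane \<Rightarrow> real) \<Rightarrow> bool" where
  "in_L2 S f \<longleftrightarrow> f \<in> borel_measurable (lebesgue_on S) \<and> integrable (lebesgue_on S) (\<lambda>x. (f x)\<^sup>2)"

definition l2_inner :: "plane set \<Rightarrow> (plane \<Rightarrow> real) \<Rightarrow> (plane \<Rightarrow> real) \<Rightarrow> real" where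
  "l2_inner S f g = (LINT x|lebesgue_on S. f x * g x)"

definition l2_norm :: "plane set \<Rightarrow> (plane \<Rightarrow> real) \<Rightarrow> real" where
  "l2_norm S f = sqrt (l2_inner S f f)"

definition in_Linf :: "plane set \<Rightarrow> (plane \<Rightarrow> real) \<Rightarrow> bool" where
  "in_Linf S f \<longleftrightarrow> f \<in> borel_measurable (lebesgue_on S) \<and>
     esssup (lebesgue_on S) (\<lambda>x. ereal \<bar>f x\<bar>) < \<infinity>"

definition Linf_norm :: "plane set \<Rightarrow> (plane \<Rightarrow> real) \<Rightarrow> real" where
  "Linf_norm S f = real_of_ereal (esssup (lebesgue_on S) (\<lambda>x. ereal \<bar>f x\<bar>))"

definition gradient :: "(plane \<Rightarrow> real) \<Rightarrow> plane \<Rightarrow> plane" where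
  "gradient f x = (THE D. GDERIV f x :> D)"

primrec C_k :: "nat \<Rightarrow> (plane \<Rightarrow> real) \<Rightarrow> bool" where
  "C_k 0 f \<longleftrightarrow> continuous_on UNIV f"
| "C_k (Suc k) f \<longleftrightarrow> (\<forall>x. f differentiable (at x)) \<and> (\<forall>i. C_k k (\<lambda>x. gradient f x $ i))"

definition test_function :: "plane set \<Rightarrow> (plane \<Rightarrow> real) \<Rightarrow> bool" where
  "test_function U \<phi> \<longleftrightarrow> (\<forall>k. C_k k \<phi>) \<and>
     compact (closure {x. \<phi> x \<noteq> 0}) \<and> closure {x. \<phi> x \<noteq> 0} \<subseteq> U"

definition locally_integrable :: "plane set \<Rightarrow> (plane \<Rightarrow> real) \<Rightarrow> bool" where
  "locally_integrable U f \<longleftrightarrow> (\<forall>C. compact C \<and> C \<subseteq> U \<longrightarrow> integrable (lebesgue_on C) f)"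

definition has_weak_partial ::
  "plane set \<Rightarrow> 2 \<Rightarrow> (plane \<Rightarrow> real) \<Rightarrow> (plane \<Rightarrow> real) \<Rightarrow> bool" where
  "has_weak_partial U i f g \<longleftrightarrow> locally_integrable U f \<and> locally_integrable U g \<and>
     (\<forall>\<phi>. test_function U \<phi> \<longrightarrow>
        (LINT x|lebesgue_on U. f x * gradient \<phi> x $ i) = - (LINT x|lebesgue_on U. g x * \<phi> x))"

text \<open>The weak derivative is determined only up to null sets; all uses below are invariant
  under a.e. modification.\<close>

definition weak_partial :: "plane set \<Rightarrow> 2 \<Rightarrow> (plane \<Rightarrow> real) \<Rightarrow> plane \<Rightarrow> real" where
  "weak_partial U i f = (SOME g. has_weak_partial U i f g)"

definition in_W1inf :: "plane set \<Rightarrow> (plane \<Rightarrow> plane) \<Rightarrow> bool" where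
  "in_W1inf U b \<longleftrightarrow> (\<forall>k. in_Linf U (\<lambda>x. b x $ k) \<and>
     (\<forall>i. \<exists>g. has_weak_partial U i (\<lambda>x. b x $ k) g \<and> in_Linf U g))"

definition W1inf_norm :: "plane set \<Rightarrow> (plane \<Rightarrow> plane) \<Rightarrow> real" where
  "W1inf_norm U b = Max (range (\<lambda>k. Linf_norm U (\<lambda>x. b x $ k)) \<union>
     range (\<lambda>(i, k). Linf_norm U (weak_partial U i (\<lambda>x. b x $ k))))"

definition weak_div :: "plane set \<Rightarrow> (plane \<Rightarrow> plane) \<Rightarrow> plane \<Rightarrow> real" where
  "weak_div U b x = (\<Sum>i\<in>UNIV. weak_partial U i (\<lambda>x. b x $ i) x)"

section \<open>Meshes\<close>

text \<open>A triangulation together with a choice of \<open>K\<^sup>+\<close> and \<open>K\<^sup>-\<close>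
  for every interior edge.\<close>

record mesh =
  triangles :: "plane set set"
  plus_elem :: "plane set \<Rightarrow> plane set"
  minus_elem :: "plane set \<Rightarrow> plane set"

definition edges :: "mesh \<Rightarrow> plane set set" where
  "edges M = {E. \<exists>K\<in>triangles M. E edge_of K}"

definition interior_edges :: "mesh \<Rightarrow> plane set set" where
  "interior_edges M = {E. \<exists>K\<in>triangles M. \<exists>K'\<in>triangles M. K \<noteq> K' \<and> E edge_of K \<and> E edge_of K'}"

definition boundary_edges :: "mesh \<Rightarrow> plane set set" where
  "boundary_edges M = edges M - interior_edges M"

definition mesh_of :: "plane set \<Rightarrow> mesh \<Rightarrow> bool" where
  "mesh_of \<Omega> M \<longleftrightarrow> triangulation (triangles M) \<and> (\<forall>K\<in>triangles M. 2 simplex K) \<and>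
     \<Union>(triangles M) = closure \<Omega> \<and>
     (\<forall>E\<in>interior_edges M.
        plus_elem M E \<in> triangles M \<and> minus_elem M E \<in> triangles M \<and>
        plus_elem M E \<noteq> minus_elem M E \<and>
        E edge_of plus_elem M E \<and> E edge_of minus_elem M E)"

definition boundary_elem :: "mesh \<Rightarrow> plane set \<Rightarrow> plane set" where
  "boundary_elem M E = (THE K. K \<in> triangles M \<and> E edge_of K)"

definition outer_normal :: "plane set \<Rightarrow> plane set \<Rightarrow> plane" where
  "outer_normal K E = (THE n. norm n = 1 \<and> (\<forall>x\<in>E. \<forall>y\<in>K. n \<bullet> (y - x) \<le> 0))"

definition edge_normal :: "mesh \<Rightarrow> plane set \<Rightarrow> plane" where
  "edge_normal M E = (if E \<in> interior_edges M then outer_normal (plus_elem M E) E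
     else outer_normal (boundary_elem M E) E)"

definition edge_patch :: "mesh \<Rightarrow> plane set \<Rightarrow> plane set" where
  "edge_patch M E = \<Union>{K \<in> triangles M. E edge_of K}"

definition mesh_size :: "mesh \<Rightarrow> plane \<Rightarrow> real" where
  "mesh_size M x = (\<Sum>K\<in>triangles M. indicator (interior K) x * diameter K)"

definition inscribed_diameter :: "plane set \<Rightarrow> real" where
  "inscribed_diameter K = Sup {2 * r | r x. 0 \<le> r \<and> cball x r \<subseteq> K}"

definition shape_regular :: "mesh set \<Rightarrow> bool" where
  "shape_regular \<F> \<longleftrightarrow>
     (\<exists>\<sigma>. \<forall>M\<in>\<F>. \<forall>K\<in>triangles M. diameter K \<le> \<sigma> * inscribed_diameter K)"

definition locally_quasi_uniform :: "mesh set \<Rightarrow> bool" where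
  "locally_quasi_uniform \<F> \<longleftrightarrow>
     (\<exists>q. \<forall>M\<in>\<F>. \<forall>K\<in>triangles M. \<forall>K'\<in>triangles M. K \<inter> K' \<noteq> {} \<longrightarrow> diameter K \<le> q * diameter K')"

text \<open>Arc length integral; it does not depend on the order in which the endpoints of the
  segment are chosen.\<close>

definition edge_integral :: "plane set \<Rightarrow> (plane \<Rightarrow> real) \<Rightarrow> real" where
  "edge_integral E f = (let (p, q) = (SOME (p, q). E = closed_segment p q)
     in dist p q * (LINT t:{0..1}|lborel. f (linepath p q t)))"

section \<open>The Crouzeix--Raviart space\<close>

definition P1 :: "(plane \<Rightarrow> real) set" where
  "P1 = {p. \<exists>a c. p = (\<lambda>x. a \<bullet> x + c)}"

text \<open>Elements of the space are functions on the domain up to null sets. The polynomial that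
  represents \<open>v\<close> on \<open>K\<close> supplies the one-sided traces on the edges of \<open>K\<close>.\<close>

definition elem_poly :: "(plane \<Rightarrow> real) \<Rightarrow> plane set \<Rightarrow> plane \<Rightarrow> real" where
  "elem_poly v K = (THE p. p \<in> P1 \<and> (AE x in lebesgue_on K. v x = p x))"

definition jump :: "mesh \<Rightarrow> plane set \<Rightarrow> (plane \<Rightarrow> real) \<Rightarrow> plane \<Rightarrow> real" where
  "jump M E v x = elem_poly v (plus_elem M E) x - elem_poly v (minus_elem M E) x"

definition average :: "mesh \<Rightarrow> plane set \<Rightarrow> (plane \<Rightarrow> real) \<Rightarrow> plane \<Rightarrow> real" where
  "average M E v x = (elem_poly v (plus_elem M E) x + elem_poly v (minus_elem M E) x) / 2"

definition boundary_trace :: "mesh \<Rightarrow> plane set \<Rightarrow> (plane \<Rightarrow> real) \<Rightarrow> plane \<Rightarrow> real" where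
  "boundary_trace M E v = elem_poly v (boundary_elem M E)"

definition V_nc :: "plane set \<Rightarrow> mesh \<Rightarrow> (plane \<Rightarrow> real) set" where
  "V_nc \<Omega> M = {v. in_L2 \<Omega> v \<and>
     (\<forall>K\<in>triangles M. \<exists>p\<in>P1. AE x in lebesgue_on K. v x = p x) \<and>
     (\<forall>E\<in>interior_edges M. edge_integral E (jump M E v) = 0)}"

definition V_nc_nonzero :: "plane set \<Rightarrow> mesh \<Rightarrow> (plane \<Rightarrow> real) set" where
  "V_nc_nonzero \<Omega> M = {v \<in> V_nc \<Omega> M. \<not> (AE x in lebesgue_on \<Omega>. v x = 0)}"

definition broken_gradient :: "mesh \<Rightarrow> (plane \<Rightarrow> real) \<Rightarrow> plane \<Rightarrow> plane" where
  "broken_gradient M v x =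
     (\<Sum>K\<in>triangles M. indicator (interior K) x *\<^sub>R gradient (elem_poly v K) x)"

section \<open>Stabilization, bilinear form and norm\<close>

definition neg_part :: "real \<Rightarrow> real" where
  "neg_part w = (\<bar>w\<bar> - w) / 2"

definition advect :: "(plane \<Rightarrow> plane) \<Rightarrow> mesh \<Rightarrow> (plane \<Rightarrow> real) \<Rightarrow> plane \<Rightarrow> real" where
  "advect b M u x = b x \<bullet> broken_gradient M u x"

definition kappa ::
  "(plane \<Rightarrow> plane) \<Rightarrow> mesh \<Rightarrow> plane set \<Rightarrow> (plane \<Rightarrow> real) \<Rightarrow> plane \<Rightarrow> real" where
  "kappa b M E u x = advect b M u x -
     (1 / measure lebesgue (edge_patch M E)) * (LINT y|lebesgue_on (edge_patch M E). advect b M u y)"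

definition S_nc ::
  "(plane \<Rightarrow> plane) \<Rightarrow> real \<Rightarrow> mesh \<Rightarrow> (plane \<Rightarrow> real) \<Rightarrow> (plane \<Rightarrow> real) \<Rightarrow> real" where
  "S_nc b \<beta> M u v =
     (\<Sum>E\<in>edges M. (\<beta> * diameter E) * l2_inner (edge_patch M E) (kappa b M E u) (kappa b M E v))"

definition A_nc ::
  "plane set \<Rightarrow> (plane \<Rightarrow> plane) \<Rightarrow> (plane \<Rightarrow> real) \<Rightarrow> real \<Rightarrow> mesh \<Rightarrow>
     (plane \<Rightarrow> real) \<Rightarrow> (plane \<Rightarrow> real) \<Rightarrow> real" where
  "A_nc \<Omega> b \<mu> \<beta> M u v =
     l2_inner \<Omega> (advect b M u) v + l2_inner \<Omega> (\<lambda>x. \<mu> x * u x) v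
     + (\<Sum>E\<in>boundary_edges M. edge_integral E
          (\<lambda>x. neg_part (b x \<bullet> edge_normal M E) * boundary_trace M E u x * boundary_trace M E v x))
     - (\<Sum>E\<in>interior_edges M. edge_integral E
          (\<lambda>x. (b x \<bullet> edge_normal M E) * jump M E u x * average M E v x))
     + (\<Sum>E\<in>interior_edges M. edge_integral E
          (\<lambda>x. \<bar>b x \<bullet> edge_normal M E\<bar> / 2 * jump M E u x * jump M E v x))
     + S_nc b \<beta> M u v"

definition NLPSD_norm ::
  "plane set \<Rightarrow> (plane \<Rightarrow> plane) \<Rightarrow> real \<Rightarrow> real \<Rightarrow> mesh \<Rightarrow> (plane \<Rightarrow> real) \<Rightarrow> real" where
  "NLPSD_norm \<Omega> b \<alpha> \<beta> M v = sqrt (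
     \<alpha> * (l2_norm \<Omega> v)\<^sup>2
     + (\<Sum>E\<in>boundary_edges M. edge_integral E
          (\<lambda>x. \<bar>b x \<bullet> edge_normal M E\<bar> / 2 * (boundary_trace M E v x)\<^sup>2))
     + S_nc b \<beta> M v v
     + (\<Sum>E\<in>interior_edges M. edge_integral E
          (\<lambda>x. \<bar>b x \<bullet> edge_normal M E\<bar> / 2 * (jump M E v x)\<^sup>2))
     + (l2_norm \<Omega> (\<lambda>x. sqrt (mesh_size M x) * advect b M v x))\<^sup>2)"

text \<open>Where \<open>b\<close> vanishes on a patch the upper bound reads \<open>\<beta> \<le> 0\<close> because division by zero
  gives zero; with \<open>\<beta> > 0\<close> this case is excluded, as it is by the relation
  \<open>\<beta> \<sim> 1 / \<parallel>b\<parallel>\<close>.\<close>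

definition beta_scaling :: "(plane \<Rightarrow> plane) \<Rightarrow> real \<Rightarrow> mesh set \<Rightarrow> bool" where
  "beta_scaling b \<beta> \<F> \<longleftrightarrow> (\<exists>c C. 0 < c \<and> 0 < C \<and> (\<forall>M\<in>\<F>. \<forall>E\<in>edges M.
     c / W1inf_norm (interior (edge_patch M E)) b \<le> \<beta> \<and>
     \<beta> \<le> C / W1inf_norm (interior (edge_patch M E)) b))"

end

theory Submission
  imports Defs "HOL-Real_Asymp.Real_Asymp"
begin

text \<open>
  Testing the weak definition of \<open>div b\<close> with \<open>u\<^sup>2\<close> times a smooth cutoff of a triangle, and letting
  the cutoff tend to the indicator of the triangle, gives elementwise integration by parts in the form of
  an inequality. Summed over the mesh, it shows that \<open>A(u, u)\<close> bounds every part of the squared norm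
  except \<open>\<parallel>h\<^sup>1\<^sup>/\<^sup>2 b \<cdot> \<nabla>\<^sub>h u\<parallel>\<^sup>2\<close>. That part is recovered with the Crouzeix--Raviart function \<open>w\<close> whose mean
  value on each edge \<open>E\<close> is \<open>h\<^sub>E\<close> times the mean of \<open>b \<cdot> \<nabla>\<^sub>h u\<close> over the patch of \<open>E\<close>: up to fluctuations
  controlled by the stabilization, \<open>(b \<cdot> \<nabla>\<^sub>h u, w)\<close> bounds it, and scaling arguments bound the norm of \<open>w\<close>
  by it. Hence \<open>v = u + \<delta> w\<close> with a small fixed \<open>\<delta>\<close> satisfies \<open>A(u, v) \<ge> \<nu> |||u||| |||v|||\<close>.
\<close>

section \<open>Smooth cutoffs\<close>

text \<open>The weak divergence acts only on test functions with compact support in the open domain,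
  and a mesh triangle may reach the boundary. Each cutoff therefore vanishes in a layer along all
  three edges. It has one flat factor per barycentric coordinate, so its gradient splits into three
  pieces, each of which acts in the limit like a line measure on one edge. To see this, plane
  integrals are written in affine coordinates and the coordinate transverse to the edge is stretched
  by the width of the layer. Why this \<open>w\<close> works: on each triangle the Crouzeix-Raviart
  function of an edge has the positive integral \<open>|K|/3\<close>, so pairing it with the patch
  mean that is its coefficient gives a square. What remains is the fluctuation, which is exactly
  what the stabilization measures. Every triangle has an edge of length \<open>h_K\<close>, so the
  edge weights \<open>h_E\<close> recover the element weight. All bounds are expressed by numbers
  that limit the data and the shape of the mesh, so the final constant is an explicit formula in
  them.\<close>

lemma gradient_eqI: "GDERIV f x :> D \<Longrightarrow> gradient f x = D"
proof -
  assume D: "GDERIV f x :> D"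
  have "D' = D" if "GDERIV f x :> D'" for D'
  proof -
    have "(\<lambda>h. h \<bullet> D') = (\<lambda>h. h \<bullet> D)"
      using D that unfolding gderiv_def by (rule has_derivative_unique[rotated])
    then have "(D' - D) \<bullet> D' = (D' - D) \<bullet> D" by metis
    then have "(D' - D) \<bullet> (D' - D) = 0" by (simp add: inner_diff_right)
    then show ?thesis by simp
  qed
  with D show ?thesis unfolding gradient_def by blast
qed

lemma differentiable_imp_GDERIV:
  fixes f :: "plane \<Rightarrow> real"
  assumes "f differentiable (at x)"
  shows "GDERIV f x :> gradient f x"
proof -
  from assms obtain f' where f': "(f has_derivative f') (at x)" by (auto simp: differentiable_def)
  then have lin: "linear f'" by (simp add: has_derivative_linear)
  have "f' = (\<lambda>h. h \<bullet> (\<Sum>i\<in>Basis. f' i *\<^sub>R i))"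
  proof
    fix h :: plane
    have "f' h = f' (\<Sum>i\<in>Basis. (h \<bullet> i) *\<^sub>R i)" by (simp add: euclidean_representation)
    also have "\<dots> = (\<Sum>i\<in>Basis. (h \<bullet> i) * f' i)"
      by (simp add: linear_sum[OF lin] linear_cmul[OF lin])
    finally show "f' h = h \<bullet> (\<Sum>i\<in>Basis. f' i *\<^sub>R i)" by (simp add: inner_sum_right mult.commute)
  qed
  with f' have "GDERIV f x :> (\<Sum>i\<in>Basis. f' i *\<^sub>R i)" by (simp add: gderiv_def)
  then show ?thesis using gradient_eqI by metis
qed

lemma GDERIV_imp_differentiable: "GDERIV f x :> D \<Longrightarrow> f differentiable (at x)"
  unfolding gderiv_def differentiable_def by blast

section \<open>Closure properties of the smoothness classes \<open>C_k\<close>\<close>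

lemma C_k_SucI:
  assumes "\<And>x. GDERIV f x :> D x" and "\<And>i. C_k k (\<lambda>x. D x $ i)"
  shows "C_k (Suc k) f"
proof -
  have "gradient f = D" using assms(1) by (intro ext gradient_eqI)
  moreover have "f differentiable (at x)" for x
    using assms(1) by (rule GDERIV_imp_differentiable)
  ultimately show ?thesis using assms(2) by simp
qed

lemma C_k_SucD:
  assumes "C_k (Suc k) f"
  obtains D where "\<And>x. GDERIV f x :> D x" "\<And>i. C_k k (\<lambda>x. D x $ i)"
  using assms differentiable_imp_GDERIV[of f] by (metis C_k.simps(2))

lemma C_k_Suc_imp: "C_k (Suc k) f \<Longrightarrow> C_k k f"
proof (induction k arbitrary: f)
  case 0
  then show ?case
    by (auto intro!: continuous_at_imp_continuous_on differentiable_imp_continuous_within)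
next
  case (Suc k)
  then obtain D where D: "\<And>x. GDERIV f x :> D x" "\<And>i. C_k (Suc k) (\<lambda>x. D x $ i)"
    using C_k_SucD by blast
  show ?case by (rule C_k_SucI[OF D(1)]) (use D(2) Suc.IH in blast)
qed

lemma C_k_const: "C_k k (\<lambda>x. c)"
proof (induction k arbitrary: c)
  case (Suc k)
  show ?case by (rule C_k_SucI[OF GDERIV_const]) (simp add: Suc.IH)
qed simp

lemma C_k_add: "C_k k f \<Longrightarrow> C_k k g \<Longrightarrow> C_k k (\<lambda>x. f x + g x)"
proof (induction k arbitrary: f g)
  case (Suc k)
  from Suc.prems(1) obtain D where D: "\<And>x. GDERIV f x :> D x" "\<And>i. C_k k (\<lambda>x. D x $ i)"
    using C_k_SucD by blast
  from Suc.prems(2) obtain D' where D': "\<And>x. GDERIV g x :> D' x" "\<And>i. C_k k (\<lambda>x. D' x $ i)"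
    using C_k_SucD by blast
  show ?case by (rule C_k_SucI[OF GDERIV_add[OF D(1) D'(1)]]) (simp add: Suc.IH D D')
qed (auto intro: continuous_on_add)

lemma C_k_mult: "C_k k f \<Longrightarrow> C_k k g \<Longrightarrow> C_k k (\<lambda>x. f x * g x)"
proof (induction k arbitrary: f g)
  case (Suc k)
  from Suc.prems(1) obtain D where D: "\<And>x. GDERIV f x :> D x" "\<And>i. C_k k (\<lambda>x. D x $ i)"
    using C_k_SucD by blast
  from Suc.prems(2) obtain D' where D': "\<And>x. GDERIV g x :> D' x" "\<And>i. C_k k (\<lambda>x. D' x $ i)"
    using C_k_SucD by blast
  show ?case
    by (rule C_k_SucI[OF GDERIV_mult[OF D(1) D'(1)]])
      (simp add: Suc.IH C_k_add D D' C_k_Suc_imp[OF Suc.prems(1)] C_k_Suc_imp[OF Suc.prems(2)])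
qed (auto intro: continuous_on_mult)

lemma GDERIV_affine: "GDERIV (\<lambda>x. a \<bullet> x + c) x :> a"
  unfolding gderiv_def by (auto intro!: derivative_eq_intros simp: inner_commute)

lemma C_k_affine: "C_k k (\<lambda>x. a \<bullet> x + c)"
proof (cases k)
  case (Suc k')
  show ?thesis unfolding Suc by (rule C_k_SucI[OF GDERIV_affine C_k_const])
qed (auto intro!: continuous_intros)

text \<open>The derivatives of \<open>x \<mapsto> exp (- 1 / x)\<close>, extended by zero, are of the same shape with a
  polynomial factor in \<open>1 / x\<close>.\<close>

definition flat_fun :: "real poly \<Rightarrow> real \<Rightarrow> real" where
  "flat_fun q x = (if x > 0 then poly q (1 / x) * exp (- (1 / x)) else 0)"

text \<open>Chain rule with \<open>y = 1/x\<close> and \<open>dy/dx = -y^2\<close>: the derivative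
  of \<open>q(y) exp(-y)\<close> is \<open>y^2 (q - q')(y) exp(-y)\<close>.\<close>

definition flat_step :: "real poly \<Rightarrow> real poly" where
  "flat_step q = monom 1 2 * (q - pderiv q)"

lemma poly_exp_neg_tendsto_0: "((\<lambda>y. poly q y * exp (- y)) \<longlongrightarrow> 0) (at_top :: real filter)"
proof -
  have "((\<lambda>y. \<Sum>i\<le>degree q. coeff q i * (y ^ i / exp y)) \<longlongrightarrow> (\<Sum>i\<le>degree q. coeff q i * 0)) (at_top :: real filter)"
    by (intro tendsto_intros tendsto_power_div_exp_0)
  then show ?thesis by (simp add: poly_altdef exp_minus field_simps sum_divide_distrib)
qed

lemma flat_fun_tendsto_0: "((\<lambda>x. flat_fun q x) \<longlongrightarrow> 0) (at 0)"
proof -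
  have l: "((\<lambda>x. flat_fun q x) \<longlongrightarrow> 0) (at_left 0)"
    by (rule Lim_transform_eventually[of "\<lambda>_. 0"])
      (auto simp: flat_fun_def eventually_at_filter)
  have "filterlim (\<lambda>x::real. 1 / x) at_top (at_right 0)"
    using filterlim_inverse_at_top_right by (simp add: divide_inverse)
  then have "((\<lambda>x. poly q (1/x) * exp (- (1/x))) \<longlongrightarrow> 0) (at_right 0)"
    using filterlim_compose[OF poly_exp_neg_tendsto_0] by blast
  then have r: "((\<lambda>x. flat_fun q x) \<longlongrightarrow> 0) (at_right 0)"
    by (rule Lim_transform_eventually)
      (auto simp: flat_fun_def eventually_at_filter)
  show ?thesis using l r by (simp add: filterlim_split_at)
qed

lemma DERIV_flat_fun: "(flat_fun q has_real_derivative flat_fun (flat_step q) x) (at x)"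
proof (cases x "0::real" rule: linorder_cases)
  case less
  have "((\<lambda>_. 0) has_real_derivative flat_fun (flat_step q) x) (at x)"
    using less by (simp add: flat_fun_def)
  then show ?thesis
    by (rule has_field_derivative_transform_within_open[where S="{..<0}"])
      (use less in \<open>auto simp: flat_fun_def\<close>)
next
  case greater
  have "((\<lambda>x. poly q (1 / x) * exp (- (1 / x))) has_real_derivative flat_fun (flat_step q) x) (at x)"
    using greater
    by (auto intro!: derivative_eq_intros simp: flat_fun_def flat_step_def poly_monom power2_eq_square field_simps)
  then show ?thesis
    by (rule has_field_derivative_transform_within_open[where S="{0<..}"])
      (use greater in \<open>auto simp: flat_fun_def\<close>)
next
  case equal
  \<comment> \<open>Dividing by \<open>h\<close> multiplies \<open>q\<close> by its variable, so the
    difference quotient at 0 is again of the form \<open>flat_fun\<close> and its limit is already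
    known.\<close>
  have "((\<lambda>h. flat_fun (pCons 0 q) h) \<longlongrightarrow> 0) (at 0)" by (rule flat_fun_tendsto_0)
  then have "((\<lambda>h. (flat_fun q (0 + h) - flat_fun q 0) / h) \<longlongrightarrow> 0) (at 0)"
    by (rule Lim_transform_eventually) (auto simp: flat_fun_def eventually_at_filter)
  then show ?thesis
    using equal by (simp add: DERIV_def flat_fun_def)
qed

lemma C_k_flat_fun: "C_k k (\<lambda>x. flat_fun q (a \<bullet> x + c))"
proof (induction k arbitrary: q)
  case 0
  have "continuous_on UNIV (flat_fun q)"
    using DERIV_flat_fun by (metis DERIV_isCont continuous_at_imp_continuous_on)
  then have "continuous_on UNIV (flat_fun q \<circ> (\<lambda>x. a \<bullet> x + c))"
    by (intro continuous_on_compose continuous_intros) (auto elim: continuous_on_subset)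
  then show ?case by (simp add: o_def)
next
  case (Suc k)
  have "GDERIV (\<lambda>x. flat_fun q (a \<bullet> x + c)) x :> flat_fun (flat_step q) (a \<bullet> x + c) *\<^sub>R a" for x
    by (rule GDERIV_DERIV_compose[OF GDERIV_affine DERIV_flat_fun])
  then show ?case
    by (rule C_k_SucI) (auto intro!: C_k_mult C_k_const Suc.IH)
qed

definition flat :: "real \<Rightarrow> real" where "flat = flat_fun 1"
definition flat' :: "real \<Rightarrow> real" where "flat' = flat_fun (flat_step 1)"

lemma flat_eq: "flat x = (if x > 0 then exp (- (1 / x)) else 0)"
  by (simp add: flat_def flat_fun_def)

lemma flat'_eq: "flat' x = (if x > 0 then (1 / x)\<^sup>2 * exp (- (1 / x)) else 0)"
  by (simp add: flat'_def flat_fun_def flat_step_def poly_monom)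

lemma DERIV_flat: "(flat has_real_derivative flat' x) (at x)"
  unfolding flat_def flat'_def by (rule DERIV_flat_fun)

lemma flat_nonneg: "0 \<le> flat x" and flat_le_1: "flat x \<le> 1" and flat'_nonneg: "0 \<le> flat' x"
  by (auto simp: flat_eq flat'_eq)

lemma flat_tendsto_1: "(flat \<longlongrightarrow> 1) at_top"
proof -
  have "((\<lambda>x::real. exp (- (1 / x))) \<longlongrightarrow> exp (- 0)) at_top"
    by (intro tendsto_intros tendsto_divide_0[OF tendsto_const] filterlim_at_top_imp_at_infinity filterlim_ident)
  then show ?thesis
    by (simp, elim Lim_transform_eventually) (use eventually_gt_at_top[of 0] in eventually_elim, simp add: flat_eq)
qed

lemma flat'_borel [measurable]: "flat' \<in> borel_measurable borel"
proof -
  have "continuous_on UNIV (flat_fun q)" for q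
    using DERIV_flat_fun by (metis DERIV_isCont continuous_at_imp_continuous_on)
  then show ?thesis unfolding flat'_def by (auto intro: borel_measurable_continuous_onI)
qed

text \<open>\<open>flat\<close> rises from 0 to 1 on the half line, so its derivative has total mass
  1. This normalises the line measures that arise when the cutoffs are differentiated.\<close>

lemma flat'_integral: "has_bochner_integral lborel flat' 1"
proof -
  have eq: "flat' x = flat' x * indicator {0..} x" for x
    by (auto simp: flat'_eq indicator_def)
  have "(\<integral>\<^sup>+x. ennreal (flat' x) * indicator {0..} x \<partial>lborel) = ennreal (1 - flat 0)"
    by (rule nn_integral_FTC_atLeast[OF flat'_borel DERIV_flat flat'_nonneg flat_tendsto_1])
  moreover have "ennreal (flat' x) * indicator {0..} x = ennreal (flat' x)" for x
    by (auto simp: flat'_eq indicator_def)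
  ultimately have "(\<integral>\<^sup>+x. ennreal (flat' x) \<partial>lborel) = ennreal 1"
    by (simp add: flat_eq)
  then show ?thesis
    by (intro has_bochner_integral_nn_integral) (auto simp: flat'_nonneg)
qed

section \<open>Integration in affine coordinates\<close>

text \<open>The determinant with columns \<open>u\<close> and \<open>v\<close>; for two edge vectors
  of a triangle, twice its signed area.\<close>

definition cross2 :: "plane \<Rightarrow> plane \<Rightarrow> real" where
  "cross2 u v = u $ 1 * v $ 2 - u $ 2 * v $ 1"

lemma box_plane_eq: "box l r = {x::plane. l$1 < x$1 \<and> x$1 < r$1 \<and> l$2 < x$2 \<and> x$2 < r$2}"
  by (auto simp: mem_box_cart forall_2)

lemma borel_measurable_plane_vector:
  "(\<lambda>z. vector [fst z, snd z] :: plane) \<in> borel_measurable (lborel \<Otimes>\<^sub>M lborel)"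
proof -
  have "(\<lambda>z::real\<times>real. vector [fst z, snd z] :: plane) = (\<lambda>z. fst z *\<^sub>R axis 1 1 + snd z *\<^sub>R axis 2 1)"
    by (simp add: fun_eq_iff vec_eq_iff forall_2 axis_def)
  then have "continuous_on UNIV (\<lambda>z::real\<times>real. vector [fst z, snd z] :: plane)"
    by (simp only:) (intro continuous_intros)
  then show ?thesis by (simp add: lborel_prod borel_measurable_continuous_onI)
qed

text \<open>Both measures agree on boxes. Lebesgue measure on \<open>real^2\<close> as a product
  makes Fubini's theorem available for plane integrals.\<close>

lemma lborel_plane_eq:
  "distr (lborel \<Otimes>\<^sub>M lborel) borel (\<lambda>z. vector [fst z, snd z] :: plane) = lborel"
proof (rule lborel_eqI[symmetric])
  fix l u :: plane
  assume lu: "\<And>b. b \<in> Basis \<Longrightarrow> l \<bullet> b \<le> u \<bullet> b"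
  have le: "l $ i \<le> u $ i" for i
    using lu[of "axis i 1"] by (simp add: inner_axis)
  have meas: "(\<lambda>z. vector [fst z, snd z] :: plane) \<in> borel_measurable (lborel \<Otimes>\<^sub>M lborel)"
    by (rule borel_measurable_plane_vector)
  have "(\<lambda>z::real\<times>real. vector [fst z, snd z] :: plane) -` box l u
      = {l$1<..<u$1} \<times> {l$2<..<u$2}"
    by (auto simp: box_plane_eq)
  then have "emeasure (distr (lborel \<Otimes>\<^sub>M lborel) borel (\<lambda>z. vector [fst z, snd z])) (box l u)
     = emeasure (lborel \<Otimes>\<^sub>M lborel) ({l$1<..<u$1} \<times> {l$2<..<u$2})"
    using meas by (subst emeasure_distr) (auto simp: space_pair_measure)
  also have "\<dots> = ennreal ((u$1 - l$1) * (u$2 - l$2))"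
    using le by (simp add: lborel.emeasure_pair_measure_Times ennreal_mult)
  also have "(u$1 - l$1) * (u$2 - l$2) = (\<Prod>b\<in>Basis. (u - l) \<bullet> b)"
    by (simp add: Basis_vec_def UNIV_2 axis_eq_axis inner_axis)
  finally show "emeasure (distr (lborel \<Otimes>\<^sub>M lborel) borel (\<lambda>z. vector [fst z, snd z])) (box l u)
     = (\<Prod>b\<in>Basis. (u - l) \<bullet> b)" .
qed simp

text \<open>Boxes determine the measure. The preimage of a box is measured by the determinant
  formula for linear images, and \<open>cross2 u v\<close> is the determinant of
  \<open>g\<close>.\<close>

lemma lborel_plane_linear:
  fixes u v :: plane
  assumes "cross2 u v \<noteq> 0"
  defines "g \<equiv> \<lambda>x::plane. x$1 *\<^sub>R u + x$2 *\<^sub>R v"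
  shows "lborel = density (distr lborel borel g) (\<lambda>_. ennreal \<bar>cross2 u v\<bar>)"
proof (rule lborel_eqI)
  have lin: "linear g" unfolding g_def
    by (rule linearI) (auto simp: algebra_simps scaleR_add_left)
  have det: "det (matrix g) = cross2 u v"
    by (simp add: det_2 matrix_def g_def cross2_def axis_def)
  with assms(1) have inv: "inj g" using det_nz_iff_inj[OF lin] by simp
  then have bij: "bij g" using lin linear_injective_imp_surjective bij_def by blast
  obtain h where h: "linear h" "\<And>x. h (g x) = x" "\<And>x. g (h x) = x"
    using linear_injective_isomorphism[OF lin inv] by blast
  have cont: "continuous_on UNIV g" using lin linear_continuous_on linear_conv_bounded_linear by blast
  fix l r :: plane
  assume lr: "\<And>b. b \<in> Basis \<Longrightarrow> l \<bullet> b \<le> r \<bullet> b"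
  let ?S = "g -` box l r"
  have S: "?S = h ` box l r"
  proof (intro set_eqI iffI)
    fix x assume "x \<in> ?S"
    then show "x \<in> h ` box l r" using h(2)[of x] by (metis imageI vimageD)
  qed (use h(3) in auto)
  have opS: "open ?S" using cont by (intro open_vimage open_box)
  have "bounded ?S" unfolding S
    using h(1) bounded_linear_image linear_conv_bounded_linear bounded_box by blast
  with opS have lm: "?S \<in> lmeasurable" using lmeasurable_open by blast
  have img: "g ` ?S = box l r" using bij by (simp add: surj_image_vimage_eq bij_def)
  have "measure lebesgue (box l r) = \<bar>cross2 u v\<bar> * measure lebesgue ?S"
    using measure_linear_image[OF lin lm] img det by simp
  then have m: "(\<Prod>b\<in>Basis. (r - l) \<bullet> b) = \<bar>cross2 u v\<bar> * measure lborel ?S"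
    using lr opS by (simp add: measure_completion inner_diff_left)
  have fin: "emeasure lborel ?S < \<infinity>"
    using \<open>bounded ?S\<close> emeasure_bounded_finite by blast
  have "emeasure (density (distr lborel borel g) (\<lambda>_. ennreal \<bar>cross2 u v\<bar>)) (box l r)
    = ennreal \<bar>cross2 u v\<bar> * emeasure (distr lborel borel g) (box l r)"
    by (simp add: emeasure_density_const)
  also have "emeasure (distr lborel borel g) (box l r) = emeasure lborel ?S"
    using cont by (subst emeasure_distr) (auto intro: borel_measurable_continuous_onI)
  also have "\<dots> = ennreal (measure lborel ?S)"
    using fin by (simp add: emeasure_eq_ennreal_measure)
  finally show "emeasure (density (distr lborel borel g) (\<lambda>_. ennreal \<bar>cross2 u v\<bar>)) (box l r)
     = (\<Prod>b\<in>Basis. (r - l) \<bullet> b)"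
    using m by (simp add: ennreal_mult)
qed simp

text \<open>The map is the identification of pairs with plane vectors, followed by a linear map and
  a translation; the image measure is known for each of the three.\<close>

lemma lborel_plane_param:
  fixes P u v :: plane
  assumes "cross2 u v \<noteq> 0"
  defines "T \<equiv> \<lambda>z. P + fst z *\<^sub>R u + snd z *\<^sub>R v"
  shows "T \<in> borel_measurable (lborel \<Otimes>\<^sub>M lborel)"
    and "lborel = density (distr (lborel \<Otimes>\<^sub>M lborel) borel T) (\<lambda>_. ennreal \<bar>cross2 u v\<bar>)"
proof -
  let ?g = "\<lambda>x::plane. x$1 *\<^sub>R u + x$2 *\<^sub>R v"
  let ?J = "\<lambda>z. vector [fst z, snd z] :: plane"
  have J: "?J \<in> borel_measurable (lborel \<Otimes>\<^sub>M lborel)"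
    by (rule borel_measurable_plane_vector)
  have g: "?g \<in> borel_measurable borel"
    by (auto intro!: borel_measurable_continuous_onI continuous_intros)
  have T: "T = (\<lambda>x. P + x) \<circ> ?g \<circ> ?J"
    by (auto simp: T_def fun_eq_iff)
  show "T \<in> borel_measurable (lborel \<Otimes>\<^sub>M lborel)"
    unfolding T o_assoc[symmetric] comp_def using g J by measurable
  have "distr (lborel \<Otimes>\<^sub>M lborel) borel T = distr (distr (distr (lborel \<Otimes>\<^sub>M lborel) borel ?J) borel ?g) borel ((+) P)"
    unfolding T using g J by (simp add: distr_distr o_assoc comp_def measurable_compose)
  also have "\<dots> = distr (distr lborel borel ?g) borel ((+) P)"
    by (simp only: lborel_plane_eq)
  finally have d: "distr (lborel \<Otimes>\<^sub>M lborel) borel T = distr (distr lborel borel ?g) borel ((+) P)" .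
  have "lborel = distr lborel borel ((+) P)" by (simp add: lborel_distr_plus)
  also have "\<dots> = distr (density (distr lborel borel ?g) (\<lambda>_. ennreal \<bar>cross2 u v\<bar>)) borel ((+) P)"
    using lborel_plane_linear[OF assms(1)] by simp
  also have "\<dots> = density (distr (distr lborel borel ?g) borel ((+) P)) (\<lambda>_. ennreal \<bar>cross2 u v\<bar>)"
    by (subst density_distr) auto
  finally show "lborel = density (distr (lborel \<Otimes>\<^sub>M lborel) borel T) (\<lambda>_. ennreal \<bar>cross2 u v\<bar>)"
    unfolding d .
qed

lemma plane_integral_param:
  fixes P u v :: plane and f :: "plane \<Rightarrow> real"
  assumes "cross2 u v \<noteq> 0" and f [measurable]: "f \<in> borel_measurable borel"
  shows "(LINT x|lborel. f x) = \<bar>cross2 u v\<bar> * (LINT z|(lborel \<Otimes>\<^sub>M lborel). f (P + fst z *\<^sub>R u + snd z *\<^sub>R v))"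
proof -
  let ?T = "\<lambda>z. P + fst z *\<^sub>R u + snd z *\<^sub>R v"
  note T = lborel_plane_param[OF assms(1), of P]
  have "(LINT x|lborel. f x) = (LINT x|(density (distr (lborel \<Otimes>\<^sub>M lborel) borel ?T) (\<lambda>_. ennreal \<bar>cross2 u v\<bar>)). f x)"
    using T(2) by simp
  also have "\<dots> = (LINT x|(distr (lborel \<Otimes>\<^sub>M lborel) borel ?T). \<bar>cross2 u v\<bar> *\<^sub>R f x)"
    by (subst integral_density) auto
  also have "\<dots> = (LINT z|(lborel \<Otimes>\<^sub>M lborel). \<bar>cross2 u v\<bar> *\<^sub>R f (?T z))"
    using T(1) by (subst integral_distr) auto
  finally show ?thesis by simp
qed

section \<open>The weak divergence\<close>

lemma test_function_gradient:
  assumes "test_function U \<phi>"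
  shows "GDERIV \<phi> x :> gradient \<phi> x" and "continuous_on UNIV (\<lambda>x. gradient \<phi> x $ i)"
    and "x \<notin> closure {x. \<phi> x \<noteq> 0} \<Longrightarrow> gradient \<phi> x = 0"
proof -
  from assms have "C_k (Suc 0) \<phi>" unfolding test_function_def by blast
  then show d: "GDERIV \<phi> x :> gradient \<phi> x" and "continuous_on UNIV (\<lambda>x. gradient \<phi> x $ i)"
    using differentiable_imp_GDERIV by auto
  assume x: "x \<notin> closure {x. \<phi> x \<noteq> 0}"
  have "((\<lambda>_. 0) has_derivative (\<lambda>h. h \<bullet> gradient \<phi> x)) (at x)"
    using d unfolding gderiv_def
    by (rule has_derivative_transform_within_open[where s="- closure {x. \<phi> x \<noteq> 0}"])
      (use x closure_subset[of "{x. \<phi> x \<noteq> 0}"] in auto)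
  then have "GDERIV (\<lambda>_. 0) x :> gradient \<phi> x" by (simp add: gderiv_def)
  then show "gradient \<phi> x = 0"
    using gradient_eqI[of "\<lambda>_. 0"] GDERIV_const[of 0 x] by metis
qed

lemma lebesgue_on_integral_cong_support:
  fixes f :: "plane \<Rightarrow> real"
  assumes "S \<in> sets lebesgue" "T \<in> sets lebesgue"
    and "\<And>x. x \<notin> S \<inter> T \<Longrightarrow> f x = 0"
  shows "(LINT x|lebesgue_on S. f x) = (LINT x|lebesgue_on T. f x)"
    and "integrable (lebesgue_on S) f \<longleftrightarrow> integrable (lebesgue_on T) f"
proof -
  have e: "(\<lambda>x. indicator S x *\<^sub>R f x) = (\<lambda>x. indicator T x *\<^sub>R f x)"
    using assms(3) by (auto simp: indicator_def fun_eq_iff)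
  have S: "S \<inter> space lebesgue \<in> sets lebesgue" and T: "T \<inter> space lebesgue \<in> sets lebesgue"
    using assms by auto
  show "(LINT x|lebesgue_on S. f x) = (LINT x|lebesgue_on T. f x)"
    unfolding integral_restrict_space[OF S] integral_restrict_space[OF T] e ..
  show "integrable (lebesgue_on S) f \<longleftrightarrow> integrable (lebesgue_on T) f"
    unfolding integrable_restrict_space[OF S] integrable_restrict_space[OF T] e ..
qed

text \<open>A continuous factor is bounded on the compact set \<open>C\<close>, so integrability of
  \<open>g\<close> on \<open>C\<close> carries over to the product, which vanishes
  elsewhere.\<close>

lemma locally_integrable_mult:
  fixes g h :: "plane \<Rightarrow> real"
  assumes "locally_integrable U g" "open U" "compact C" "C \<subseteq> U" "continuous_on UNIV h"
    and "\<And>x. x \<notin> C \<Longrightarrow> h x = 0"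
  shows "integrable (lebesgue_on U) (\<lambda>x. g x * h x)"
proof -
  have C: "C \<in> sets lebesgue" and U: "U \<in> sets lebesgue"
    using assms by (auto simp: borel_compact)
  have g: "integrable (lebesgue_on C) g" using assms by (simp add: locally_integrable_def)
  obtain B where B: "\<And>x. x \<in> C \<Longrightarrow> \<bar>h x\<bar> \<le> B"
    using compact_imp_bounded[OF compact_continuous_image[OF continuous_on_subset[OF assms(5)] assms(3)]]
    by (auto simp: bounded_iff)
  have "integrable (lebesgue_on C) (\<lambda>x. g x * h x)"
  proof (rule Bochner_Integration.integrable_bound[of _ "\<lambda>x. B * g x"])
    show "integrable (lebesgue_on C) (\<lambda>x. B * g x)" using g by simp
    have "h \<in> borel_measurable borel" using assms(5) by (rule borel_measurable_continuous_onI)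
    then have "h \<in> borel_measurable (lebesgue_on C)"
      by (intro measurable_restrict_space1 measurable_completion) simp
    then show "(\<lambda>x. g x * h x) \<in> borel_measurable (lebesgue_on C)" using g by simp
    show "AE x in lebesgue_on C. norm (g x * h x) \<le> norm (B * g x)"
    proof (rule AE_I2)
      fix x assume "x \<in> space (lebesgue_on C)"
      then have "\<bar>h x\<bar> \<le> B" using B by simp
      then have "\<bar>h x\<bar> \<le> \<bar>B\<bar>" by linarith
      then show "norm (g x * h x) \<le> norm (B * g x)"
        using mult_right_mono[of "\<bar>h x\<bar>" "\<bar>B\<bar>" "\<bar>g x\<bar>"] by (simp add: abs_mult mult.commute[of "\<bar>g x\<bar>"])
    qed
  qed
  moreover have "integrable (lebesgue_on U) (\<lambda>x. g x * h x) \<longleftrightarrow> integrable (lebesgue_on C) (\<lambda>x. g x * h x)"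
    by (rule lebesgue_on_integral_cong_support(2)) (use C U assms in auto)
  ultimately show ?thesis by simp
qed

lemma has_weak_partial_weak_partial:
  assumes "in_W1inf U b"
  shows "has_weak_partial U i (\<lambda>x. b x $ k) (weak_partial U i (\<lambda>x. b x $ k))"
  using assms unfolding in_W1inf_def weak_partial_def by (metis someI_ex)

lemma in_Linf_bounded:
  assumes "in_Linf S f"
  obtains B where "B \<ge> 0" "AE x in lebesgue_on S. \<bar>f x\<bar> \<le> B"
proof -
  let ?M = "lebesgue_on S"
  let ?e = "esssup ?M (\<lambda>x. ereal \<bar>f x\<bar>)"
  have "AE x in ?M. ereal \<bar>f x\<bar> \<le> ?e" by (rule esssup_AE)
  moreover have "?e < \<infinity>" using assms by (simp add: in_Linf_def)
  then obtain B where "?e \<le> ereal B" by (cases ?e) auto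
  \<comment> \<open>On a null set the essential supremum is minus infinity, so the bound is raised
    to 0 where necessary.\<close>
  ultimately have "AE x in ?M. \<bar>f x\<bar> \<le> max B 0"
    by (auto elim!: eventually_mono dest: order_trans simp: le_max_iff_disj)
  then show ?thesis using that[of "max B 0"] by simp
qed

lemma in_Linf_locally_integrable:
  assumes "in_Linf U f" "open U"
  shows "locally_integrable U f"
  unfolding locally_integrable_def
proof safe
  fix C assume C: "compact C" "C \<subseteq> U"
  obtain B where B: "AE x in lebesgue_on U. \<bar>f x\<bar> \<le> B" using in_Linf_bounded[OF assms(1)] by blast
  have sC: "C \<in> sets lebesgue" and sU: "U \<in> sets lebesgue" using C assms by (auto simp: borel_compact)
  have "AE x in lebesgue. x \<in> U \<longrightarrow> \<bar>f x\<bar> \<le> B"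
    using B sU by (simp add: AE_restrict_space_iff)
  then have "AE x in lebesgue_on C. \<bar>f x\<bar> \<le> B"
    using sC C(2) by (auto simp: AE_restrict_space_iff elim!: eventually_mono)
  moreover have "f \<in> borel_measurable (lebesgue_on C)"
    using assms C(2) measurable_restrict_mono unfolding in_Linf_def by blast
  moreover
  have "emeasure (lebesgue_on C) (space (lebesgue_on C)) < \<infinity>"
    using C(1) sC lmeasurable_compact[OF C(1)]
    by (auto simp: emeasure_restrict_space fmeasurable_def)
  then have "finite_measure (lebesgue_on C)" by (intro finite_measureI) auto
  ultimately show "integrable (lebesgue_on C) f"
    by (intro finite_measure.integrable_const_bound[of _ _ B]) auto
qed

text \<open>Only the lower bound on \<open>\<mu> - div b / 2\<close> is used, tested with non-negative functions. This
  avoids any regularity of the weak divergence up to the boundary.\<close>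

lemma weak_coercivity:
  assumes "open \<Omega>" and b: "in_W1inf \<Omega> b" and mu: "in_Linf \<Omega> \<mu>"
    and AE: "AE x in lebesgue_on \<Omega>. \<mu> x - 1/2 * weak_div \<Omega> b x \<ge> \<alpha>"
    and \<phi>: "test_function \<Omega> \<phi>" and nonneg: "\<And>x. \<phi> x \<ge> 0"
  shows "1/2 * (LINT x|lebesgue_on \<Omega>. b x \<bullet> gradient \<phi> x) + (LINT x|lebesgue_on \<Omega>. \<mu> x * \<phi> x)
     \<ge> \<alpha> * (LINT x|lebesgue_on \<Omega>. \<phi> x)"
proof -
  let ?C = "closure {x. \<phi> x \<noteq> 0}"
  let ?d = "\<lambda>i. weak_partial \<Omega> i (\<lambda>x. b x $ i)"
  have C: "compact ?C" "?C \<subseteq> \<Omega>" using \<phi> by (auto simp: test_function_def)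
  have \<phi>0: "\<phi> x = 0" if "x \<notin> ?C" for x using that closure_subset[of "{x. \<phi> x \<noteq> 0}"] by auto
  have cont: "continuous_on UNIV \<phi>" using \<phi> unfolding test_function_def by (metis C_k.simps(1))
  have w: "has_weak_partial \<Omega> i (\<lambda>x. b x $ i) (?d i)" for i
    using has_weak_partial_weak_partial[OF b] .
  have eq: "(LINT x|lebesgue_on \<Omega>. b x $ i * gradient \<phi> x $ i) = - (LINT x|lebesgue_on \<Omega>. ?d i x * \<phi> x)" for i
    using w[of i] \<phi> by (simp add: has_weak_partial_def)
  have i1: "integrable (lebesgue_on \<Omega>) (\<lambda>x. b x $ i * gradient \<phi> x $ i)" for i
    by (rule locally_integrable_mult[OF _ \<open>open \<Omega>\<close> C test_function_gradient(2)[OF \<phi>]])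
      (use w[of i] test_function_gradient(3)[OF \<phi>] in \<open>auto simp: has_weak_partial_def\<close>)
  have i2: "integrable (lebesgue_on \<Omega>) (\<lambda>x. ?d i x * \<phi> x)" for i
    by (rule locally_integrable_mult[OF _ \<open>open \<Omega>\<close> C cont \<phi>0])
      (use w[of i] in \<open>auto simp: has_weak_partial_def\<close>)
  have i3: "integrable (lebesgue_on \<Omega>) (\<lambda>x. \<mu> x * \<phi> x)"
    by (rule locally_integrable_mult[OF in_Linf_locally_integrable[OF mu \<open>open \<Omega>\<close>] \<open>open \<Omega>\<close> C cont \<phi>0])
  have li1: "locally_integrable \<Omega> (\<lambda>x. 1)"
    unfolding locally_integrable_def
  proof safe
    fix C :: "plane set" assume "compact C"
    then have "emeasure (lebesgue_on C) (space (lebesgue_on C)) < \<infinity>"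
      using lmeasurable_compact[of C] by (auto simp: emeasure_restrict_space fmeasurable_def)
    then show "integrable (lebesgue_on C) (\<lambda>x. 1::real)"
      by (intro finite_measure.integrable_const finite_measureI) auto
  qed
  have i4: "integrable (lebesgue_on \<Omega>) (\<lambda>x. 1 * \<phi> x)"
    by (rule locally_integrable_mult[OF li1 \<open>open \<Omega>\<close> C cont \<phi>0])
  have div: "(\<lambda>x. weak_div \<Omega> b x * \<phi> x) = (\<lambda>x. \<Sum>i\<in>UNIV. ?d i x * \<phi> x)"
    by (simp add: weak_div_def sum_distrib_right)
  have i5: "integrable (lebesgue_on \<Omega>) (\<lambda>x. weak_div \<Omega> b x * \<phi> x)"
    unfolding div by (intro Bochner_Integration.integrable_sum i2)
  have "(LINT x|lebesgue_on \<Omega>. b x \<bullet> gradient \<phi> x) = (LINT x|lebesgue_on \<Omega>. (\<Sum>i\<in>UNIV. b x $ i * gradient \<phi> x $ i))"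
    by (simp add: inner_vec_def)
  also have "\<dots> = (\<Sum>i\<in>UNIV. - (LINT x|lebesgue_on \<Omega>. ?d i x * \<phi> x))"
    using i1 eq by (subst Bochner_Integration.integral_sum) auto
  also have "\<dots> = - (LINT x|lebesgue_on \<Omega>. weak_div \<Omega> b x * \<phi> x)"
    unfolding div using i2 by (subst Bochner_Integration.integral_sum) (auto simp: sum_negf)
  finally have e: "(LINT x|lebesgue_on \<Omega>. b x \<bullet> gradient \<phi> x) = - (LINT x|lebesgue_on \<Omega>. weak_div \<Omega> b x * \<phi> x)" .
  have "(LINT x|lebesgue_on \<Omega>. \<alpha> * (1 * \<phi> x)) \<le> (LINT x|lebesgue_on \<Omega>. \<mu> x * \<phi> x - 1/2 * (weak_div \<Omega> b x * \<phi> x))"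
  proof (rule integral_mono_AE)
    show "AE x in lebesgue_on \<Omega>. \<alpha> * (1 * \<phi> x) \<le> \<mu> x * \<phi> x - 1/2 * (weak_div \<Omega> b x * \<phi> x)"
      using AE
    proof eventually_elim
      case (elim x)
      from mult_right_mono[OF elim nonneg[of x]] show ?case by (simp add: algebra_simps)
    qed
  qed (use i3 i4 i5 in auto)
  also have "\<dots> = (LINT x|lebesgue_on \<Omega>. \<mu> x * \<phi> x) - 1/2 * (LINT x|lebesgue_on \<Omega>. weak_div \<Omega> b x * \<phi> x)"
    using i3 i5 by simp
  finally show ?thesis using e by simp
qed

section \<open>Barycentric coordinates\<close>

definition tri :: "plane \<Rightarrow> plane \<Rightarrow> plane \<Rightarrow> bool" where
  "tri P Q R \<longleftrightarrow> cross2 (Q - P) (R - P) \<noteq> 0"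

definition perp :: "plane \<Rightarrow> plane" where
  "perp w = vector [- (w $ 2), w $ 1]"

text \<open>\<open>bary P Q R\<close> is the coordinate of the last vertex \<open>R\<close>; it vanishes on the line through \<open>P\<close> and \<open>Q\<close>.\<close>

definition bary :: "plane \<Rightarrow> plane \<Rightarrow> plane \<Rightarrow> plane \<Rightarrow> real" where
  "bary P Q R x = cross2 (Q - P) (x - P) / cross2 (Q - P) (R - P)"

text \<open>Since \<open>cross2 w x = perp w \<bullet> x\<close>, this constant vector is the
  gradient of \<open>bary P Q R\<close>: perpendicular to the edge \<open>PQ\<close> and pointing to
  the side of \<open>R\<close>.\<close>

definition bary_grad :: "plane \<Rightarrow> plane \<Rightarrow> plane \<Rightarrow> plane" where
  "bary_grad P Q R = (1 / cross2 (Q - P) (R - P)) *\<^sub>R perp (Q - P)"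

lemma inner_plane: "(x::plane) \<bullet> y = x$1 * y$1 + x$2 * y$2"
  by (simp add: inner_vec_def UNIV_2)

lemma plane_eq_iff: "(x::plane) = y \<longleftrightarrow> x$1 = y$1 \<and> x$2 = y$2"
  by (simp add: vec_eq_iff forall_2)

lemma perp_nth [simp]: "perp w $ 1 = - (w $ 2)" "perp w $ 2 = w $ 1"
  by (simp_all add: perp_def)

lemma norm_perp [simp]: "norm (perp w) = norm w"
  by (simp add: norm_eq_sqrt_inner inner_plane algebra_simps)

lemma cross2_cyc: "cross2 (R - Q) (P - Q) = cross2 (Q - P) (R - P)"
  "cross2 (P - R) (Q - R) = cross2 (Q - P) (R - P)"
  by (simp_all add: cross2_def algebra_simps)

lemma cross2_swap: "cross2 (P - Q) (R - Q) = - cross2 (Q - P) (R - P)"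
  by (simp add: cross2_def algebra_simps)

lemma tri_cyc: "tri P Q R \<Longrightarrow> tri Q R P" "tri P Q R \<Longrightarrow> tri R P Q"
  unfolding tri_def using cross2_cyc by simp_all

lemma tri_swap: "tri P Q R \<Longrightarrow> tri Q P R"
  unfolding tri_def using cross2_swap[of P Q R] by simp

lemma tri_neq: "tri P Q R \<Longrightarrow> P \<noteq> Q" "tri P Q R \<Longrightarrow> Q \<noteq> R" "tri P Q R \<Longrightarrow> R \<noteq> P"
  by (auto simp: tri_def cross2_def algebra_simps)

lemma bary_affine: "bary P Q R x = bary_grad P Q R \<bullet> x + bary P Q R 0"
  by (simp add: bary_def bary_grad_def inner_plane cross2_def field_simps diff_divide_distrib add_divide_distrib)

lemma bary_vertices: "bary P Q R P = 0" "bary P Q R Q = 0" "tri P Q R \<Longrightarrow> bary P Q R R = 1"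
  by (simp_all add: bary_def cross2_def tri_def)

lemma bary_sum: assumes "tri P Q R" shows "bary P Q R x + bary Q R P x + bary R P Q x = 1"
proof -
  have "cross2 (Q - P) (x - P) + cross2 (R - Q) (x - Q) + cross2 (P - R) (x - R) = cross2 (Q - P) (R - P)"
    by (simp add: cross2_def algebra_simps)
  with assms show ?thesis
    by (simp add: bary_def cross2_cyc tri_def add_divide_distrib[symmetric])
qed

lemma bary_combination:
  assumes "tri P Q R"
  shows "bary Q R P x *\<^sub>R P + bary R P Q x *\<^sub>R Q + bary P Q R x *\<^sub>R R = x"
proof -
  have "cross2 (R - Q) (x - Q) * P $ i + cross2 (P - R) (x - R) * Q $ i + cross2 (Q - P) (x - P) * R $ i
     = cross2 (Q - P) (R - P) * x $ i" for i
    using exhaust_2[of i] by (auto simp: cross2_def algebra_simps)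
  with assms show ?thesis
    by (simp add: vec_eq_iff bary_def cross2_cyc tri_def add_divide_distrib[symmetric])
qed

lemma bary_param:
  assumes "tri P Q R"
  shows "bary P Q R (P + s *\<^sub>R (Q - P) + t *\<^sub>R (R - P)) = t"
    and "bary R P Q (P + s *\<^sub>R (Q - P) + t *\<^sub>R (R - P)) = s"
    and "bary Q R P (P + s *\<^sub>R (Q - P) + t *\<^sub>R (R - P)) = 1 - s - t"
proof -
  let ?x = "P + s *\<^sub>R (Q - P) + t *\<^sub>R (R - P)"
  have x: "?x - P = s *\<^sub>R (Q - P) + t *\<^sub>R (R - P)"
    "?x - R = s *\<^sub>R (Q - P) + (t - 1) *\<^sub>R (R - P)" "P - R = (- 1) *\<^sub>R (R - P)"
    by (simp_all add: scaleR_left_diff_distrib)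
  have c: "cross2 u (s *\<^sub>R u + t *\<^sub>R v) = t * cross2 u v"
    "cross2 ((- 1) *\<^sub>R v) (s *\<^sub>R u + t *\<^sub>R v) = s * cross2 u v" for u v and s t :: real
    by (simp_all add: cross2_def algebra_simps)
  have "cross2 (Q - P) (?x - P) = t * cross2 (Q - P) (R - P)"
    unfolding x by (rule c)
  then show 1: "bary P Q R ?x = t" using assms by (simp add: bary_def tri_def)
  have "cross2 (P - R) (?x - R) = s * cross2 (Q - P) (R - P)"
    unfolding x by (rule c)
  then show 2: "bary R P Q ?x = s" using assms by (simp add: bary_def tri_def cross2_cyc)
  show "bary Q R P ?x = 1 - s - t" using bary_sum[OF assms, of ?x] 1 2 by simp
qed

lemma bary_affine_comb:
  assumes "u + v + w = 1"
  shows "bary P Q R (u *\<^sub>R A + v *\<^sub>R B + w *\<^sub>R C) = u * bary P Q R A + v * bary P Q R B + w * bary P Q R C"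
proof -
  have "bary P Q R (u *\<^sub>R A + v *\<^sub>R B + w *\<^sub>R C)
    = bary_grad P Q R \<bullet> (u *\<^sub>R A + v *\<^sub>R B + w *\<^sub>R C) + (u + v + w) * bary P Q R 0"
    using assms by (simp only: mult_1 bary_affine[symmetric])
  also have "\<dots> = u * bary P Q R A + v * bary P Q R B + w * bary P Q R C"
    by (subst (2 3 4) bary_affine) (simp add: inner_add_right algebra_simps)
  finally show ?thesis .
qed

lemma hull_eq_bary:
  assumes "tri P Q R"
  shows "convex hull {P, Q, R} = {x. 0 \<le> bary P Q R x \<and> 0 \<le> bary Q R P x \<and> 0 \<le> bary R P Q x}"
proof (intro set_eqI iffI)
  fix x assume "x \<in> convex hull {P, Q, R}"
  then obtain u v w where uvw: "0 \<le> u" "0 \<le> v" "0 \<le> w" "u + v + w = 1" "x = u *\<^sub>R P + v *\<^sub>R Q + w *\<^sub>R R"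
    by (auto simp: convex_hull_3)
  then show "x \<in> {x. 0 \<le> bary P Q R x \<and> 0 \<le> bary Q R P x \<and> 0 \<le> bary R P Q x}"
    using bary_vertices[of P Q R] bary_vertices[of Q R P] bary_vertices[of R P Q] assms tri_cyc[OF assms]
    by (simp add: bary_affine_comb)
next
  fix x assume x: "x \<in> {x. 0 \<le> bary P Q R x \<and> 0 \<le> bary Q R P x \<and> 0 \<le> bary R P Q x}"
  then show "x \<in> convex hull {P, Q, R}"
    unfolding convex_hull_3 using bary_sum[OF assms, of x] bary_combination[OF assms, of x, symmetric]
    by (intro CollectI exI[of _ "bary Q R P x"] exI[of _ "bary R P Q x"] exI[of _ "bary P Q R x"]) auto
qed

lemma bary_le_1:
  assumes "tri P Q R" "x \<in> convex hull {P, Q, R}"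
  shows "0 \<le> bary P Q R x" "bary P Q R x \<le> 1"
  using assms(2) bary_sum[OF assms(1), of x] by (auto simp: hull_eq_bary[OF assms(1)])

lemma continuous_bary: "continuous_on S (bary P Q R)"
proof -
  have "continuous_on S (\<lambda>x. bary_grad P Q R \<bullet> x + bary P Q R 0)"
    by (intro continuous_intros)
  then show ?thesis by (simp only: bary_affine[symmetric])
qed

lemma bary_pos_subset_interior:
  assumes "tri P Q R"
  shows "{x. 0 < bary P Q R x \<and> 0 < bary Q R P x \<and> 0 < bary R P Q x} \<subseteq> interior (convex hull {P, Q, R})"
proof (rule interior_maximal)
  show "open {x. 0 < bary P Q R x \<and> 0 < bary Q R P x \<and> 0 < bary R P Q x}"
    by (intro open_Collect_conj open_Collect_less continuous_on_const continuous_bary)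
qed (auto simp: hull_eq_bary[OF assms])

lemma bary_grad_nz: "tri P Q R \<Longrightarrow> bary_grad P Q R \<noteq> 0"
proof -
  assume t: "tri P Q R"
  then have "norm (bary_grad P Q R) = norm (Q - P) / \<bar>cross2 (Q - P) (R - P)\<bar>"
    by (simp add: bary_grad_def)
  also have "\<dots> \<noteq> 0" using t tri_neq[OF t] by (simp add: tri_def)
  finally show ?thesis by force
qed

text \<open>The zero set is a line. Off the three edge lines all cutoffs tend to 1 inside the
  triangle, so this provides convergence almost everywhere.\<close>

lemma AE_bary_nz: assumes "tri P Q R" shows "AE x in lebesgue. bary P Q R x \<noteq> 0"
proof -
  have "negligible {x. bary_grad P Q R \<bullet> x = - bary P Q R 0}"
    using bary_grad_nz[OF assms] by (simp add: negligible_hyperplane)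
  moreover have "{x. bary P Q R x = 0} = {x. bary_grad P Q R \<bullet> x = - bary P Q R 0}"
    by (rule Collect_cong, subst bary_affine) (simp add: eq_neg_iff_add_eq_0)
  ultimately have "{x. bary P Q R x = 0} \<in> null_sets lebesgue" by (simp add: negligible_iff_null_sets)
  then show ?thesis by (rule AE_I') auto
qed

section \<open>Integrals over a triangle in the coordinates of one edge\<close>

lemma compact_hull3: "compact (convex hull {P, Q, R})" for P :: plane
  by (simp add: finite_imp_compact_convex_hull)

lemma continuous_on_compact_lebesgue:
  fixes f :: "plane \<Rightarrow> real"
  assumes "compact K" "continuous_on K f"
  shows "(\<lambda>x. indicator K x * f x) \<in> borel_measurable borel"
    and "(LINT x|lebesgue_on K. f x) = (LINT x|lborel. indicator K x * f x)"
    and "integrable (lebesgue_on K) f"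
proof -
  have K: "K \<in> sets borel" using assms by (simp add: borel_compact)
  then show m: "(\<lambda>x. indicator K x * f x) \<in> borel_measurable borel"
    using borel_measurable_continuous_on_indicator[OF K assms(2)] by simp
  have K': "K \<inter> space lebesgue \<in> sets lebesgue" using K by simp
  show "(LINT x|lebesgue_on K. f x) = (LINT x|lborel. indicator K x * f x)"
    unfolding integral_restrict_space[OF K'] using m by (simp add: integral_completion)
  show "integrable (lebesgue_on K) f"
    unfolding integrable_restrict_space[OF K']
    using borel_integrable_compact[OF assms] m by (simp add: integrable_completion)
qed

text \<open>The second coordinate is stretched by \<open>\<delta>\<close>: a layer of width
  proportional to \<open>\<delta>\<close> along \<open>PQ\<close> becomes a layer of fixed width,
  and the Jacobian factor \<open>\<delta>\<close> later cancels the \<open>1/\<delta>\<close> in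
  \<open>cutoff'\<close>.\<close>

lemma tri_integral:
  fixes f :: "plane \<Rightarrow> real"
  assumes "tri P Q R" "continuous_on (convex hull {P, Q, R}) f" "\<delta> > 0"
  defines "T \<equiv> \<lambda>z. P + fst z *\<^sub>R (Q - P) + (\<delta> * snd z) *\<^sub>R (R - P)"
  shows "(LINT x|lebesgue_on (convex hull {P, Q, R}). f x) =
     \<bar>cross2 (Q - P) (R - P)\<bar> * \<delta> *
       (LINT z|(lborel \<Otimes>\<^sub>M lborel). indicator (convex hull {P, Q, R}) (T z) * f (T z))"
proof -
  let ?K = "convex hull {P, Q, R}"
  note i = continuous_on_compact_lebesgue[OF compact_hull3 assms(2)]
  have c: "cross2 (Q - P) (\<delta> *\<^sub>R (R - P)) = \<delta> * cross2 (Q - P) (R - P)"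
    by (simp add: cross2_def algebra_simps)
  have T: "P + fst z *\<^sub>R (Q - P) + (snd z * \<delta>) *\<^sub>R (R - P) = T z" for z
    by (simp add: T_def mult.commute[of \<delta>])
  have "(LINT x|lebesgue_on ?K. f x) = (LINT x|lborel. indicator ?K x * f x)" by (rule i(2))
  also have "\<dots> = \<bar>\<delta> * cross2 (Q - P) (R - P)\<bar> * (LINT z|(lborel \<Otimes>\<^sub>M lborel). indicator ?K (T z) * f (T z))"
    using assms(1,3) by (subst plane_integral_param[of "Q - P" "\<delta> *\<^sub>R (R - P)" _ P, OF _ i(1)]) (auto simp: c tri_def T)
  finally show ?thesis using assms(3) by (simp add: abs_mult mult_ac)
qed

lemma indicator_hull_param:
  assumes "tri P Q R"
  shows "indicator (convex hull {P, Q, R}) (P + s *\<^sub>R (Q - P) + t *\<^sub>R (R - P)) =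
     (if 0 \<le> s \<and> 0 \<le> t \<and> s + t \<le> 1 then 1 else 0 :: real)"
  using bary_param[OF assms, of s t] by (auto simp: hull_eq_bary[OF assms] indicator_def)

section \<open>Integration by parts on a triangle\<close>

lemma integrable_pair_mult:
  fixes f g :: "real \<Rightarrow> real"
  assumes f: "integrable lborel f" and g: "integrable lborel g"
  shows "integrable (lborel \<Otimes>\<^sub>M lborel) (\<lambda>z. f (fst z) * g (snd z))"
    and "(LINT z|(lborel \<Otimes>\<^sub>M lborel). f (fst z) * g (snd z)) = (LINT x|lborel. f x) * (LINT x|lborel. g x)"
proof -
  show i: "integrable (lborel \<Otimes>\<^sub>M lborel) (\<lambda>z. f (fst z) * g (snd z))"
  proof (rule lborel_pair.Fubini_integrable)
    show "(\<lambda>z. f (fst z) * g (snd z)) \<in> borel_measurable (lborel \<Otimes>\<^sub>M lborel)"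
      using f g by (auto intro!: borel_measurable_times measurable_compose[OF measurable_fst] measurable_compose[OF measurable_snd])
    show "integrable lborel (\<lambda>x. LINT y|lborel. norm (f (fst (x, y)) * g (snd (x, y))))"
      using f by (simp add: abs_mult)
    show "AE x in lborel. integrable lborel (\<lambda>y. f (fst (x, y)) * g (snd (x, y)))"
      using g by simp
  qed
  show "(LINT z|(lborel \<Otimes>\<^sub>M lborel). f (fst z) * g (snd z)) = (LINT x|lborel. f x) * (LINT x|lborel. g x)"
    using lborel_pair.integral_fst'[OF i] by simp
qed

lemma flat'_shift: "has_bochner_integral lborel (\<lambda>t. flat' (t - 1)) 1"
  using flat'_integral lborel_has_bochner_integral_real_affine_iff[of 1 flat' 1 "-1"] by simp

lemma flat_scaled_tendsto:
  assumes "c > 0"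
  shows "(\<lambda>n. flat (c / inverse (real (Suc n)) - 1)) \<longlonglongrightarrow> 1"
proof -
  have "filterlim (\<lambda>n. c * real (Suc n) - 1) at_top sequentially"
    using assms by real_asymp
  then show ?thesis
    using filterlim_compose[OF flat_tendsto_1] by (simp add: divide_inverse)
qed

text \<open>The shift by 1 makes it vanish for \<open>bary P Q R x \<le> \<delta>\<close> and not
  only on the edge, so that the product of the three cutoffs has its support inside the open
  triangle.\<close>

definition cutoff :: "real \<Rightarrow> plane \<Rightarrow> plane \<Rightarrow> plane \<Rightarrow> plane \<Rightarrow> real" where
  "cutoff \<delta> P Q R x = flat (bary P Q R x / \<delta> - 1)"

definition cutoff' :: "real \<Rightarrow> plane \<Rightarrow> plane \<Rightarrow> plane \<Rightarrow> plane \<Rightarrow> real" where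
  "cutoff' \<delta> P Q R x = flat' (bary P Q R x / \<delta> - 1) / \<delta>"

lemma cutoff_bounds: "0 \<le> cutoff \<delta> P Q R x" "cutoff \<delta> P Q R x \<le> 1"
  by (simp_all add: cutoff_def flat_nonneg flat_le_1)

lemma cutoff_eq_0: "\<delta> > 0 \<Longrightarrow> bary P Q R x \<le> \<delta> \<Longrightarrow> cutoff \<delta> P Q R x = 0"
  and cutoff'_eq_0: "\<delta> > 0 \<Longrightarrow> bary P Q R x \<le> \<delta> \<Longrightarrow> cutoff' \<delta> P Q R x = 0"
  by (simp_all add: cutoff_def cutoff'_def flat_eq flat'_eq)

lemma cutoff_as_flat_fun: "\<delta> > 0 \<Longrightarrow> cutoff \<delta> P Q R = (\<lambda>x. flat_fun 1 (((1/\<delta>) *\<^sub>R bary_grad P Q R) \<bullet> x + (bary P Q R 0 / \<delta> - 1)))"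
  unfolding cutoff_def flat_def by (subst bary_affine) (simp add: add_divide_distrib add_diff_eq)

lemma cutoff_smooth: "\<delta> > 0 \<Longrightarrow> C_k k (cutoff \<delta> P Q R)"
  by (simp only: cutoff_as_flat_fun C_k_flat_fun)

lemma GDERIV_bary: "GDERIV (bary P Q R) x :> bary_grad P Q R"
proof -
  have "bary P Q R = (\<lambda>x. bary_grad P Q R \<bullet> x + bary P Q R 0)" using bary_affine by blast
  then show ?thesis using GDERIV_affine by metis
qed

lemma GDERIV_cutoff: "\<delta> > 0 \<Longrightarrow> GDERIV (cutoff \<delta> P Q R) x :> cutoff' \<delta> P Q R x *\<^sub>R bary_grad P Q R"
proof -
  assume "\<delta> > 0"
  then have "DERIV (\<lambda>t. flat (t / \<delta> - 1)) (bary P Q R x) :> flat' (bary P Q R x / \<delta> - 1) * (1 / \<delta>)"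
    by (intro DERIV_chain2[where g="\<lambda>t. t / \<delta> - 1", OF DERIV_flat]) (auto intro!: derivative_eq_intros)
  from GDERIV_DERIV_compose[OF GDERIV_bary this] show ?thesis
    unfolding cutoff_def cutoff'_def by simp
qed

lemma continuous_flat: "continuous_on S flat" "continuous_on S flat'"
proof -
  have "continuous_on UNIV (flat_fun q)" for q
    using DERIV_flat_fun by (metis DERIV_isCont continuous_at_imp_continuous_on)
  then show "continuous_on S flat" "continuous_on S flat'"
    unfolding flat_def flat'_def by (auto intro: continuous_on_subset)
qed

lemma continuous_cutoff: "continuous_on S (cutoff \<delta> P Q R)" "continuous_on S (cutoff' \<delta> P Q R)"
  unfolding cutoff_def cutoff'_def divide_inverse
  by (intro continuous_intros continuous_bary continuous_on_compose2[OF continuous_flat(1)[of UNIV]]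
      continuous_on_compose2[OF continuous_flat(2)[of UNIV]] subset_UNIV)+

text \<open>In the stretched coordinates \<open>(s, t)\<close> the factor \<open>cutoff'\<close>
  becomes, up to the cancelled scaling, the fixed density \<open>flat' (t - 1)\<close> of mass 1.
  For \<open>0 < s < 1\<close> the two other cutoffs tend to 1 and the argument of \<open>G\<close>
  tends to the edge point with parameter \<open>s\<close>. Dominated convergence and Fubini leave
  the integral along the edge.\<close>

lemma tri_edge_limit:
  fixes G :: "plane \<Rightarrow> real"
  assumes t: "tri P Q R" and G: "continuous_on (convex hull {P, Q, R}) G"
  defines "d \<equiv> \<lambda>n. inverse (real (Suc n))"
  shows "(\<lambda>n. LINT x|lebesgue_on (convex hull {P, Q, R}).
      G x * cutoff' (d n) P Q R x * cutoff (d n) Q R P x * cutoff (d n) R P Q x)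
    \<longlonglongrightarrow> \<bar>cross2 (Q - P) (R - P)\<bar> * (LINT s:{0..1}|lborel. G (linepath P Q s))"
proof -
  let ?K = "convex hull {P, Q, R}"
  let ?D = "\<bar>cross2 (Q - P) (R - P)\<bar>"
  let ?T = "\<lambda>n z. P + fst z *\<^sub>R (Q - P) + (d n * snd z) *\<^sub>R (R - P)"
  let ?w = "\<lambda>n z. cutoff (d n) Q R P (?T n z) * cutoff (d n) R P Q (?T n z)"
  define h where "h n z = (indicator ?K (?T n z) * G (?T n z)) * flat' (snd z - 1) * ?w n z" for n z
  \<comment> \<open>The open interval matches the pointwise limit: at \<open>s = 0\<close> the
    cutoff of the edge \<open>RP\<close> vanishes for every \<open>n\<close>, and at
    \<open>s = 1\<close> the points with positive second coordinate are outside the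
    triangle.\<close>
  define g where "g s = indicator {0<..<1} s * (indicator ?K (linepath P Q s) * G (linepath P Q s))" for s :: real
  have d: "d n > 0" for n by (simp add: d_def)
  have KG: "(\<lambda>x. indicator ?K x * G x) \<in> borel_measurable borel"
    by (rule continuous_on_compact_lebesgue(1)[OF compact_hull3 G])
  obtain B where B: "\<And>x. x \<in> ?K \<Longrightarrow> \<bar>G x\<bar> \<le> B"
    using compact_imp_bounded[OF compact_continuous_image[OF G compact_hull3]] by (auto simp: bounded_iff)
  have lp: "linepath P Q s = P + s *\<^sub>R (Q - P)" for s by (simp add: linepath_def algebra_simps)
  have lpK: "indicator ?K (linepath P Q s) = (indicator {0..1} s :: real)" for s
    using indicator_hull_param[OF t, of s 0] by (auto simp: lp indicator_def)
  have lpK': "linepath P Q s \<in> ?K" if "s \<in> {0..1}" for s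
  proof -
    have "indicator ?K (linepath P Q s) = (1::real)" using that by (simp add: lpK)
    then show ?thesis by (simp add: indicator_eq_1_iff)
  qed
  have "(LINT x|lebesgue_on ?K. G x * cutoff' (d n) P Q R x * cutoff (d n) Q R P x * cutoff (d n) R P Q x)
     = ?D * (LINT z|(lborel \<Otimes>\<^sub>M lborel). h n z)" for n
  proof -
    let ?F = "\<lambda>x. G x * cutoff' (d n) P Q R x * cutoff (d n) Q R P x * cutoff (d n) R P Q x"
    have h: "d n * (indicator ?K (?T n z) * ?F (?T n z)) = h n z" for z
      using bary_param(1)[OF t, of "fst z" "d n * snd z"] d[of n] by (simp add: h_def cutoff'_def)
    have "(LINT x|lebesgue_on ?K. ?F x) = ?D * d n * (LINT z|(lborel \<Otimes>\<^sub>M lborel). indicator ?K (?T n z) * ?F (?T n z))"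
      by (rule tri_integral[OF t _ d]) (intro continuous_intros G continuous_cutoff)
    also have "\<dots> = ?D * (LINT z|(lborel \<Otimes>\<^sub>M lborel). d n * (indicator ?K (?T n z) * ?F (?T n z)))"
      by simp
    finally show ?thesis unfolding h .
  qed
  moreover have "(\<lambda>n. LINT z|(lborel \<Otimes>\<^sub>M lborel). h n z) \<longlonglongrightarrow> (LINT z|(lborel \<Otimes>\<^sub>M lborel). g (fst z) * flat' (snd z - 1))"
  proof (rule integral_dominated_convergence[where w="\<lambda>z. (B * indicator {0..1} (fst z)) * flat' (snd z - 1)"])
    show "(\<lambda>z. g (fst z) * flat' (snd z - 1)) \<in> borel_measurable (lborel \<Otimes>\<^sub>M lborel)"
    proof -
      have "(\<lambda>s::real. linepath P Q s) \<in> borel_measurable borel"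
        by (intro borel_measurable_continuous_onI continuous_on_linepath)
      then have "g \<in> borel_measurable borel" unfolding g_def
        using measurable_compose[OF _ KG] by measurable
      then show ?thesis by measurable
    qed
    show "h n \<in> borel_measurable (lborel \<Otimes>\<^sub>M lborel)" for n
    proof -
      have T: "?T n \<in> borel_measurable (lborel \<Otimes>\<^sub>M lborel)"
        by (simp add: lborel_prod) (intro borel_measurable_continuous_onI continuous_intros)
      have c: "cutoff (d n) A B C \<in> borel_measurable borel" for A B C
        by (intro borel_measurable_continuous_onI continuous_cutoff)
      show ?thesis unfolding h_def
        using measurable_compose[OF T KG] measurable_compose[OF T c] by measurable
    qed
    show "integrable (lborel \<Otimes>\<^sub>M lborel) (\<lambda>z::real\<times>real. (B * indicator {0..1} (fst z)) * flat' (snd z - 1))"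
    proof -
      have 1: "integrable lborel (\<lambda>s::real. B * indicator {0..1} s)"
        by (intro integrable_mult_right integrable_real_indicator) auto
      have 2: "integrable lborel (\<lambda>t. flat' (t - 1))"
        using flat'_shift by (simp add: has_bochner_integral_iff)
      show ?thesis using integrable_pair_mult(1)[OF 1 2] .
    qed
    show "AE z::real\<times>real in lborel \<Otimes>\<^sub>M lborel. norm (h n z) \<le> B * indicator {0..1} (fst z) * flat' (snd z - 1)" for n
    proof (rule AE_I2)
      fix z :: "real \<times> real"
      have w: "0 \<le> ?w n z" "?w n z \<le> 1" by (auto intro!: mult_nonneg_nonneg mult_le_one cutoff_bounds)
      show "norm (h n z) \<le> B * indicator {0..1} (fst z) * flat' (snd z - 1)"
      \<comment> \<open>\<open>flat' (snd z - 1)\<close> is zero for \<open>snd z < 1\<close>.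
        Otherwise the transverse coordinate is positive, and membership in the triangle forces
        \<open>fst z\<close> into \<open>{0..1}\<close>, where the majorant is supported.\<close>
      proof (cases "?T n z \<in> ?K \<and> 1 \<le> snd z")
        case True
        then have "0 \<le> d n * snd z" using d[of n] by simp
        then have s: "fst z \<in> {0..1}"
          using True indicator_hull_param[OF t, of "fst z" "d n * snd z"] by (auto simp: indicator_def split: if_splits)
        have "norm (h n z) = \<bar>G (?T n z)\<bar> * flat' (snd z - 1) * ?w n z"
          using True w flat'_nonneg[of "snd z - 1"] by (simp add: h_def abs_mult cutoff_bounds)
        also have "\<dots> \<le> (B * flat' (snd z - 1)) * 1"
          using B[of "?T n z"] True w flat'_nonneg[of "snd z - 1"]
          by (intro mult_mono mult_right_mono) (auto intro!: mult_nonneg_nonneg order_trans[OF abs_ge_zero B])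
        finally show ?thesis using s by simp
      next
        case False
        then have "h n z = 0" by (auto simp: h_def flat'_eq)
        moreover have "0 \<le> B" using B[of P] by (simp add: hull_inc order_trans[OF abs_ge_zero])
        ultimately show ?thesis using flat'_nonneg by simp
      qed
    qed
    show "AE z::real\<times>real in lborel \<Otimes>\<^sub>M lborel. (\<lambda>n. h n z) \<longlonglongrightarrow> g (fst z) * flat' (snd z - 1)"
    proof (rule AE_I2)
      fix z :: "real \<times> real"
      let ?s = "fst z" and ?t = "snd z"
      have dl: "d \<longlonglongrightarrow> 0" unfolding d_def by (rule LIMSEQ_inverse_real_of_nat)
      show "(\<lambda>n. h n z) \<longlonglongrightarrow> g ?s * flat' (?t - 1)"
      proof (cases "?t > 1 \<and> 0 < ?s \<and> ?s < 1")
        case True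
        have Tl: "(\<lambda>n. ?T n z) \<longlonglongrightarrow> P + ?s *\<^sub>R (Q - P) + (0 * ?t) *\<^sub>R (R - P)"
          by (intro tendsto_intros dl)
        then have Tl': "(\<lambda>n. ?T n z) \<longlonglongrightarrow> linepath P Q ?s" by (simp add: lp)
        have "eventually (\<lambda>n. d n * ?t < 1 - ?s) sequentially"
          using True order_tendstoD(2)[OF tendsto_mult_left_zero[OF dl, of ?t], of "1 - ?s"] by simp
        then have ev: "eventually (\<lambda>n. ?T n z \<in> ?K) sequentially"
        proof eventually_elim
          case (elim n)
          have "0 \<le> d n * ?t" using d[of n] True by simp
          then show ?case
            using elim True indicator_hull_param[OF t, of ?s "d n * ?t"] by (auto simp: indicator_def split: if_splits)
        qed
        have inK: "linepath P Q ?s \<in> ?K"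
          using lpK[of ?s] True by (auto simp: indicator_def split: if_splits)
        have Gl: "(\<lambda>n. G (?T n z)) \<longlonglongrightarrow> G (linepath P Q ?s)"
          using continuous_on_tendsto_compose[OF G Tl' inK ev] .
        have il: "(\<lambda>n. indicator ?K (?T n z) :: real) \<longlonglongrightarrow> 1"
          by (rule Lim_transform_eventually[of "\<lambda>_. 1"]) (use ev in \<open>auto elim!: eventually_mono\<close>)
        have c1: "(\<lambda>n. cutoff (d n) R P Q (?T n z)) \<longlonglongrightarrow> 1"
          using flat_scaled_tendsto[of ?s] True by (simp add: cutoff_def bary_param[OF t] d_def)
        have c2: "(\<lambda>n. cutoff (d n) Q R P (?T n z)) \<longlonglongrightarrow> 1"
        proof -
          have "filterlim (\<lambda>n. (1 - ?s) * real (Suc n) - ?t - 1) at_top sequentially"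
            using True by real_asymp
          then have "(\<lambda>n. flat ((1 - ?s) * real (Suc n) - ?t - 1)) \<longlonglongrightarrow> 1"
            by (rule filterlim_compose[OF flat_tendsto_1])
          moreover have "(1 - ?s - d n * ?t) / d n - 1 = (1 - ?s) * real (Suc n) - ?t - 1" for n
            using d[of n] by (simp add: d_def field_simps)
          ultimately show ?thesis by (simp add: cutoff_def bary_param[OF t])
        qed
        have "(\<lambda>n. h n z) \<longlonglongrightarrow> (1 * G (linepath P Q ?s)) * flat' (?t - 1) * (1 * 1)"
          unfolding h_def by (intro tendsto_mult il Gl c1 c2 tendsto_const)
        moreover have "g ?s = G (linepath P Q ?s)" using True lpK[of ?s] by (simp add: g_def)
        ultimately show ?thesis by simp
      next
        case False
        have "h n z = 0" for n
        proof (cases "?t > 1 \<and> ?T n z \<in> ?K")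
          case True
          have "0 < d n * ?t" using d[of n] True by simp
          moreover have "0 \<le> ?s \<and> ?s + d n * ?t \<le> 1"
            using True indicator_hull_param[OF t, of ?s "d n * ?t"] by (auto simp: indicator_def split: if_splits)
          ultimately have "?s = 0" using False True by auto
          then have "cutoff (d n) R P Q (?T n z) = 0"
            using d[of n] bary_param(2)[OF t, of 0 "d n * ?t"] by (intro cutoff_eq_0) simp_all
          then show ?thesis by (simp add: h_def)
        qed (auto simp: h_def flat'_eq)
        moreover have "g ?s * flat' (?t - 1) = 0" using False by (auto simp: g_def flat'_eq)
        ultimately show ?thesis by (simp only: tendsto_const)
      qed
    qed
  qed
  moreover have "(LINT z|(lborel \<Otimes>\<^sub>M lborel). g (fst z) * flat' (snd z - 1)) = (LINT s:{0..1}|lborel. G (linepath P Q s))"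
  proof -
    have cont: "continuous_on {0..1} (\<lambda>s. G (linepath P Q s))"
    proof (rule continuous_on_compose2[OF G continuous_on_linepath])
      show "linepath P Q ` {0..1} \<subseteq> ?K"
        using lpK' by blast
    qed
    have int: "integrable lborel (\<lambda>s. indicator {0..1} s *\<^sub>R G (linepath P Q s))"
      using borel_integrable_compact[OF _ cont] by simp
    have gm: "g \<in> borel_measurable lborel"
    proof -
      have "(\<lambda>s::real. linepath P Q s) \<in> borel_measurable borel"
        by (intro borel_measurable_continuous_onI continuous_on_linepath)
      then have "g \<in> borel_measurable borel" unfolding g_def
        using measurable_compose[OF _ KG] by measurable
      then show ?thesis by simp
    qed
    have ae: "AE s in lborel. g s = indicator {0..1} s *\<^sub>R G (linepath P Q s)"
      using AE_lborel_singleton[of 0] AE_lborel_singleton[of 1]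
      by eventually_elim (use lpK' in \<open>auto simp: g_def indicator_def\<close>)
    have gi: "integrable lborel g"
      using integrable_cong_AE[OF gm borel_measurable_integrable[OF int] ae] int by simp
    have "(LINT s|lborel. g s) = (LINT s:{0..1}|lborel. G (linepath P Q s))"
      unfolding set_lebesgue_integral_def
      by (rule integral_cong_AE[OF gm borel_measurable_integrable[OF int] ae])
    then show ?thesis
      using integrable_pair_mult(2)[OF gi, of "\<lambda>t. flat' (t - 1)"] flat'_shift by (simp add: has_bochner_integral_iff)
  qed
  ultimately show ?thesis by (simp add: tendsto_mult_left)
qed

text \<open>Dominated convergence with the integrand itself as majorant. \<open>S\<close> will be
  the closed triangle for continuous integrands and its interior for the term with
  \<open>\<mu>\<close>.\<close>

lemma tri_volume_limit:
  fixes g :: "plane \<Rightarrow> real"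
  assumes t: "tri P Q R" and S: "S \<subseteq> convex hull {P, Q, R}" "S \<in> sets lebesgue"
    and g: "integrable (lebesgue_on S) g"
  defines "d \<equiv> \<lambda>n. inverse (real (Suc n))"
  shows "(\<lambda>n. LINT x|lebesgue_on S. g x * (cutoff (d n) P Q R x * cutoff (d n) Q R P x * cutoff (d n) R P Q x))
    \<longlonglongrightarrow> (LINT x|lebesgue_on S. g x)" (is "(\<lambda>n. LINT x|_. g x * ?c n x) \<longlonglongrightarrow> _")
proof (rule integral_dominated_convergence[where w="\<lambda>x. norm (g x)"])
  have c: "cutoff \<delta> A B C \<in> borel_measurable (lebesgue_on S)" for \<delta> A B C
    by (intro measurable_restrict_space1 measurable_completion)
      (simp add: borel_measurable_continuous_onI continuous_cutoff)
  show "(\<lambda>x. g x * ?c n x) \<in> borel_measurable (lebesgue_on S)" for n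
    using g c by (intro borel_measurable_times) auto
  show "AE x in lebesgue_on S. norm (g x * ?c n x) \<le> norm (g x)" for n
  proof (rule AE_I2)
    fix x
    have "0 \<le> ?c n x" "?c n x \<le> 1"
      by (auto intro!: mult_nonneg_nonneg mult_le_one cutoff_bounds)
    then show "norm (g x * ?c n x) \<le> norm (g x)"
      using mult_left_mono[of _ 1 "\<bar>g x\<bar>"] by (simp add: abs_mult)
  qed
  have "AE x in lebesgue. bary P Q R x \<noteq> 0 \<and> bary Q R P x \<noteq> 0 \<and> bary R P Q x \<noteq> 0"
    using AE_bary_nz[OF t] AE_bary_nz[OF tri_cyc(1)[OF t]] AE_bary_nz[OF tri_cyc(2)[OF t]] by eventually_elim simp
  then have "AE x in lebesgue. x \<in> S \<longrightarrow> (\<lambda>n. g x * ?c n x) \<longlonglongrightarrow> g x"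
  proof eventually_elim
    case (elim x)
    show ?case
    proof
      assume "x \<in> S"
      then have "x \<in> convex hull {P, Q, R}" using S by blast
      then have "0 < bary P Q R x" "0 < bary Q R P x" "0 < bary R P Q x"
        using elim by (auto simp: hull_eq_bary[OF t])
      then have "(\<lambda>n. g x * ?c n x) \<longlonglongrightarrow> g x * (1 * 1 * 1)"
        unfolding d_def cutoff_def by (intro tendsto_mult flat_scaled_tendsto tendsto_const)
      then show "(\<lambda>n. g x * ?c n x) \<longlonglongrightarrow> g x" by simp
    qed
  qed
  then show "AE x in lebesgue_on S. (\<lambda>n. g x * ?c n x) \<longlonglongrightarrow> g x"
    using S(2) by (simp add: AE_restrict_space_iff)
qed (use g in auto)

text \<open>The absolute determinant times \<open>bary_grad P Q R\<close> is the inner normal of the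
  edge \<open>PQ\<close> scaled by the length of the edge, so this is the flux of \<open>f b\<close>
  through \<open>PQ\<close> into the triangle.\<close>

definition tri_flux :: "plane \<Rightarrow> plane \<Rightarrow> plane \<Rightarrow> (plane \<Rightarrow> plane) \<Rightarrow> (plane \<Rightarrow> real) \<Rightarrow> real" where
  "tri_flux P Q R b f = \<bar>cross2 (Q - P) (R - P)\<bar> *
     (LINT s:{0..1}|lborel. (b (linepath P Q s) \<bullet> bary_grad P Q R) * f (linepath P Q s))"

text \<open>The weak formulation is tested with \<open>f\<close> times cutoffs in the three barycentric coordinates. In
  the limit the derivatives of the cutoffs concentrate on the edges and produce the boundary fluxes.\<close>

lemma triangle_coercivity:
  assumes "open \<Omega>" and b: "in_W1inf \<Omega> b" and mu: "in_Linf \<Omega> \<mu>"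
    and AE: "AE x in lebesgue_on \<Omega>. \<mu> x - 1/2 * weak_div \<Omega> b x \<ge> \<alpha>"
    and t: "tri P Q R" and K: "K = convex hull {P, Q, R}" and int: "interior K \<subseteq> \<Omega>"
    and cont: "continuous_on K b" and f: "\<And>k. C_k k f" and nonneg: "\<And>x. f x \<ge> 0"
    and F: "\<And>x. GDERIV f x :> F x" and Fc: "continuous_on UNIV F"
    and mui: "integrable (lebesgue_on (interior K)) (\<lambda>x. \<mu> x * f x)"
  shows "1/2 * (LINT x|lebesgue_on K. b x \<bullet> F x)
      + 1/2 * (tri_flux P Q R b f + tri_flux Q R P b f + tri_flux R P Q b f)
      + (LINT x|lebesgue_on (interior K). \<mu> x * f x)
     \<ge> \<alpha> * (LINT x|lebesgue_on K. f x)"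
proof -
  define d where "d n = inverse (real (Suc n))" for n
  have d: "d n > 0" for n by (simp add: d_def)
  define c where "c n x = cutoff (d n) P Q R x * cutoff (d n) Q R P x * cutoff (d n) R P Q x" for n x
  define \<phi> where "\<phi> n x = f x * c n x" for n x
  define e where "e n A B C x = cutoff' (d n) A B C x * cutoff (d n) B C A x * cutoff (d n) C A B x" for n A B C x
  have grad: "gradient (\<phi> n) x = c n x *\<^sub>R F x + f x *\<^sub>R (e n P Q R x *\<^sub>R bary_grad P Q R
      + e n Q R P x *\<^sub>R bary_grad Q R P + e n R P Q x *\<^sub>R bary_grad R P Q)" for n x
  proof -
    note g = GDERIV_mult[OF F GDERIV_mult[OF GDERIV_mult[OF GDERIV_cutoff[OF d] GDERIV_cutoff[OF d]] GDERIV_cutoff[OF d]]]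
    show ?thesis
      unfolding \<phi>_def c_def
      by (rule gradient_eqI, rule GDERIV_subst[OF g]) (simp add: e_def algebra_simps)
  qed
  have supp: "c n x = 0 \<and> e n P Q R x = 0 \<and> e n Q R P x = 0 \<and> e n R P Q x = 0"
    if "\<not> (d n \<le> bary P Q R x \<and> d n \<le> bary Q R P x \<and> d n \<le> bary R P Q x)" for n x
    using that cutoff_eq_0[OF d[of n], of P Q R x] cutoff_eq_0[OF d[of n], of Q R P x] cutoff_eq_0[OF d[of n], of R P Q x]
      cutoff'_eq_0[OF d[of n], of P Q R x] cutoff'_eq_0[OF d[of n], of Q R P x] cutoff'_eq_0[OF d[of n], of R P Q x]
    by (auto simp: c_def e_def not_le less_imp_le)
  \<comment> \<open>All three barycentric coordinates are at least \<open>d n\<close> here, so this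
    is a compact subset of the open triangle even when the triangle touches the frontier of
    \<open>\<Omega>\<close>.\<close>
  let ?Z = "\<lambda>n. {x. d n \<le> bary P Q R x \<and> d n \<le> bary Q R P x \<and> d n \<le> bary R P Q x}"
  have Zi: "?Z n \<subseteq> interior K" for n
    using bary_pos_subset_interior[OF t] d[of n] unfolding K by (auto intro: less_le_trans)
  have Zc: "closed (?Z n)" for n
    by (intro closed_Collect_conj closed_Collect_le continuous_on_const continuous_bary)
  have "compact K" unfolding K by (rule compact_hull3)
  have test: "test_function \<Omega> (\<phi> n)" for n
    unfolding test_function_def
  proof (intro conjI allI)
    show "C_k k (\<phi> n)" for k
      unfolding \<phi>_def c_def by (intro C_k_mult f cutoff_smooth d)
    have "{x. \<phi> n x \<noteq> 0} \<subseteq> ?Z n" using supp[of n] by (auto simp: \<phi>_def)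
    then have cl: "closure {x. \<phi> n x \<noteq> 0} \<subseteq> ?Z n" using Zc closure_minimal by blast
    then show "closure {x. \<phi> n x \<noteq> 0} \<subseteq> \<Omega>" using Zi[of n] int by blast
    have "closure {x. \<phi> n x \<noteq> 0} \<subseteq> K" using cl Zi[of n] interior_subset by blast
    then have "bounded (closure {x. \<phi> n x \<noteq> 0})" using \<open>compact K\<close> bounded_subset compact_imp_bounded by blast
    then show "compact (closure {x. \<phi> n x \<noteq> 0})" by (simp add: compact_eq_bounded_closed)
  qed
  have cn: "0 \<le> c n x" for n x unfolding c_def by (intro mult_nonneg_nonneg cutoff_bounds)
  have main: "1/2 * (LINT x|lebesgue_on \<Omega>. b x \<bullet> gradient (\<phi> n) x) + (LINT x|lebesgue_on \<Omega>. \<mu> x * \<phi> n x)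
     \<ge> \<alpha> * (LINT x|lebesgue_on \<Omega>. \<phi> n x)" for n
    using weak_coercivity[OF \<open>open \<Omega>\<close> b mu AE test[of n]] nonneg cn by (simp add: \<phi>_def)
  have sO: "\<Omega> \<in> sets lebesgue" and sK: "K \<in> sets lebesgue" and sI: "interior K \<in> sets lebesgue"
    using \<open>open \<Omega>\<close> \<open>compact K\<close> by (auto simp: borel_compact)
  have out: "x \<notin> ?Z n" if "x \<notin> \<Omega> \<inter> K \<or> x \<notin> \<Omega> \<inter> interior K" for x n
    using that Zi[of n] int interior_subset[of K] by blast
  have \<phi>0: "\<phi> n x = 0" "gradient (\<phi> n) x = 0" if "x \<notin> ?Z n" for x n
    using supp[of n x] that by (simp_all add: \<phi>_def grad)
  \<comment> \<open>Everything vanishes off \<open>?Z n\<close>, so integrals over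
    \<open>\<Omega>\<close> become integrals over \<open>K\<close>; the one with
    \<open>\<mu>\<close> is moved to the interior, which lies in \<open>\<Omega>\<close>.\<close>
  have 1: "(LINT x|lebesgue_on \<Omega>. b x \<bullet> gradient (\<phi> n) x) = (LINT x|lebesgue_on K. b x \<bullet> gradient (\<phi> n) x)" for n
    by (rule lebesgue_on_integral_cong_support(1)[OF sO sK]) (use out[of _ n] \<phi>0[of _ n] in force)
  have 2: "(LINT x|lebesgue_on \<Omega>. \<mu> x * \<phi> n x) = (LINT x|lebesgue_on (interior K). \<mu> x * \<phi> n x)" for n
    by (rule lebesgue_on_integral_cong_support(1)[OF sO sI]) (use out[of _ n] \<phi>0[of _ n] in force)
  have 3: "(LINT x|lebesgue_on \<Omega>. \<phi> n x) = (LINT x|lebesgue_on K. \<phi> n x)" for n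
    by (rule lebesgue_on_integral_cong_support(1)[OF sO sK]) (use out[of _ n] \<phi>0[of _ n] in force)
  have fc: "continuous_on K f" using f[of 0] by (auto intro: continuous_on_subset)
  have Fc': "continuous_on K F" using Fc by (auto intro: continuous_on_subset)
  have bfc: "continuous_on K (\<lambda>x. (b x \<bullet> v) * f x)" for v by (intro continuous_intros cont fc)
  have ec: "continuous_on K (e n A B C)" "continuous_on K (c n)" for n A B C
    unfolding e_def c_def by (intro continuous_intros continuous_cutoff)+
  let ?E = "\<lambda>n A B C. (LINT x|lebesgue_on K. ((b x \<bullet> bary_grad A B C) * f x) * cutoff' (d n) A B C x * cutoff (d n) B C A x * cutoff (d n) C A B x)"
  have split: "(LINT x|lebesgue_on K. b x \<bullet> gradient (\<phi> n) x)
     = (LINT x|lebesgue_on K. (b x \<bullet> F x) * c n x) + (?E n P Q R + ?E n Q R P + ?E n R P Q)" for n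
  proof -
    note I = continuous_on_compact_lebesgue(3)[OF \<open>compact K\<close>]
    have i0: "integrable (lebesgue_on K) (\<lambda>x. (b x \<bullet> F x) * c n x)"
      by (intro I continuous_intros cont Fc' ec)
    have i1: "integrable (lebesgue_on K) (\<lambda>x. ((b x \<bullet> bary_grad A B C) * f x) * cutoff' (d n) A B C x * cutoff (d n) B C A x * cutoff (d n) C A B x)" for A B C
      by (intro I continuous_intros cont fc continuous_cutoff)
    have "b x \<bullet> gradient (\<phi> n) x = (b x \<bullet> F x) * c n x
        + ((((b x \<bullet> bary_grad P Q R) * f x) * cutoff' (d n) P Q R x * cutoff (d n) Q R P x * cutoff (d n) R P Q x)
        + (((b x \<bullet> bary_grad Q R P) * f x) * cutoff' (d n) Q R P x * cutoff (d n) R P Q x * cutoff (d n) P Q R x)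
        + (((b x \<bullet> bary_grad R P Q) * f x) * cutoff' (d n) R P Q x * cutoff (d n) P Q R x * cutoff (d n) Q R P x))" for x
      by (simp add: grad e_def inner_add_right algebra_simps)
    then show ?thesis using i0 i1 by simp
  qed
  have l1: "(\<lambda>n. LINT x|lebesgue_on K. (b x \<bullet> F x) * c n x) \<longlonglongrightarrow> (LINT x|lebesgue_on K. b x \<bullet> F x)"
    unfolding c_def d_def
    by (rule tri_volume_limit[OF t _ sK]) (auto simp: K intro!: continuous_on_compact_lebesgue(3) continuous_intros compact_hull3 cont[unfolded K] Fc'[unfolded K])
  have l2: "(\<lambda>n. LINT x|lebesgue_on (interior K). (\<mu> x * f x) * c n x) \<longlonglongrightarrow> (LINT x|lebesgue_on (interior K). \<mu> x * f x)"
    unfolding c_def d_def by (rule tri_volume_limit[OF t _ sI mui]) (use interior_subset K in auto)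
  have l3: "(\<lambda>n. LINT x|lebesgue_on K. f x * c n x) \<longlonglongrightarrow> (LINT x|lebesgue_on K. f x)"
    unfolding c_def d_def
    by (rule tri_volume_limit[OF t _ sK]) (auto simp: K intro!: continuous_on_compact_lebesgue(3) compact_hull3 fc[unfolded K])
  have l4: "(\<lambda>n. ?E n P Q R) \<longlonglongrightarrow> tri_flux P Q R b f"
    unfolding tri_flux_def d_def K by (rule tri_edge_limit[OF t bfc[unfolded K]])
  have l5: "(\<lambda>n. ?E n Q R P) \<longlonglongrightarrow> tri_flux Q R P b f"
    using tri_edge_limit[OF tri_cyc(1)[OF t], of "\<lambda>x. (b x \<bullet> bary_grad Q R P) * f x"] bfc
    unfolding tri_flux_def d_def K by (simp add: insert_commute)
  have l6: "(\<lambda>n. ?E n R P Q) \<longlonglongrightarrow> tri_flux R P Q b f"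
    using tri_edge_limit[OF tri_cyc(2)[OF t], of "\<lambda>x. (b x \<bullet> bary_grad R P Q) * f x"] bfc
    unfolding tri_flux_def d_def K by (simp add: insert_commute)
  show ?thesis
  proof (rule LIMSEQ_le)
    show "(\<lambda>n. \<alpha> * (LINT x|lebesgue_on K. f x * c n x)) \<longlonglongrightarrow> \<alpha> * (LINT x|lebesgue_on K. f x)"
      by (intro tendsto_intros l3)
    show "(\<lambda>n. 1/2 * (LINT x|lebesgue_on K. (b x \<bullet> F x) * c n x) + 1/2 * (?E n P Q R + ?E n Q R P + ?E n R P Q)
        + (LINT x|lebesgue_on (interior K). (\<mu> x * f x) * c n x))
      \<longlonglongrightarrow> 1/2 * (LINT x|lebesgue_on K. b x \<bullet> F x)
      + 1/2 * (tri_flux P Q R b f + tri_flux Q R P b f + tri_flux R P Q b f)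
      + (LINT x|lebesgue_on (interior K). \<mu> x * f x)"
      by (intro tendsto_intros l1 l2 l4 l5 l6)
    have "\<alpha> * (LINT x|lebesgue_on K. f x * c n x) \<le> 1/2 * (LINT x|lebesgue_on K. (b x \<bullet> F x) * c n x) + 1/2 * (?E n P Q R + ?E n Q R P + ?E n R P Q)
        + (LINT x|lebesgue_on (interior K). (\<mu> x * f x) * c n x)" for n
    proof -
      have "(\<lambda>x. \<mu> x * \<phi> n x) = (\<lambda>x. (\<mu> x * f x) * c n x)" "\<phi> n = (\<lambda>x. f x * c n x)"
        by (simp_all add: \<phi>_def fun_eq_iff)
      then show ?thesis using main[of n, unfolded 1 2 3 split] by (simp only: distrib_left)
    qed
    then show "\<exists>N. \<forall>n\<ge>N. \<alpha> * (LINT x|lebesgue_on K. f x * c n x) \<le> 1/2 * (LINT x|lebesgue_on K. (b x \<bullet> F x) * c n x) + 1/2 * (?E n P Q R + ?E n Q R P + ?E n R P Q)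
        + (LINT x|lebesgue_on (interior K). (\<mu> x * f x) * c n x)" by blast
  qed
qed

section \<open>Polygonal domains, triangles and edges\<close>

text \<open>A connected set that avoids the curve lies on one side of it, while every point of a
  Jordan curve is a limit of points of both sides. A curve point in the interior of the closure
  would force \<open>\<Omega>\<close> to meet both sides.\<close>

lemma Jordan_curve_not_in_interior_closure:
  fixes \<Omega> :: "complex set"
  assumes "open \<Omega>" "connected \<Omega>" and c: "simple_path c" "pathfinish c = pathstart c"
    and fr: "path_image c \<subseteq> frontier \<Omega>"
  shows "path_image c \<inter> interior (closure \<Omega>) = {}"
proof (rule ccontr)
  let ?P = "path_image c"
  assume "?P \<inter> interior (closure \<Omega>) \<noteq> {}"
  then obtain x where x: "x \<in> ?P" "x \<in> interior (closure \<Omega>)" by blast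
  note J = Jordan_inside_outside[OF c]
  have meet: "U \<inter> \<Omega> \<noteq> {}" if "open U" "frontier U = ?P" for U
  proof -
    have "x \<in> closure U" using x(1) that(2) by (auto simp: frontier_def)
    then obtain y where y: "y \<in> U" "y \<in> interior (closure \<Omega>)"
      using x(2) open_Int_closure_eq_empty[of "interior (closure \<Omega>)" U] by auto
    then have "y \<in> closure \<Omega>" using interior_subset by blast
    then show ?thesis using y(1) that(1) open_Int_closure_eq_empty[of U \<Omega>] by auto
  qed
  have "\<Omega> \<inter> ?P = {}" using fr \<open>open \<Omega>\<close> by (auto simp: frontier_def interior_open)
  then have "\<Omega> \<subseteq> inside ?P \<union> outside ?P" using J by blast
  then have "inside ?P \<inter> \<Omega> = {} \<or> outside ?P \<inter> \<Omega> = {}"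
    using \<open>connected \<Omega>\<close> J unfolding connected_def by (metis Int_commute inf_assoc inf_bot_left)
  then show False using meet J by blast
qed

text \<open>Absence of slits. The triangles fill the closure of \<open>\<Omega>\<close>, and this is
  what puts their interiors into \<open>\<Omega>\<close> itself.\<close>

lemma polygonal_domain_interior_closure:
  assumes "polygonal_domain \<Omega>"
  shows "interior (closure \<Omega>) = \<Omega>"
proof
  have op: "open \<Omega>" and conn: "connected \<Omega>" using assms by (auto simp: polygonal_domain_def)
  obtain \<P> where \<P>: "\<forall>P\<in>\<P>. simple_closed_polygon P" "frontier \<Omega> = \<Union>\<P>"
    using assms by (auto simp: polygonal_domain_def)
  \<comment> \<open>A linear bijection onto \<open>complex\<close>, where the Jordan curve theorem
    is applied; it commutes with closure, interior and frontier.\<close>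
  define h :: "plane \<Rightarrow> complex" where "h x = Complex (x $ 1) (x $ 2)" for x
  have lin: "linear h" by (rule linearI) (simp_all add: h_def complex_eq_iff)
  have inj: "inj h" by (rule injI) (simp add: h_def plane_eq_iff)
  have surj: "surj h"
  proof (rule surjI)
    show "h (vector [Re z, Im z]) = z" for z by (simp add: h_def)
  qed
  have bij: "bij h" using inj surj by (simp add: bij_def)
  have cl: "closure (h ` S) = h ` closure S" for S using closure_injective_linear_image[OF lin inj, of S] by simp
  have it: "interior (h ` S) = h ` interior S" for S using interior_bijective_linear_image[OF lin bij] .
  have fr: "frontier (h ` S) = h ` frontier S" for S
    by (simp add: frontier_def cl it image_set_diff[OF inj])
  have "P \<inter> interior (closure \<Omega>) = {}" if "P \<in> \<P>" for P
  proof -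
    from that \<P>(1) obtain g where g: "simple_path g" "pathfinish g = pathstart g" "path_image g = P"
      unfolding simple_closed_polygon_def by blast
    have "path_image (h \<circ> g) \<inter> interior (closure (h ` \<Omega>)) = {}"
    proof (rule Jordan_curve_not_in_interior_closure)
      show "open (h ` \<Omega>)" using it[of \<Omega>] op interior_eq by metis
      show "connected (h ` \<Omega>)" using conn lin by (intro connected_linear_image)
      show "simple_path (h \<circ> g)" using g simple_path_linear_image_eq[OF lin inj] by blast
      show "pathfinish (h \<circ> g) = pathstart (h \<circ> g)" using g by (simp add: pathfinish_compose pathstart_compose)
      show "path_image (h \<circ> g) \<subseteq> frontier (h ` \<Omega>)"
        using g that \<P>(2) by (auto simp: fr path_image_compose)
    qed
    then show ?thesis using g inj by (simp add: path_image_compose cl it image_Int[OF inj, symmetric])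
  qed
  then have "interior (closure \<Omega>) \<inter> frontier \<Omega> = {}" using \<P>(2) by blast
  moreover have "interior (closure \<Omega>) \<subseteq> closure \<Omega>" by (rule interior_subset)
  ultimately show "interior (closure \<Omega>) \<subseteq> \<Omega>"
    using op by (auto simp: frontier_def interior_open)
  show "\<Omega> \<subseteq> interior (closure \<Omega>)" using op closure_subset interior_maximal by blast
qed

text \<open>Bundles a labelling of the corners with the list of edges. Rotating and swapping labels
  then reduces every statement about an edge to the edge \<open>PQ\<close>.\<close>

definition vertices :: "plane set \<Rightarrow> plane \<Rightarrow> plane \<Rightarrow> plane \<Rightarrow> bool" where
  "vertices K P Q R \<longleftrightarrow> tri P Q R \<and> K = convex hull {P, Q, R} \<and>
     {E. E edge_of K} = {closed_segment P Q, closed_segment Q R, closed_segment R P}"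

lemma verticesD:
  assumes "vertices K P Q R"
  shows "tri P Q R" "K = convex hull {P, Q, R}"
    "{E. E edge_of K} = {closed_segment P Q, closed_segment Q R, closed_segment R P}"
  using assms by (auto simp: vertices_def)

lemma vertices_cyc: "vertices K P Q R \<Longrightarrow> vertices K Q R P"
  unfolding vertices_def using tri_cyc(1)[of P Q R] by (auto simp: insert_commute)

lemma vertices_swap: "vertices K P Q R \<Longrightarrow> vertices K Q P R"
  unfolding vertices_def using tri_swap[of P Q R]
  by (auto simp: insert_commute closed_segment_commute)

lemma parallel_plane:
  assumes "cross2 u v = 0" "u \<noteq> 0" obtains t where "v = t *\<^sub>R u"
proof (cases "u $ 1 = 0")
  case True
  then have "u $ 2 \<noteq> 0" using assms(2) by (simp add: plane_eq_iff)
  then show ?thesis using assms(1) True that[of "v $ 2 / u $ 2"] by (simp add: plane_eq_iff cross2_def)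
next
  case False
  then show ?thesis using assms(1) that[of "v $ 1 / u $ 1"] by (simp add: plane_eq_iff cross2_def field_simps)
qed

text \<open>Collinear corners would be affinely dependent. The faces of the hull of an affinely
  independent set are the hulls of its subsets, and affine dimension 1 singles out the
  pairs.\<close>

lemma simplex_2_vertices:
  assumes "2 simplex K"
  obtains P Q R where "vertices K P Q R"
proof -
  obtain C where C: "\<not> affine_dependent C" "card C = 3" "K = convex hull C"
    using assms unfolding simplex_def by auto
  then obtain P Q R where PQR: "C = {P, Q, R}" "P \<noteq> Q" "Q \<noteq> R" "P \<noteq> R" by (metis card_3_iff)
  have tri: "tri P Q R"
    unfolding tri_def
  proof
    assume "cross2 (Q - P) (R - P) = 0"
    then obtain t where "R - P = t *\<^sub>R (Q - P)" using PQR parallel_plane[of "Q - P" "R - P"] by auto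
    then have "R = (1 - t) *\<^sub>R P + t *\<^sub>R Q" by (simp add: algebra_simps)
    then have "R \<in> affine hull {P, Q}"
      unfolding affine_hull_2 by (intro CollectI exI[of _ "1 - t"] exI[of _ t] conjI) (assumption, simp)
    moreover have "{P, Q, R} - {R} = {P, Q}" using PQR by auto
    ultimately have "affine_dependent {P, Q, R}"
      unfolding affine_dependent_def by (intro bexI[of _ R]) simp_all
    with C(1) PQR(1) show False by simp
  qed
  have "{E. E edge_of K} = {closed_segment P Q, closed_segment Q R, closed_segment R P}"
  proof (intro set_eqI iffI)
    fix E assume "E \<in> {E. E edge_of K}"
    then have "E edge_of K" by simp
    then obtain c where c: "c \<subseteq> C" "E = convex hull c" "aff_dim E = 1"
      using face_of_convex_hull_affine_independent[OF C(1)] C(3) unfolding edge_of_def by auto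
    then have "card c = 2"
      using aff_dim_affine_independent[OF affine_independent_subset[OF C(1) c(1)]] by (simp add: aff_dim_convex_hull)
    then obtain x y where xy: "c = {x, y}" "x \<noteq> y" by (metis card_2_iff)
    then have "E = closed_segment x y" using c by (simp add: segment_convex_hull)
    moreover have "{x, y} = {P, Q} \<or> {x, y} = {Q, R} \<or> {x, y} = {R, P}"
      using c(1) xy PQR by auto
    ultimately show "E \<in> {closed_segment P Q, closed_segment Q R, closed_segment R P}"
      by (auto simp: doubleton_eq_iff closed_segment_commute)
  next
    fix E assume E: "E \<in> {closed_segment P Q, closed_segment Q R, closed_segment R P}"
    have edge: "closed_segment x y edge_of K" if "x \<in> C" "y \<in> C" "x \<noteq> y" for x y
    proof -
      have "\<not> affine_dependent {x, y}" using affine_independent_2 by blast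
      from aff_dim_affine_independent[OF this] have "aff_dim (closed_segment x y) = 1"
        using that by (simp add: segment_convex_hull aff_dim_convex_hull)
      moreover have "convex hull {x, y} face_of K"
        unfolding C(3) face_of_convex_hull_affine_independent[OF C(1)]
        using that by (intro exI[of _ "{x, y}"]) simp
      ultimately show ?thesis by (simp add: edge_of_def segment_convex_hull)
    qed
    show "E \<in> {E. E edge_of K}" using E PQR edge[of P Q] edge[of Q R] edge[of R P] by auto
  qed
  then show ?thesis using that tri C(3) PQR(1) by (auto simp: vertices_def)
qed

lemma simplex_2_edge_vertices:
  assumes "2 simplex K" "E edge_of K"
  obtains P Q R where "vertices K P Q R" "E = closed_segment P Q"
proof -
  obtain P Q R where v: "vertices K P Q R" using simplex_2_vertices[OF assms(1)] .
  then have "E \<in> {closed_segment P Q, closed_segment Q R, closed_segment R P}"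
    using assms(2) verticesD(3)[OF v] by blast
  then show ?thesis using that v vertices_cyc by blast
qed

lemma vertices_distinct_edges:
  assumes "vertices K P Q R"
  shows "closed_segment P Q \<noteq> closed_segment Q R" "closed_segment Q R \<noteq> closed_segment R P"
    "closed_segment P Q \<noteq> closed_segment R P"
  using tri_neq[OF verticesD(1)[OF assms]] by (auto simp: closed_segment_eq doubleton_eq_iff)

lemma sum_vertices_edges:
  assumes "vertices K P Q R"
  shows "(\<Sum>E | E edge_of K. f E) = f (closed_segment P Q) + f (closed_segment Q R) + f (closed_segment R P)"
  unfolding verticesD(3)[OF assms]
  using vertices_distinct_edges[OF assms] by (simp add: add.assoc)

lemma finite_edges_2_simplex: "2 simplex K \<Longrightarrow> finite {E. E edge_of K}" for K :: "plane set"
  by (erule simplex_2_vertices) (simp add: verticesD(3))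

lemma card_edges_2_simplex: "2 simplex K \<Longrightarrow> card {E. E edge_of K} = 3" for K :: "plane set"
proof -
  assume "2 simplex K"
  then obtain P Q R where v: "vertices K P Q R" using simplex_2_vertices by blast
  show ?thesis using sum_vertices_edges[OF v, of "\<lambda>_. 1::nat"] by simp
qed

text \<open>Distances in a simplex are maximal between corners. The longest edge is what recovers
  the weight \<open>h_K\<close> from the weights \<open>h_E\<close> in
  \<open>convection_lower_bound\<close>.\<close>

lemma simplex_2_diameter_edge:
  fixes K :: "plane set"
  assumes "2 simplex K"
  obtains E where "E edge_of K" "diameter E = diameter K"
proof -
  obtain P Q R where v: "vertices K P Q R" using simplex_2_vertices[OF assms] .
  note K = verticesD(2)[OF v]
  have cK: "compact K" unfolding K by (rule compact_hull3)
  have "K \<noteq> {}" unfolding K by simp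
  then obtain x y where xy: "x \<in> K" "y \<in> K" "dist x y = diameter K"
    using diameter_compact_attained[OF cK] by blast
  then have "\<exists>u\<in>{P, Q, R}. \<exists>w\<in>{P, Q, R}. norm (x - y) \<le> norm (u - w)"
    using simplex_extremal_le_exists[of "{P, Q, R}" x y] unfolding K by simp
  then obtain u w where uw: "u \<in> {P, Q, R}" "w \<in> {P, Q, R}" "norm (x - y) \<le> norm (u - w)"
    by blast
  have d: "diameter K \<le> dist u w" using uw(3) xy(3) by (simp add: dist_norm)
  have PQ: "dist P Q > 0" using tri_neq[OF verticesD(1)[OF v]] by simp
  have inK: "{P, Q, R} \<subseteq> K" unfolding K by (rule hull_subset)
  then have "dist P Q \<le> diameter K" using diameter_bounded_bound[OF compact_imp_bounded[OF cK]] by simp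
  then have "0 < dist u w" using d PQ by linarith
  then have "u \<noteq> w" by auto
  then have "closed_segment u w \<in> {closed_segment P Q, closed_segment Q R, closed_segment R P}"
    using uw by (auto simp: closed_segment_commute)
  then have e: "closed_segment u w edge_of K" using verticesD(3)[OF v] by blast
  have "dist u w \<le> diameter (closed_segment u w)"
    by (intro diameter_bounded_bound compact_imp_bounded[OF compact_segment]) auto
  then have "diameter K \<le> diameter (closed_segment u w)" using d by linarith
  moreover have "diameter (closed_segment u w) \<le> diameter K"
    using e cK by (intro diameter_subset compact_imp_bounded) (auto dest: edge_of_imp_subset)
  ultimately show ?thesis using that e by force
qed

section \<open>Arc length integrals over segments\<close>

lemma diameter_closed_segment: "diameter (closed_segment p q) = dist p q" for p q :: plane
proof (rule antisym)
  show "diameter (closed_segment p q) \<le> dist p q"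
  proof (rule diameter_le)
    fix x y assume "x \<in> closed_segment p q" "y \<in> closed_segment p q"
    then have "x \<in> convex hull {p, q}" "y \<in> convex hull {p, q}" by (auto simp: segment_convex_hull)
    from simplex_extremal_le_exists[OF _ this] show "norm (x - y) \<le> dist p q"
      by (auto simp: dist_norm norm_minus_commute)
  qed simp
  show "dist p q \<le> diameter (closed_segment p q)"
    by (intro diameter_bounded_bound compact_imp_bounded[OF compact_segment]) auto
qed

text \<open>The endpoints picked by \<open>SOME\<close> are determined up to their order, and
  reversing the order is the substitution of \<open>1 - t\<close> for \<open>t\<close>.\<close>

lemma edge_integral_segment:
  "edge_integral (closed_segment P Q) f = dist P Q * (LINT t:{0..1}|lborel. f (linepath P Q t))"
proof -
  obtain p q where pq: "(SOME (p, q). closed_segment P Q = closed_segment p q) = (p, q)" by force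
  have "case (SOME (p, q). closed_segment P Q = closed_segment p q) of (p, q) \<Rightarrow> closed_segment P Q = closed_segment p q"
    by (rule someI[of _ "(P, Q)"]) simp
  then have "{P, Q} = {p, q}" unfolding pq by (simp add: closed_segment_eq)
  then consider "p = P" "q = Q" | "p = Q" "q = P" by (auto simp: doubleton_eq_iff)
  then have "dist p q * (LINT t:{0..1}|lborel. f (linepath p q t)) = dist P Q * (LINT t:{0..1}|lborel. f (linepath P Q t))"
  proof cases
    case 2
    have "(LINT t:{0..1}|lborel. f (linepath Q P t)) = (LINT t|lborel. indicator {0..1} (1 - t) *\<^sub>R f (linepath Q P (1 - t)))"
      unfolding set_lebesgue_integral_def
      using lborel_integral_real_affine[of "-1" "\<lambda>t. indicator {0..1} t *\<^sub>R f (linepath Q P t)" 1] by simp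
    also have "\<dots> = (LINT t:{0..1}|lborel. f (linepath P Q t))"
      unfolding set_lebesgue_integral_def
      by (intro Bochner_Integration.integral_cong) (auto simp: indicator_def linepath_def algebra_simps)
    finally show ?thesis using 2 by (simp add: dist_commute)
  qed simp
  then show ?thesis unfolding edge_integral_def pq by simp
qed

lemma edge_integral_integrable:
  assumes "continuous_on (closed_segment P Q) (f :: plane \<Rightarrow> real)"
  shows "set_integrable lborel {0..1} (\<lambda>t. f (linepath P Q t))"
proof -
  have "continuous_on {0..1} (\<lambda>t. f (linepath P Q t))"
    by (rule continuous_on_compose2[OF assms continuous_on_linepath])
      (simp add: path_image_linepath[symmetric] path_image_def)
  then show ?thesis
    unfolding set_integrable_def by (intro borel_integrable_compact) simp_all
qed

definition is_segment :: "plane set \<Rightarrow> bool" where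
  "is_segment E \<longleftrightarrow> (\<exists>P Q. E = closed_segment P Q)"

lemma edge_integral_add:
  assumes "is_segment E" "continuous_on E f" "continuous_on E g"
  shows "edge_integral E (\<lambda>x. f x + g x) = edge_integral E f + edge_integral E g"
  using assms by (auto simp: is_segment_def edge_integral_segment edge_integral_integrable set_integral_add(2) distrib_left)

lemma edge_integral_cmult: "is_segment E \<Longrightarrow> edge_integral E (\<lambda>x. c * f x) = c * edge_integral E f"
  by (auto simp: is_segment_def edge_integral_segment)

lemma edge_integral_mono:
  assumes "is_segment E" "continuous_on E f" "continuous_on E g" "\<And>x. x \<in> E \<Longrightarrow> f x \<le> g x"
  shows "edge_integral E f \<le> edge_integral E g"
proof -
  obtain P Q where E: "E = closed_segment P Q" using assms(1) by (auto simp: is_segment_def)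
  have "(LINT t:{0..1}|lborel. f (linepath P Q t)) \<le> (LINT t:{0..1}|lborel. g (linepath P Q t))"
  proof (rule set_integral_mono)
    fix t :: real assume "t \<in> {0..1}"
    then have "linepath P Q t \<in> E" unfolding E by (metis imageI path_image_def path_image_linepath)
    then show "f (linepath P Q t) \<le> g (linepath P Q t)" by (rule assms(4))
  qed (use assms E edge_integral_integrable in auto)
  then show ?thesis unfolding E edge_integral_segment by (rule mult_left_mono) simp
qed

lemma edge_integral_cong:
  assumes "is_segment E" "\<And>x. x \<in> E \<Longrightarrow> f x = g x"
  shows "edge_integral E f = edge_integral E g"
proof -
  obtain P Q where E: "E = closed_segment P Q" using assms(1) by (auto simp: is_segment_def)
  have "(LINT t:{0..1}|lborel. f (linepath P Q t)) = (LINT t:{0..1}|lborel. g (linepath P Q t))"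
  proof (rule set_lebesgue_integral_cong)
    have "linepath P Q t \<in> E" if "t \<in> {0..1}" for t
      using that unfolding E by (metis imageI path_image_def path_image_linepath)
    then show "\<forall>t. t \<in> {0..1} \<longrightarrow> f (linepath P Q t) = g (linepath P Q t)" using assms(2) by blast
  qed simp
  then show ?thesis unfolding E edge_integral_segment by simp
qed

lemma edge_integral_const: "is_segment E \<Longrightarrow> edge_integral E (\<lambda>_. c) = diameter E * c"
  by (auto simp: is_segment_def edge_integral_segment diameter_closed_segment set_integral_const)

lemma edge_integral_nonneg:
  assumes "is_segment E" "continuous_on E f" "\<And>x. x \<in> E \<Longrightarrow> 0 \<le> f x"
  shows "0 \<le> edge_integral E f"
  using edge_integral_mono[OF assms(1) continuous_on_const assms(2), of 0] assms(3)
  by (simp add: edge_integral_const[OF assms(1)])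

lemma edge_integral_P1:
  assumes "p \<in> P1" shows "edge_integral (closed_segment P Q) p = dist P Q * ((p P + p Q) / 2)"
proof -
  obtain a c where p: "p = (\<lambda>x. a \<bullet> x + c)" using assms by (auto simp: P1_def)
  let ?F = "\<lambda>t. p P * t + (p Q - p P) * (t\<^sup>2 / 2)"
  have eq: "p (linepath P Q t) = p P + (p Q - p P) * t" for t
    by (simp add: p linepath_def inner_add_right inner_diff_right algebra_simps)
  have "(LINT t:{0..1}|lborel. p (linepath P Q t)) = ?F 1 - ?F 0"
    unfolding set_lebesgue_integral_def eq
    by (rule integral_FTC_atLeastAtMost)
      (auto intro!: derivative_eq_intros continuous_intros simp: has_real_derivative_iff_has_vector_derivative[symmetric])
  also have "\<dots> = (p P + p Q) / 2" by (simp add: field_simps)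
  finally have "(LINT t:{0..1}|lborel. p (linepath P Q t)) = (p P + p Q) / 2" .
  then show ?thesis by (simp add: edge_integral_segment)
qed

section \<open>Affine polynomials and their gradients\<close>

lemma P1_continuous: "p \<in> P1 \<Longrightarrow> continuous_on S p"
  by (auto simp: P1_def intro!: continuous_intros)

lemma P1_add: "p \<in> P1 \<Longrightarrow> q \<in> P1 \<Longrightarrow> (\<lambda>x. p x + q x) \<in> P1"
proof -
  assume "p \<in> P1" "q \<in> P1"
  then obtain a c a' c' where "p = (\<lambda>x. a \<bullet> x + c)" "q = (\<lambda>x. a' \<bullet> x + c')" by (auto simp: P1_def)
  then have "(\<lambda>x. p x + q x) = (\<lambda>x. (a + a') \<bullet> x + (c + c'))" by (auto simp: inner_add_left)
  then show ?thesis unfolding P1_def by blast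
qed

lemma P1_cmult: "p \<in> P1 \<Longrightarrow> (\<lambda>x. k * p x) \<in> P1"
proof -
  assume "p \<in> P1"
  then obtain a c where "p = (\<lambda>x. a \<bullet> x + c)" by (auto simp: P1_def)
  then have "(\<lambda>x. k * p x) = (\<lambda>x. (k *\<^sub>R a) \<bullet> x + (k * c))" by (auto simp: algebra_simps)
  then show ?thesis unfolding P1_def by blast
qed

lemma P1_const: "(\<lambda>x. k) \<in> P1"
  unfolding P1_def by (intro CollectI exI[of _ 0] exI[of _ k]) simp

lemma P1_sum: "(\<And>i. i \<in> I \<Longrightarrow> p i \<in> P1) \<Longrightarrow> (\<lambda>x. \<Sum>i\<in>I. p i x) \<in> P1"
  by (induction I rule: infinite_finite_induct) (auto intro: P1_const P1_add)

lemma P1_gradient: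
  assumes "p \<in> P1"
  shows "gradient p x = gradient p 0" "GDERIV p x :> gradient p 0" "p x = gradient p 0 \<bullet> x + p 0"
proof -
  obtain a c where p: "p = (\<lambda>x. a \<bullet> x + c)" using assms by (auto simp: P1_def)
  have g: "gradient p y = a" for y unfolding p by (rule gradient_eqI[OF GDERIV_affine])
  show "gradient p x = gradient p 0" by (simp add: g)
  show "GDERIV p x :> gradient p 0" unfolding g unfolding p by (rule GDERIV_affine)
  show "p x = gradient p 0 \<bullet> x + p 0" unfolding g by (simp add: p)
qed

lemma gradient_P1_linear:
  assumes "p \<in> P1" "q \<in> P1"
  shows "gradient (\<lambda>x. p x + q x) 0 = gradient p 0 + gradient q 0"
    "gradient (\<lambda>x. k * p x) 0 = k *\<^sub>R gradient p 0"
  using GDERIV_add[OF P1_gradient(2)[OF assms(1), of 0] P1_gradient(2)[OF assms(2), of 0]]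
    GDERIV_mult[OF GDERIV_const[of k] P1_gradient(2)[OF assms(1), of 0]]
  by (auto intro!: gradient_eqI)

lemma gradient_P1_sum:
  assumes "\<And>i. i \<in> I \<Longrightarrow> p i \<in> P1"
  shows "gradient (\<lambda>x. \<Sum>i\<in>I. p i x) 0 = (\<Sum>i\<in>I. gradient (p i) 0)"
  using assms
  by (induction I rule: infinite_finite_induct)
    (auto simp: gradient_eqI[OF GDERIV_const] gradient_P1_linear P1_sum)

lemma P1_eq_if_eq_on_open:
  assumes "p \<in> P1" "q \<in> P1" "open U" "U \<noteq> {}" "\<And>x. x \<in> U \<Longrightarrow> p x = q x"
  shows "p = q"
proof -
  obtain x where x: "x \<in> U" using assms by blast
  have "((\<lambda>y. p y) has_derivative (\<lambda>h. h \<bullet> gradient q 0)) (at x)"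
    by (rule has_derivative_transform_within_open[OF _ assms(3) x, of q])
      (use P1_gradient(2)[OF assms(2)] assms(5) in \<open>auto simp: gderiv_def\<close>)
  then have "GDERIV p x :> gradient q 0" by (simp add: gderiv_def)
  then have g: "gradient p 0 = gradient q 0"
    using gradient_eqI[of p x] P1_gradient(1)[OF assms(1), of x] by simp
  then have 0: "p 0 = q 0" using assms(5)[OF x] P1_gradient(3)[OF assms(1), of x] P1_gradient(3)[OF assms(2), of x] by simp
  show ?thesis
  proof
    fix y
    show "p y = q y"
      using g 0 P1_gradient(3)[OF assms(1), of y] P1_gradient(3)[OF assms(2), of y] by simp
  qed
qed

text \<open>The set where two affine functions differ is open, and a nonempty open set is not null.
  This is what makes \<open>elem_poly\<close> well defined.\<close>

lemma P1_AE_unique: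
  assumes "p \<in> P1" "q \<in> P1" "open U" "U \<noteq> {}" "AE x in lebesgue_on U. p x = q x"
  shows "p = q"
proof -
  let ?N = "{x \<in> U. p x - q x \<noteq> 0}"
  have "open {x. p x - q x \<noteq> 0}"
    by (intro open_Collect_neq continuous_on_diff P1_continuous assms continuous_on_const)
  then have "open (U \<inter> {x. p x - q x \<noteq> 0})" using assms(3) by blast
  moreover have "?N = U \<inter> {x. p x - q x \<noteq> 0}" by auto
  ultimately have "open ?N" by simp
  have "U \<in> sets lebesgue" using assms(3) by auto
  then have "AE x in lebesgue. x \<in> U \<longrightarrow> p x = q x"
    using assms(5) by (simp add: AE_restrict_space_iff)
  then have "AE x in lebesgue. x \<notin> ?N" by eventually_elim auto
  moreover have "?N \<in> sets lebesgue" using \<open>open ?N\<close> by (simp only: sets_completionI_sets borel_open sets_lborel)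
  ultimately have "negligible ?N" unfolding negligible_iff_null_sets using AE_iff_null_sets[of ?N lebesgue] by blast
  then have "?N = {}" using open_not_negligible[OF \<open>open ?N\<close>] by blast
  then show ?thesis using P1_eq_if_eq_on_open[OF assms(1,2,3,4)] by force
qed

text \<open>\<open>bary P Q R\<close> is zero on the edge and nonnegative on the triangle, so its
  negative normalised gradient qualifies. For uniqueness, comparing \<open>P\<close> with
  \<open>Q\<close> in both orders makes the vector perpendicular to the edge, and \<open>R\<close>
  fixes its sign.\<close>

lemma outer_normal_vertices:
  assumes "vertices K P Q R"
  shows "outer_normal K (closed_segment P Q) = - (1 / norm (bary_grad P Q R)) *\<^sub>R bary_grad P Q R"
proof -
  let ?g = "bary_grad P Q R"
  let ?n = "- (1 / norm ?g) *\<^sub>R ?g"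
  let ?E = "closed_segment P Q"
  note t = verticesD(1)[OF assms] and K = verticesD(2)[OF assms]
  have g0: "norm ?g > 0" using bary_grad_nz[OF t] by simp
  have inK: "P \<in> K" "Q \<in> K" "R \<in> K" unfolding K by (simp_all add: hull_inc)
  have inE: "P \<in> ?E" "Q \<in> ?E" by auto
  have dg: "?g \<bullet> (y - x) = bary P Q R y - bary P Q R x" for x y
    by (subst (1 2) bary_affine) (simp add: inner_diff_right)
  have E0: "bary P Q R x = 0" if xE: "x \<in> ?E" for x
  proof -
    obtain u where "x = (1 - u) *\<^sub>R P + u *\<^sub>R Q" using xE unfolding in_segment by blast
    then have "x = (1 - u) *\<^sub>R P + u *\<^sub>R Q + 0 *\<^sub>R R" by simp
    then show ?thesis using bary_affine_comb[of "1 - u" u 0 P Q R P Q R] by (simp add: bary_vertices)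
  qed
  have "norm ?n = 1 \<and> (\<forall>x\<in>?E. \<forall>y\<in>K. ?n \<bullet> (y - x) \<le> 0)"
    using g0 bary_le_1(1)[OF t] by (auto simp: dg E0 K)
  moreover have "n = ?n" if n: "norm n = 1" "\<forall>x\<in>?E. \<forall>y\<in>K. n \<bullet> (y - x) \<le> 0" for n
  proof -
    have "n \<bullet> (Q - P) \<le> 0" "n \<bullet> (P - Q) \<le> 0" using n(2) inK inE by blast+
    then have nPQ: "n \<bullet> (Q - P) = 0" by (simp add: inner_diff_right)
    have PQ: "Q - P \<noteq> 0" using tri_neq(1)[OF t] by simp
    have "cross2 (perp (Q - P)) n = 0"
      using nPQ by (simp add: cross2_def inner_plane algebra_simps)
    moreover have "perp (Q - P) \<noteq> 0" using PQ norm_perp[of "Q - P"] by force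
    ultimately obtain s where s: "n = s *\<^sub>R perp (Q - P)" using parallel_plane by blast
    define c where "c = s * cross2 (Q - P) (R - P)"
    have nc: "n = c *\<^sub>R ?g" using s t by (simp add: bary_grad_def c_def tri_def)
    have "n \<bullet> (R - P) \<le> 0" using n(2) inK inE by blast
    then have "c \<le> 0" unfolding nc using dg[of R P] bary_vertices(1)[of P Q R] bary_vertices(3)[OF t] by simp
    moreover have "\<bar>c\<bar> * norm ?g = 1" using n(1) nc by simp
    ultimately have "c = - (1 / norm ?g)" using g0 by (simp add: field_simps)
    then show ?thesis using nc by simp
  qed
  ultimately show ?thesis unfolding outer_normal_def by (rule the_equality) simp_all
qed

lemma norm_outer_normal: "vertices K P Q R \<Longrightarrow> norm (outer_normal K (closed_segment P Q)) = 1"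
  using bary_grad_nz[OF verticesD(1)] by (simp add: outer_normal_vertices)

text \<open>\<open>bary_grad P Q R\<close> has norm \<open>dist P Q\<close> divided by the absolute
  determinant, so the determinant in \<open>tri_flux\<close> turns into the arc length factor. The
  minus sign is the change from the inner to the outer normal.\<close>

lemma tri_flux_eq_edge_integral:
  assumes v: "vertices K P Q R"
  shows "tri_flux P Q R b f = - edge_integral (closed_segment P Q)
     (\<lambda>x. (b x \<bullet> outer_normal K (closed_segment P Q)) * f x)"
proof -
  let ?g = "bary_grad P Q R"
  note t = verticesD(1)[OF v]
  have g0: "norm ?g > 0" using bary_grad_nz[OF t] by simp
  have D: "\<bar>cross2 (Q - P) (R - P)\<bar> * norm ?g = dist P Q"
    using t by (simp add: bary_grad_def tri_def dist_norm norm_minus_commute)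
  have "(b x \<bullet> outer_normal K (closed_segment P Q)) * f x = - (1 / norm ?g) * ((b x \<bullet> ?g) * f x)" for x
    unfolding outer_normal_vertices[OF v] by simp
  then have "edge_integral (closed_segment P Q) (\<lambda>x. (b x \<bullet> outer_normal K (closed_segment P Q)) * f x)
     = dist P Q * (- (1 / norm ?g) * (LINT s:{0..1}|lborel. (b (linepath P Q s) \<bullet> ?g) * f (linepath P Q s)))"
    by (simp only: edge_integral_segment set_integral_mult_right)
  also have "\<dots> = - tri_flux P Q R b f"
    unfolding tri_flux_def D[symmetric] using g0 by simp
  finally show ?thesis by simp
qed

lemma shared_edge_vertices:
  assumes "2 simplex K" "2 simplex K'" "E edge_of K" "E edge_of K'"
  obtains P Q R R' where "vertices K P Q R" "vertices K' P Q R'" "E = closed_segment P Q"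
proof -
  obtain P Q R where v: "vertices K P Q R" "E = closed_segment P Q"
    using simplex_2_edge_vertices assms by blast
  obtain P' Q' R' where v': "vertices K' P' Q' R'" "E = closed_segment P' Q'"
    using simplex_2_edge_vertices assms by blast
  have "{P', Q'} = {P, Q}" using v(2) v'(2) by (simp add: closed_segment_eq)
  then have "vertices K' P Q R'" using v'(1) vertices_swap by (auto simp: doubleton_eq_iff)
  then show ?thesis using that v by blast
qed

text \<open>Triangles on the same side of a common edge overlap near its midpoint.\<close>

lemma outer_normal_opposite:
  assumes "2 simplex K" "2 simplex K'" "E edge_of K" "E edge_of K'" "interior K \<inter> interior K' = {}"
  shows "outer_normal K' E = - outer_normal K E"
proof -
  obtain P Q R R' where v: "vertices K P Q R" "vertices K' P Q R'" and E: "E = closed_segment P Q"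
    using shared_edge_vertices[OF assms(1-4)] .
  note t = verticesD(1)[OF v(1)] and t' = verticesD(1)[OF v(2)]
  let ?D = "cross2 (Q - P) (R - P)" and ?D' = "cross2 (Q - P) (R' - P)"
  have nz: "?D \<noteq> 0" "?D' \<noteq> 0" using t t' by (auto simp: tri_def)
  have "?D * ?D' < 0"
  proof (rule ccontr)
    assume "\<not> ?D * ?D' < 0"
    then have "?D * ?D' > 0" using nz by (metis mult_eq_0_iff not_less_iff_gr_or_eq)
    then have q: "?D / ?D' > 0" by (simp add: zero_less_divide_iff zero_less_mult_iff)
    \<comment> \<open>The midpoint of the common edge, pushed slightly towards \<open>R\<close>.
      Equal signs of the two determinants make the same shift lead into \<open>K'\<close> as
      well.\<close>
    let ?x = "\<lambda>\<epsilon>. P + (1/2) *\<^sub>R (Q - P) + \<epsilon> *\<^sub>R (R - P)"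
    have b1: "bary P Q R' (?x \<epsilon>) = \<epsilon> * (?D / ?D')" for \<epsilon>
      by (simp add: bary_def cross2_def algebra_simps diff_divide_distrib add_divide_distrib)
    have cont: "continuous_on UNIV (\<lambda>\<epsilon>. bary A B C (?x \<epsilon>))" for A B C
      by (rule continuous_on_compose2[OF continuous_bary[of UNIV]]) (auto intro!: continuous_intros)
    have ev: "eventually (\<lambda>\<epsilon>. 0 < bary A B C (?x \<epsilon>)) (at_right 0)" if "bary A B C (?x 0) > 0" for A B C
    proof -
      have "isCont (\<lambda>\<epsilon>. bary A B C (?x \<epsilon>)) 0" using cont[of A B C] by (simp only: continuous_on_eq_continuous_at[OF open_UNIV] ball_UNIV)
      then have "((\<lambda>\<epsilon>. bary A B C (?x \<epsilon>)) \<longlongrightarrow> bary A B C (?x 0)) (at 0)" by (simp only: isCont_def)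
      then have "((\<lambda>\<epsilon>. bary A B C (?x \<epsilon>)) \<longlongrightarrow> bary A B C (?x 0)) (at_right 0)"
        by (rule tendsto_within_subset) simp
      then show ?thesis using that order_tendstoD(1) by blast
    qed
    have "eventually (\<lambda>\<epsilon>::real. \<epsilon> > 0) (at_right 0)" by (simp add: eventually_at_right_less)
    moreover have "eventually (\<lambda>\<epsilon>. 0 < bary Q R P (?x \<epsilon>)) (at_right 0)" "eventually (\<lambda>\<epsilon>. 0 < bary R P Q (?x \<epsilon>)) (at_right 0)"
      using bary_param[OF t, of "1/2" 0] by (intro ev; simp)+
    moreover have "eventually (\<lambda>\<epsilon>. 0 < bary Q R' P (?x \<epsilon>)) (at_right 0)" "eventually (\<lambda>\<epsilon>. 0 < bary R' P Q (?x \<epsilon>)) (at_right 0)"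
      using bary_param[OF t', of "1/2" 0] by (intro ev; simp)+
    ultimately have "eventually (\<lambda>\<epsilon>. ?x \<epsilon> \<in> interior K \<inter> interior K') (at_right 0)"
    proof eventually_elim
      case (elim \<epsilon>)
      have "0 < bary P Q R (?x \<epsilon>)" using bary_param(1)[OF t] elim by simp
      moreover have "0 < bary P Q R' (?x \<epsilon>)" unfolding b1 using elim q by (intro mult_pos_pos)
      ultimately show ?case
        using elim bary_pos_subset_interior[OF t] bary_pos_subset_interior[OF t']
        unfolding verticesD(2)[OF v(1)] verticesD(2)[OF v(2)] by blast
    qed
    then have "eventually (\<lambda>\<epsilon>::real. False) (at_right 0)" using assms(5) by simp
    then show False by (simp add: trivial_limit_at_right_real)
  qed
  then have s: "sgn ?D' = - sgn ?D" by (auto simp: mult_less_0_iff sgn_if)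
  \<comment> \<open>The normal depends on the third corner only through the sign of the determinant,
    which is opposite for the two triangles.\<close>
  have n: "outer_normal L (closed_segment A B) = - (sgn (cross2 (B - A) (C - A)) / norm (B - A)) *\<^sub>R perp (B - A)"
    if "vertices L A B C" for L A B C
    unfolding outer_normal_vertices[OF that] using verticesD(1)[OF that]
    by (auto simp: bary_grad_def tri_def sgn_if)
  show ?thesis unfolding E n[OF v(1)] n[OF v(2)] s by simp
qed

section \<open>The Crouzeix--Raviart basis\<close>

text \<open>One on \<open>E\<close>, with mean value zero on the two other edges of \<open>K\<close>.\<close>

definition cr_basis :: "plane set \<Rightarrow> plane set \<Rightarrow> plane \<Rightarrow> real" where
  "cr_basis K E = (SOME \<phi>. \<exists>P Q R. vertices K P Q R \<and> E = closed_segment P Q \<and> \<phi> = (\<lambda>x. 1 - 2 * bary P Q R x))"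

lemma bary_P1: "bary P Q R \<in> P1"
  unfolding P1_def using bary_affine by blast

lemma cr_basis_obtain:
  assumes "2 simplex K" "E edge_of K"
  obtains P Q R where "vertices K P Q R" "E = closed_segment P Q" "cr_basis K E = (\<lambda>x. 1 - 2 * bary P Q R x)"
proof -
  have "\<exists>\<phi>. \<exists>P Q R. vertices K P Q R \<and> E = closed_segment P Q \<and> \<phi> = (\<lambda>x. 1 - 2 * bary P Q R x)"
    using simplex_2_edge_vertices[OF assms] by metis
  from someI_ex[OF this] show ?thesis using that unfolding cr_basis_def by blast
qed

lemma cr_basis_P1:
  assumes "2 simplex K" "E edge_of K" shows "cr_basis K E \<in> P1"
proof -
  obtain P Q R where "cr_basis K E = (\<lambda>x. 1 - 2 * bary P Q R x)" using cr_basis_obtain[OF assms] .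
  then have "cr_basis K E = (\<lambda>x. 1 + (-2) * bary P Q R x)" by simp
  then show ?thesis using P1_add[OF P1_const[of 1] P1_cmult[OF bary_P1, of "-2"]] by simp
qed

lemma cr_basis_bound:
  assumes "2 simplex K" "E edge_of K" "x \<in> K" shows "\<bar>cr_basis K E x\<bar> \<le> 1"
proof -
  obtain P Q R where v: "vertices K P Q R" "cr_basis K E = (\<lambda>x. 1 - 2 * bary P Q R x)"
    using cr_basis_obtain[OF assms(1,2)] .
  then show ?thesis using bary_le_1[OF verticesD(1)[OF v(1)], of x] assms(3) verticesD(2)[OF v(1)] by simp
qed

lemma edge_integral_cr_basis:
  assumes "2 simplex K" "E edge_of K" "E' edge_of K"
  shows "edge_integral E' (cr_basis K E) = (if E' = E then diameter E else 0)"
proof -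
  obtain P Q R where v: "vertices K P Q R" and E: "E = closed_segment P Q"
    and \<phi>: "cr_basis K E = (\<lambda>x. 1 - 2 * bary P Q R x)"
    using cr_basis_obtain[OF assms(1,2)] .
  note p = edge_integral_P1[OF cr_basis_P1[OF assms(1,2)]]
  have vals: "cr_basis K E P = 1" "cr_basis K E Q = 1" "cr_basis K E R = -1"
    using bary_vertices(1,2)[of P Q R] bary_vertices(3)[OF verticesD(1)[OF v]] by (simp_all add: \<phi>)
  have "E' \<in> {closed_segment P Q, closed_segment Q R, closed_segment R P}"
    using assms(3) verticesD(3)[OF v] by blast
  then show ?thesis
    using vertices_distinct_edges[OF v] by (auto simp: E p[unfolded E] vals[unfolded E] diameter_closed_segment)
qed

text \<open>The right-hand side sees the triangle only through the absolute determinant, which is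
  invariant under cyclic relabelling; hence all three coordinates will have the same
  integral.\<close>

lemma tri_integral_bary_reference:
  fixes P Q R :: plane
  assumes t: "tri P Q R"
  shows "(LINT x|lebesgue_on (convex hull {P, Q, R}). bary P Q R x)
    = (LINT z|(lborel \<Otimes>\<^sub>M lborel). (if 0 \<le> fst z \<and> 0 \<le> snd z \<and> fst z + snd z \<le> 1 then 1 else 0) * snd z)
       * \<bar>cross2 (Q - P) (R - P)\<bar>"
proof -
  have b: "bary P Q R (P + fst z *\<^sub>R (Q - P) + (1 * snd z) *\<^sub>R (R - P)) = snd z" for z
    using bary_param(1)[OF t] by simp
  show ?thesis
    unfolding tri_integral[OF t continuous_bary zero_less_one] b
    using indicator_hull_param[OF t] by simp
qed

text \<open>The three barycentric coordinates have equal integrals and sum to 1.\<close>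

lemma tri_integral_bary:
  assumes t: "tri P Q R"
  shows "(LINT x|lebesgue_on (convex hull {P, Q, R}). bary P Q R x) = measure lebesgue (convex hull {P, Q, R}) / 3"
proof -
  let ?K = "convex hull {P, Q, R}"
  have i: "integrable (lebesgue_on ?K) (bary A B C)" for A B C
    by (rule continuous_on_compact_lebesgue(3)[OF compact_hull3 continuous_bary])
  have e1: "(LINT x|lebesgue_on ?K. bary Q R P x) = (LINT x|lebesgue_on ?K. bary P Q R x)"
    using tri_integral_bary_reference[OF tri_cyc(1)[OF t]] tri_integral_bary_reference[OF t] by (simp add: cross2_cyc insert_commute)
  have e2: "(LINT x|lebesgue_on ?K. bary R P Q x) = (LINT x|lebesgue_on ?K. bary P Q R x)"
    using tri_integral_bary_reference[OF tri_cyc(2)[OF t]] tri_integral_bary_reference[OF t] by (simp add: cross2_cyc insert_commute)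
  have "measure lebesgue ?K = (LINT x|lebesgue_on ?K. 1)"
    by (simp add: measure_restrict_space borel_compact[OF compact_hull3])
  also have "\<dots> = (LINT x|lebesgue_on ?K. bary P Q R x + bary Q R P x + bary R P Q x)"
    by (simp add: bary_sum[OF t])
  also have "\<dots> = 3 * (LINT x|lebesgue_on ?K. bary P Q R x)"
    using i by (simp add: e1 e2)
  finally show ?thesis by simp
qed

text \<open>The fraction is \<open>1 - 2 * (1/3)\<close>. That it is positive lets the patch means
  in the test function produce squares.\<close>

lemma integral_cr_basis:
  assumes "2 simplex K" "E edge_of K"
  shows "(LINT x|lebesgue_on K. cr_basis K E x) = measure lebesgue K / 3"
proof -
  obtain P Q R where v: "vertices K P Q R" and \<phi>: "cr_basis K E = (\<lambda>x. 1 - 2 * bary P Q R x)"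
    using cr_basis_obtain[OF assms(1,2)] .
  note K = verticesD(2)[OF v]
  have i: "integrable (lebesgue_on K) (bary P Q R)" "integrable (lebesgue_on K) (\<lambda>_. 1::real)"
    unfolding K by (intro continuous_on_compact_lebesgue(3) compact_hull3 continuous_bary continuous_on_const)+
  have "(LINT x|lebesgue_on K. cr_basis K E x) = (LINT x|lebesgue_on K. 1) - 2 * (LINT x|lebesgue_on K. bary P Q R x)"
    unfolding \<phi> using i by simp
  also have "(LINT x|lebesgue_on K. 1) = measure lebesgue K"
    unfolding K by (simp add: measure_restrict_space borel_compact[OF compact_hull3])
  also have "(LINT x|lebesgue_on K. bary P Q R x) = measure lebesgue K / 3"
    unfolding K using tri_integral_bary[OF verticesD(1)[OF v]] .
  finally show ?thesis by simp
qed

text \<open>An inverse estimate. At the two ends of the diameter of the ball in the direction of the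
  gradient, the values of \<open>p\<close> differ by \<open>2 * r * norm (gradient p 0)\<close> and
  also by at most 2.\<close>

lemma P1_gradient_bound:
  assumes "p \<in> P1" "cball x r \<subseteq> K" "r > 0" "\<And>y. y \<in> K \<Longrightarrow> \<bar>p y\<bar> \<le> 1"
  shows "norm (gradient p 0) \<le> 1 / r"
proof (cases "gradient p 0 = 0")
  case False
  let ?g = "gradient p 0"
  let ?v = "(r / norm ?g) *\<^sub>R ?g"
  have n: "norm ?v = r" using False assms(3) by simp
  then have "x + ?v \<in> K" "x - ?v \<in> K" using assms(2) by (auto simp: dist_norm)
  then have "p (x + ?v) - p (x - ?v) \<le> 2" using assms(4)[of "x + ?v"] assms(4)[of "x - ?v"] by simp
  moreover have "p (x + ?v) - p (x - ?v) = 2 * (?g \<bullet> ?v)"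
    using P1_gradient(3)[OF assms(1), of "x + ?v"] P1_gradient(3)[OF assms(1), of "x - ?v"]
    by (simp add: inner_add_right inner_diff_right)
  moreover have "?g \<bullet> ?v = r * norm ?g" using False by (simp add: dot_square_norm power2_eq_square)
  ultimately have "2 * (r * norm ?g) \<le> 2" by (simp only:)
  then show ?thesis using assms(3) by (simp add: pos_le_divide_eq mult.commute)
qed (use assms in simp)

text \<open>The intersection is a face of both triangles. With nonempty interior it has full
  dimension, hence equals both.\<close>

lemma triangulation_disjoint_interior:
  assumes T: "triangulation \<T>" and K: "K \<in> \<T>" "K' \<in> \<T>" "K \<noteq> K'" and s: "2 simplex K" "2 simplex (K' :: plane set)"
  shows "interior K \<inter> interior K' = {}"
proof (rule ccontr)
  assume "interior K \<inter> interior K' \<noteq> {}"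
  then have "interior (K \<inter> K') \<noteq> {}" by simp
  then have d: "aff_dim (K \<inter> K') = 2" using aff_dim_nonempty_interior[of "K \<inter> K'"] by simp
  have f: "(K \<inter> K') face_of K" "(K \<inter> K') face_of K'" using T K unfolding triangulation_def by (metis Int_commute)+
  have adv: "aff_dim L \<le> 2" for L :: "plane set" using aff_dim_le_DIM[of L] by simp
  have cv: "convex K" "convex K'" using s convex_simplex by auto
  have "K \<inter> K' = K" using face_of_aff_dim_lt[OF cv(1) f(1)] d adv[of K] by force
  moreover have "K \<inter> K' = K'" using face_of_aff_dim_lt[OF cv(2) f(2)] d adv[of K'] by force
  ultimately show False using K(3) by simp
qed

section \<open>A single mesh\<close>

text \<open>The numbers \<open>Bb\<close>, \<open>m\<close>, \<open>H\<close>, \<open>s\<close>,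
  \<open>q\<close> are parameters so that uniformity in the mesh can be read off: they are fixed
  once for the whole family, and every constant below is a formula in them, \<open>\<alpha>\<close>
  and \<open>\<beta>\<close>.\<close>

locale nc_mesh =
  fixes \<Omega> :: "plane set" and b :: "plane \<Rightarrow> plane" and \<mu> :: "plane \<Rightarrow> real"
    and \<alpha> \<beta> :: real and M :: mesh and Bb m H s q :: real
  assumes dom: "polygonal_domain \<Omega>"
    and bW: "in_W1inf \<Omega> b" and bcont: "continuous_on (closure \<Omega>) b"
    and mu: "in_Linf \<Omega> \<mu>"
    and alpha: "\<alpha> > 0" and coer: "AE x in lebesgue_on \<Omega>. \<mu> x - 1/2 * weak_div \<Omega> b x \<ge> \<alpha>"
    and mesh: "mesh_of \<Omega> M" and beta: "\<beta> > 0"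
    and Bb: "\<And>x. x \<in> closure \<Omega> \<Longrightarrow> norm (b x) \<le> Bb" "Bb \<ge> 0"
    and m: "AE x in lebesgue_on \<Omega>. \<bar>\<mu> x\<bar> \<le> m" "m \<ge> 0"
    and H: "\<And>K. K \<in> triangles M \<Longrightarrow> diameter K \<le> H" "H \<ge> 0"
    and s: "s > 0" "\<And>K. K \<in> triangles M \<Longrightarrow> \<exists>x r. cball x r \<subseteq> K \<and> r > 0 \<and> diameter K \<le> s * r"
    and q: "q \<ge> 0" "\<And>K K'. K \<in> triangles M \<Longrightarrow> K' \<in> triangles M \<Longrightarrow> K \<inter> K' \<noteq> {} \<Longrightarrow> diameter K \<le> q * diameter K'"
begin

abbreviation T where "T \<equiv> triangles M"

text \<open>Integrals are taken over the open triangle because \<open>\<mu>\<close> is given on \<open>\<Omega>\<close> only, while \<open>K\<close> may contain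
  boundary points of \<open>\<Omega>\<close>.\<close>

definition int_el :: "plane set \<Rightarrow> (plane \<Rightarrow> real) \<Rightarrow> real" where
  "int_el K F = (LINT x|lebesgue_on (interior K). F x)"

definition integrable_el :: "plane set \<Rightarrow> (plane \<Rightarrow> real) \<Rightarrow> bool" where
  "integrable_el K F \<longleftrightarrow> integrable (lebesgue_on (interior K)) F"

lemma open_dom: "open \<Omega>" using dom by (simp add: polygonal_domain_def)

lemma finite_T: "finite T" and T_simplex: "K \<in> T \<Longrightarrow> 2 simplex K" and T_Union: "\<Union>T = closure \<Omega>"
  and T_triangulation: "triangulation T"
  using mesh by (auto simp: mesh_of_def triangulation_def)

lemma T_sub: "K \<in> T \<Longrightarrow> K \<subseteq> closure \<Omega>" using T_Union by blast

lemma T_int: "K \<in> T \<Longrightarrow> interior K \<subseteq> \<Omega>"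
  using interior_mono[OF T_sub] polygonal_domain_interior_closure[OF dom] by blast

lemma T_compact: "K \<in> T \<Longrightarrow> compact K"
  using compact_simplex T_simplex by blast

lemma T_convex: "K \<in> T \<Longrightarrow> convex K"
  using convex_simplex T_simplex by blast

lemma T_disjoint: "K \<in> T \<Longrightarrow> K' \<in> T \<Longrightarrow> K \<noteq> K' \<Longrightarrow> interior K \<inter> interior K' = {}"
  using triangulation_disjoint_interior[OF T_triangulation] T_simplex by blast

lemma T_interior_nonempty: "K \<in> T \<Longrightarrow> interior K \<noteq> {}"
  using s(2)[of K] interior_mono by (metis ball_subset_cball centre_in_ball empty_iff interior_maximal open_ball subset_trans subset_iff)

lemma T_frontier: "K \<in> T \<Longrightarrow> AE x in lebesgue. x \<notin> frontier K"
  using negligible_convex_frontier[OF T_convex] AE_not_in by (auto simp: negligible_iff_null_sets)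

lemma b_cont: "K \<in> T \<Longrightarrow> continuous_on K b"
  using bcont T_sub continuous_on_subset by blast

text \<open>The frontier of a convex set is null, so the open and the closed triangle give the same
  integral.\<close>

lemma continuous_int_el:
  assumes K: "K \<in> T" and F: "continuous_on K F"
  shows "integrable_el K F" "int_el K F = (LINT x|lebesgue_on K. F x)"
proof -
  have sK: "K \<inter> space lebesgue \<in> sets lebesgue" and sI: "interior K \<inter> space lebesgue \<in> sets lebesgue"
    using T_compact[OF K] by (auto simp: borel_compact)
  have i: "integrable lebesgue (\<lambda>x. indicator K x *\<^sub>R F x)"
    using continuous_on_compact_lebesgue(3)[OF T_compact[OF K] F] unfolding integrable_restrict_space[OF sK] .
  have "integrable lebesgue (\<lambda>x. indicator (interior K) x *\<^sub>R (indicator K x *\<^sub>R F x))"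
    by (rule integrable_mult_indicator[OF _ i]) simp
  moreover have "(\<lambda>x. indicator (interior K) x *\<^sub>R (indicator K x *\<^sub>R F x)) = (\<lambda>x. indicator (interior K) x *\<^sub>R F x)"
    using interior_subset[of K] by (auto simp: indicator_def fun_eq_iff)
  ultimately have i': "integrable lebesgue (\<lambda>x. indicator (interior K) x *\<^sub>R F x)" by simp
  then show "integrable_el K F" unfolding integrable_el_def integrable_restrict_space[OF sI] .
  show "int_el K F = (LINT x|lebesgue_on K. F x)"
    unfolding int_el_def integral_restrict_space[OF sI] integral_restrict_space[OF sK]
  proof (rule integral_cong_AE)
    show "AE x in lebesgue. indicator (interior K) x *\<^sub>R F x = indicator K x *\<^sub>R F x"
      using T_frontier[OF K]
    proof eventually_elim
      case (elim x)
      then show ?case using interior_subset[of K] compact_imp_closed[OF T_compact[OF K]]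
        by (auto simp: frontier_def indicator_def)
    qed
  qed (rule borel_measurable_integrable[OF i'], rule borel_measurable_integrable[OF i])
qed

lemma integrable_el_mu:
  assumes K: "K \<in> T" and F: "continuous_on K F"
  shows "integrable_el K (\<lambda>x. \<mu> x * F x)"
  unfolding integrable_el_def
proof (rule Bochner_Integration.integrable_bound[of _ "\<lambda>x. m * F x"])
  have F': "integrable (lebesgue_on (interior K)) F" using continuous_int_el(1)[OF assms] by (simp add: integrable_el_def)
  then show "integrable (lebesgue_on (interior K)) (\<lambda>x. m * F x)" by simp
  have "\<mu> \<in> borel_measurable (lebesgue_on (interior K))"
    using mu T_int[OF K] measurable_restrict_mono unfolding in_Linf_def by blast
  then show "(\<lambda>x. \<mu> x * F x) \<in> borel_measurable (lebesgue_on (interior K))" using F' by simp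
  have "AE x in lebesgue. x \<in> \<Omega> \<longrightarrow> \<bar>\<mu> x\<bar> \<le> m"
    using m(1) open_dom by (simp add: AE_restrict_space_iff)
  then have "AE x in lebesgue. x \<in> interior K \<longrightarrow> norm (\<mu> x * F x) \<le> norm (m * F x)"
  proof eventually_elim
    case (elim x)
    then show ?case using T_int[OF K] m(2) by (auto simp: abs_mult intro!: mult_right_mono)
  qed
  then show "AE x in lebesgue_on (interior K). norm (\<mu> x * F x) \<le> norm (m * F x)"
    by (simp add: AE_restrict_space_iff)
qed

section \<open>Calculus of element integrals\<close>

lemma int_el_add: "integrable_el K F \<Longrightarrow> integrable_el K G \<Longrightarrow> int_el K (\<lambda>x. F x + G x) = int_el K F + int_el K G"
  by (simp add: int_el_def integrable_el_def)

lemma int_el_diff: "integrable_el K F \<Longrightarrow> integrable_el K G \<Longrightarrow> int_el K (\<lambda>x. F x - G x) = int_el K F - int_el K G"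
  by (simp add: int_el_def integrable_el_def)

lemma int_el_cmult: "int_el K (\<lambda>x. c * F x) = c * int_el K F"
  by (simp add: int_el_def)

lemma integrable_el_add: "integrable_el K F \<Longrightarrow> integrable_el K G \<Longrightarrow> integrable_el K (\<lambda>x. F x + G x)"
  by (simp add: integrable_el_def)

lemma integrable_el_cmult: "integrable_el K F \<Longrightarrow> integrable_el K (\<lambda>x. c * F x)"
  by (simp add: integrable_el_def)

lemma int_el_mono: "integrable_el K F \<Longrightarrow> integrable_el K G \<Longrightarrow> (\<And>x. x \<in> interior K \<Longrightarrow> F x \<le> G x) \<Longrightarrow> int_el K F \<le> int_el K G"
  unfolding int_el_def integrable_el_def by (rule integral_mono_AE) (auto intro!: AE_I2)

lemma int_el_nonneg: "(\<And>x. x \<in> interior K \<Longrightarrow> 0 \<le> F x) \<Longrightarrow> 0 \<le> int_el K F"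
  unfolding int_el_def by (rule integral_nonneg_AE) (auto intro!: AE_I2)

lemma int_el_const: "K \<in> T \<Longrightarrow> int_el K (\<lambda>x. c) = measure lebesgue K * c"
  using continuous_int_el(2)[of K "\<lambda>x. c"] T_compact[of K] by (simp add: measure_restrict_space borel_compact)

lemma int_el_cong: "(\<And>x. x \<in> interior K \<Longrightarrow> F x = G x) \<Longrightarrow> int_el K F = int_el K G"
  unfolding int_el_def by (rule Bochner_Integration.integral_cong) auto

lemma integrable_el_cong: "(\<And>x. x \<in> interior K \<Longrightarrow> F x = G x) \<Longrightarrow> integrable_el K F \<longleftrightarrow> integrable_el K G"
  unfolding integrable_el_def by (rule Bochner_Integration.integrable_cong) auto

lemma int_el_cong_AE:
  assumes "AE x in lebesgue_on (interior K). F x = G x" "F \<in> borel_measurable (lebesgue_on (interior K))" "integrable_el K G"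
  shows "int_el K F = int_el K G" "integrable_el K F"
  using assms integral_cong_AE[OF assms(2) _ assms(1)] integrable_cong_AE[OF assms(2) _ assms(1)]
  by (auto simp: int_el_def integrable_el_def)

text \<open>Distinct triangles have disjoint interiors and null frontiers, so almost every point of
  \<open>S\<close> lies in the interior of exactly one triangle of \<open>TT\<close>.\<close>

lemma AE_indicator_split:
  assumes TT: "TT \<subseteq> T" and S: "S \<subseteq> \<Union>TT" "\<And>K. K \<in> TT \<Longrightarrow> interior K \<subseteq> S"
  shows "AE x in lebesgue. indicator S x = (\<Sum>K\<in>TT. indicator (interior K) x :: real)"
proof -
  have fin: "finite TT" using TT finite_T finite_subset by blast
  have "AE x in lebesgue. \<forall>K\<in>TT. x \<notin> frontier K"
    using T_frontier TT by (intro AE_finite_allI fin) auto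
  then show ?thesis
  proof eventually_elim
    case (elim x)
    show ?case
    proof (cases "\<exists>K\<in>TT. x \<in> interior K")
      case True
      then obtain K where K: "K \<in> TT" "x \<in> interior K" by blast
      have "indicator (interior K') x = (if K' = K then 1 else 0 :: real)" if "K' \<in> TT" for K'
        using T_disjoint[of K' K] TT that K by (auto simp: indicator_def)
      then have "(\<Sum>K\<in>TT. indicator (interior K) x :: real) = (\<Sum>K'\<in>TT. if K' = K then 1 else 0)"
        by (rule sum.cong[OF refl])
      then show ?thesis using K S(2)[OF K(1)] fin by (auto simp: indicator_def)
    next
      case False
      have "x \<notin> K" if "K \<in> TT" for K
      proof -
        have "closed K" using that TT compact_imp_closed[OF T_compact] by blast
        then show ?thesis using False elim that by (auto simp: frontier_def)
      qed
      then have "x \<notin> S" using S(1) by blast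
      moreover have "(\<Sum>K\<in>TT. indicator (interior K) x :: real) = 0"
        using False by (intro sum.neutral) (auto simp: indicator_def)
      ultimately show ?thesis by simp
    qed
  qed
qed

lemma integral_split:
  assumes TT: "TT \<subseteq> T" and S: "S \<subseteq> \<Union>TT" "\<And>K. K \<in> TT \<Longrightarrow> interior K \<subseteq> S" "S \<in> sets lebesgue"
    and f: "f \<in> borel_measurable (lebesgue_on S)" "\<And>K. K \<in> TT \<Longrightarrow> integrable_el K f"
  shows "(LINT x|lebesgue_on S. f x) = (\<Sum>K\<in>TT. int_el K f)" "integrable (lebesgue_on S) f"
proof -
  have sS: "S \<inter> space lebesgue \<in> sets lebesgue" using S(3) by simp
  have sI: "interior K \<inter> space lebesgue \<in> sets lebesgue" for K :: "plane set" by simp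
  have i: "integrable lebesgue (\<lambda>x. indicator (interior K) x *\<^sub>R f x)" if "K \<in> TT" for K
    using f(2)[OF that] unfolding integrable_el_def integrable_restrict_space[OF sI] .
  have i': "integrable lebesgue (\<lambda>x. \<Sum>K\<in>TT. indicator (interior K) x *\<^sub>R f x)"
    using i by (intro Bochner_Integration.integrable_sum)
  have mS: "(\<lambda>x. indicator S x *\<^sub>R f x) \<in> borel_measurable lebesgue"
    using f(1) borel_measurable_restrict_space_iff[OF sS, of f] by simp
  have ae: "AE x in lebesgue. indicator S x *\<^sub>R f x = (\<Sum>K\<in>TT. indicator (interior K) x *\<^sub>R f x)"
  proof -
    have "AE x in lebesgue. indicator S x = (\<Sum>K\<in>TT. indicator (interior K) x :: real)"
      by (rule AE_indicator_split[OF TT S(1)]) (rule S(2))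
    then show ?thesis by eventually_elim (simp add: sum_distrib_right)
  qed
  have "(LINT x|lebesgue_on S. f x) = (LINT x|lebesgue. (\<Sum>K\<in>TT. indicator (interior K) x *\<^sub>R f x))"
    unfolding integral_restrict_space[OF sS]
    by (rule integral_cong_AE[OF mS _ ae]) (use i' in auto)
  also have "\<dots> = (\<Sum>K\<in>TT. int_el K f)"
    unfolding int_el_def integral_restrict_space[OF sI] using i by (subst Bochner_Integration.integral_sum) auto
  finally show "(LINT x|lebesgue_on S. f x) = (\<Sum>K\<in>TT. int_el K f)" .
  show "integrable (lebesgue_on S) f"
    unfolding integrable_restrict_space[OF sS]
    using integrable_cong_AE[OF mS _ ae] i' by auto
qed

section \<open>Edges and their adjacent triangles\<close>

definition adj :: "plane set \<Rightarrow> plane set set" where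
  "adj E = {K \<in> T. E edge_of K}"

lemma adj_sub: "adj E \<subseteq> T" and finite_adj: "finite (adj E)"
  using finite_T by (auto simp: adj_def)

lemma finite_edges_of: "K \<in> T \<Longrightarrow> finite {E. E edge_of K}"
  using finite_edges_2_simplex T_simplex by blast

lemma edges_eq: "edges M = (\<Union>K\<in>T. {E. E edge_of K})" by (auto simp: edges_def)

lemma finite_edges: "finite (edges M)"
  unfolding edges_eq using finite_T finite_edges_of by blast

lemma edge_facts:
  assumes "K \<in> T" "E edge_of K"
  shows "is_segment E" "E \<subseteq> K" "0 \<le> diameter E" "diameter E \<le> diameter K" "E \<subseteq> closure \<Omega>" "E \<in> edges M" "K \<in> adj E" "E \<noteq> {}"
proof -
  obtain P Q R where v: "vertices K P Q R" "E = closed_segment P Q"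
    using simplex_2_edge_vertices[OF T_simplex[OF assms(1)] assms(2)] .
  show "is_segment E" using v by (auto simp: is_segment_def)
  show sub: "E \<subseteq> K" using assms(2) by (rule edge_of_imp_subset)
  show "0 \<le> diameter E" unfolding v(2) diameter_closed_segment by simp
  show "diameter E \<le> diameter K" using sub T_compact[OF assms(1)] by (intro diameter_subset compact_imp_bounded)
  show "E \<subseteq> closure \<Omega>" using sub T_sub[OF assms(1)] by blast
  show "E \<in> edges M" "K \<in> adj E" using assms by (auto simp: edges_def adj_def)
  show "E \<noteq> {}" using v(2) by auto
qed

lemma edges_E: "E \<in> edges M \<Longrightarrow> \<exists>K\<in>T. E edge_of K" by (auto simp: edges_def)

lemma sum_edges_swap: "(\<Sum>E\<in>edges M. \<Sum>K\<in>adj E. f K E) = (\<Sum>K\<in>T. \<Sum>E | E edge_of K. f K E)"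
proof -
  have "(\<Sum>E\<in>edges M. \<Sum>K\<in>adj E. f K E) = (\<Sum>K\<in>T. \<Sum>E | E \<in> edges M \<and> E edge_of K. f K E)"
    unfolding adj_def using finite_edges finite_T by (rule sum.swap_restrict)
  also have "\<dots> = (\<Sum>K\<in>T. \<Sum>E | E edge_of K. f K E)"
    by (intro sum.cong refl) (auto simp: edges_def)
  finally show ?thesis .
qed

lemma opposite:
  assumes "K \<in> adj E" "K' \<in> adj E" "K \<noteq> K'"
  shows "outer_normal K' E = - outer_normal K E"
  using assms T_disjoint[of K K'] T_simplex by (intro outer_normal_opposite) (auto simp: adj_def)

lemma norm_outer_normal_adj: "K \<in> adj E \<Longrightarrow> norm (outer_normal K E) = 1"
proof -
  assume "K \<in> adj E"
  then have "2 simplex K" "E edge_of K" using T_simplex by (auto simp: adj_def)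
  then obtain P Q R where "vertices K P Q R" "E = closed_segment P Q" using simplex_2_edge_vertices by blast
  then show ?thesis using norm_outer_normal by simp
qed

text \<open>A third triangle at the edge would have its outer normal opposite to two vectors that
  are opposite to each other. The normal would equal its own negative, which contradicts norm
  1.\<close>

lemma interior_edge:
  assumes E: "E \<in> interior_edges M"
  shows "adj E = {plus_elem M E, minus_elem M E}" "plus_elem M E \<noteq> minus_elem M E"
    "plus_elem M E \<in> T" "minus_elem M E \<in> T" "E edge_of plus_elem M E" "E edge_of minus_elem M E"
    "edge_normal M E = outer_normal (plus_elem M E) E"
    "outer_normal (minus_elem M E) E = - edge_normal M E"
    "E \<in> edges M"
proof -
  show pm: "plus_elem M E \<noteq> minus_elem M E"
    "plus_elem M E \<in> T" "minus_elem M E \<in> T" "E edge_of plus_elem M E" "E edge_of minus_elem M E"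
    using mesh E by (auto simp: mesh_of_def)
  then have a: "plus_elem M E \<in> adj E" "minus_elem M E \<in> adj E" by (auto simp: adj_def)
  show n: "edge_normal M E = outer_normal (plus_elem M E) E" using E by (simp add: edge_normal_def)
  show n': "outer_normal (minus_elem M E) E = - edge_normal M E" using opposite[OF a pm(1)] n by simp
  have "K = plus_elem M E \<or> K = minus_elem M E" if K: "K \<in> adj E" for K
  proof (rule ccontr)
    assume "\<not> ?thesis"
    then have "outer_normal K E = - outer_normal (plus_elem M E) E" "outer_normal K E = - outer_normal (minus_elem M E) E"
      using opposite[OF a(1) K] opposite[OF a(2) K] by auto
    then have "outer_normal K E = - outer_normal K E" using n n' by simp
    then have "outer_normal K E = 0" by (simp add: eq_neg_iff_add_eq_0 scaleR_2[symmetric])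
    then show False using norm_outer_normal_adj[OF K] by simp
  qed
  then show "adj E = {plus_elem M E, minus_elem M E}" using a by blast
  show "E \<in> edges M" using pm by (auto simp: edges_def)
qed

lemma boundary_edge:
  assumes E: "E \<in> boundary_edges M"
  shows "adj E = {boundary_elem M E}" "boundary_elem M E \<in> T" "E edge_of boundary_elem M E"
    "edge_normal M E = outer_normal (boundary_elem M E) E" "E \<in> edges M"
proof -
  have e: "E \<in> edges M" "E \<notin> interior_edges M" using E by (auto simp: boundary_edges_def)
  then obtain K where K: "K \<in> T" "E edge_of K" by (auto simp: edges_def)
  have u: "K' = K" if "K' \<in> T" "E edge_of K'" for K'
    using e(2) K that unfolding interior_edges_def by blast
  have be: "boundary_elem M E = K" unfolding boundary_elem_def
  proof (rule the_equality)
    show "K \<in> T \<and> E edge_of K" using K by blast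
    show "K' = K" if "K' \<in> T \<and> E edge_of K'" for K' using that u by blast
  qed
  show "adj E = {boundary_elem M E}"
  proof
    show "adj E \<subseteq> {boundary_elem M E}" unfolding be adj_def using u by blast
    show "{boundary_elem M E} \<subseteq> adj E" unfolding be adj_def using K by blast
  qed
  show "boundary_elem M E \<in> T" "E edge_of boundary_elem M E" "E \<in> edges M" unfolding be using K e by blast+
  show "edge_normal M E = outer_normal (boundary_elem M E) E" using e by (simp add: edge_normal_def)
qed

lemma edges_split: "edges M = boundary_edges M \<union> interior_edges M" "boundary_edges M \<inter> interior_edges M = {}"
  using interior_edge(9) by (auto simp: boundary_edges_def)

lemma finite_be: "finite (boundary_edges M)" and finite_ie: "finite (interior_edges M)"
  using finite_edges edges_split(1) by auto

lemma sum_edges_split: "(\<Sum>E\<in>edges M. f E) = (\<Sum>E\<in>boundary_edges M. f E) + (\<Sum>E\<in>interior_edges M. f E)"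
  unfolding edges_split(1) using finite_be finite_ie edges_split(2) by (rule sum.union_disjoint)

lemma card_adj: "E \<in> edges M \<Longrightarrow> card (adj E) \<le> 2"
  unfolding edges_split(1) using interior_edge(1) boundary_edge(1) by (auto simp: card_insert_if)

lemma edge_normal_norm: "E \<in> edges M \<Longrightarrow> norm (edge_normal M E) = 1"
  unfolding edges_split(1) using interior_edge boundary_edge norm_outer_normal_adj by auto

end

section \<open>The forms on broken polynomials\<close>

type_synonym broken = "plane set \<Rightarrow> plane \<Rightarrow> real"

context nc_mesh
begin

text \<open>A broken polynomial is a family of polynomials indexed by the triangles. On such families,
  \<open>A_form\<close> is \<open>A\<^sub>h\<^sup>n\<^sup>c\<close>, \<open>S_form\<close> is \<open>S\<^sub>h\<^sup>n\<^sup>c\<close>, \<open>fluct\<close> is \<open>\<kappa>\<^sub>E\<close>, and \<open>energy + adv_energy\<close> is \<open>|||\<cdot>|||\<^sup>2\<close>, with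
  \<open>adv_energy\<close> the part that \<open>A\<^sub>h\<^sup>n\<^sup>c(u, u)\<close> does not control.\<close>

definition broken_P1 :: "broken \<Rightarrow> bool" where
  "broken_P1 U \<longleftrightarrow> (\<forall>K\<in>T. U K \<in> P1)"

definition adv :: "broken \<Rightarrow> plane set \<Rightarrow> plane \<Rightarrow> real" where
  "adv U K x = b x \<bullet> gradient (U K) 0"

definition patch_mean :: "broken \<Rightarrow> plane set \<Rightarrow> real" where
  "patch_mean U E = (\<Sum>K\<in>adj E. int_el K (adv U K)) / (\<Sum>K\<in>adj E. measure lebesgue K)"

definition fluct :: "broken \<Rightarrow> plane set \<Rightarrow> plane set \<Rightarrow> plane \<Rightarrow> real" where
  "fluct U E K x = adv U K x - patch_mean U E"

definition S_form :: "broken \<Rightarrow> broken \<Rightarrow> real" where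
  "S_form U V = (\<Sum>E\<in>edges M. (\<beta> * diameter E) * (\<Sum>K\<in>adj E. int_el K (\<lambda>x. fluct U E K x * fluct V E K x)))"

definition b_n :: "plane set \<Rightarrow> plane \<Rightarrow> real" where
  "b_n E x = b x \<bullet> edge_normal M E"

definition b_jump :: "broken \<Rightarrow> plane set \<Rightarrow> plane \<Rightarrow> real" where
  "b_jump U E x = U (plus_elem M E) x - U (minus_elem M E) x"

definition b_avg :: "broken \<Rightarrow> plane set \<Rightarrow> plane \<Rightarrow> real" where
  "b_avg U E x = (U (plus_elem M E) x + U (minus_elem M E) x) / 2"

definition b_trace :: "broken \<Rightarrow> plane set \<Rightarrow> plane \<Rightarrow> real" where
  "b_trace U E x = U (boundary_elem M E) x"

definition A_form :: "broken \<Rightarrow> broken \<Rightarrow> real" where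
  "A_form U V = (\<Sum>K\<in>T. int_el K (\<lambda>x. adv U K x * V K x)) + (\<Sum>K\<in>T. int_el K (\<lambda>x. \<mu> x * (U K x * V K x)))
     + (\<Sum>E\<in>boundary_edges M. edge_integral E (\<lambda>x. neg_part (b_n E x) * b_trace U E x * b_trace V E x))
     - (\<Sum>E\<in>interior_edges M. edge_integral E (\<lambda>x. b_n E x * b_jump U E x * b_avg V E x))
     + (\<Sum>E\<in>interior_edges M. edge_integral E (\<lambda>x. \<bar>b_n E x\<bar> / 2 * b_jump U E x * b_jump V E x))
     + S_form U V"

definition energy :: "broken \<Rightarrow> real" where
  "energy U = \<alpha> * (\<Sum>K\<in>T. int_el K (\<lambda>x. (U K x)\<^sup>2))
     + (\<Sum>E\<in>boundary_edges M. edge_integral E (\<lambda>x. \<bar>b_n E x\<bar> / 2 * (b_trace U E x)\<^sup>2))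
     + S_form U U
     + (\<Sum>E\<in>interior_edges M. edge_integral E (\<lambda>x. \<bar>b_n E x\<bar> / 2 * (b_jump U E x)\<^sup>2))"

definition adv_energy :: "broken \<Rightarrow> real" where
  "adv_energy U = (\<Sum>K\<in>T. diameter K * int_el K (\<lambda>x. (adv U K x)\<^sup>2))"

definition represents :: "(plane \<Rightarrow> real) \<Rightarrow> broken \<Rightarrow> bool" where
  "represents v V \<longleftrightarrow> v \<in> borel_measurable (lebesgue_on \<Omega>) \<and> broken_P1 V \<and>
     (\<forall>K\<in>T. AE x in lebesgue_on (interior K). v x = V K x)"

lemma cont_adv: "K \<in> T \<Longrightarrow> continuous_on K (adv U K)"
  unfolding adv_def by (intro continuous_intros b_cont)

lemma cont_broken_P1: "broken_P1 U \<Longrightarrow> K \<in> T \<Longrightarrow> continuous_on S (U K)"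
  by (simp add: broken_P1_def P1_continuous)

lemma cont_fluct: "K \<in> T \<Longrightarrow> continuous_on K (fluct U E K)"
  unfolding fluct_def by (intro continuous_intros cont_adv)

section \<open>Functions on the domain and the broken polynomials that represent them\<close>

lemma AE_interior_of_closed:
  assumes "K \<in> T" shows "(AE x in lebesgue_on K. P x) \<longleftrightarrow> (AE x in lebesgue_on (interior K). P x)"
proof -
  have sK: "K \<in> sets lebesgue" using T_compact[OF assms] by (simp add: borel_compact)
  have "(AE x in lebesgue. x \<in> K \<longrightarrow> P x) \<longleftrightarrow> (AE x in lebesgue. x \<in> interior K \<longrightarrow> P x)"
  proof
    assume "AE x in lebesgue. x \<in> K \<longrightarrow> P x"
    then show "AE x in lebesgue. x \<in> interior K \<longrightarrow> P x"
      by eventually_elim (use interior_subset in blast)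
  next
    assume "AE x in lebesgue. x \<in> interior K \<longrightarrow> P x"
    then show "AE x in lebesgue. x \<in> K \<longrightarrow> P x" using T_frontier[OF assms]
      by eventually_elim (use closure_closed[OF compact_imp_closed[OF T_compact[OF assms]]] in \<open>auto simp: frontier_def\<close>)
  qed
  then show ?thesis using sK by (simp add: AE_restrict_space_iff)
qed

lemma elem_poly_represents:
  assumes "represents v V" "K \<in> T" shows "elem_poly v K = V K"
  unfolding elem_poly_def
proof (rule the_equality)
  have V: "V K \<in> P1" "AE x in lebesgue_on (interior K). v x = V K x" using assms by (auto simp: represents_def broken_P1_def)
  then show "V K \<in> P1 \<and> (AE x in lebesgue_on K. v x = V K x)" using AE_interior_of_closed[OF assms(2)] by blast
  fix p assume "p \<in> P1 \<and> (AE x in lebesgue_on K. v x = p x)"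
  then have p: "p \<in> P1" "AE x in lebesgue_on (interior K). v x = p x" using AE_interior_of_closed[OF assms(2)] by blast+
  have "AE x in lebesgue_on (interior K). p x = V K x" using p(2) V(2) by eventually_elim simp
  then show "p = V K" using P1_AE_unique[OF p(1) V(1) open_interior T_interior_nonempty[OF assms(2)]] by blast
qed

lemma represents_elem_poly:
  assumes "v \<in> V_nc \<Omega> M" shows "represents v (elem_poly v)"
proof -
  have m: "v \<in> borel_measurable (lebesgue_on \<Omega>)" using assms by (auto simp: V_nc_def in_L2_def)
  have "elem_poly v K \<in> P1 \<and> (AE x in lebesgue_on (interior K). v x = elem_poly v K x)" if K: "K \<in> T" for K
  proof -
    obtain p where p: "p \<in> P1" "AE x in lebesgue_on (interior K). v x = p x"
      using assms K AE_interior_of_closed[OF K] unfolding V_nc_def by blast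
    \<comment> \<open>An auxiliary family with \<open>p\<close> on \<open>K\<close> and any
      admissible polynomial elsewhere. Uniqueness then identifies \<open>elem_poly v K\<close> with
      \<open>p\<close>.\<close>
    have "represents v (\<lambda>L. if L = K then p else (SOME p. p \<in> P1 \<and> (AE x in lebesgue_on (interior L). v x = p x)))"
      unfolding represents_def broken_P1_def
    proof (intro conjI ballI m)
      have ex: "\<exists>p. p \<in> P1 \<and> (AE x in lebesgue_on (interior L). v x = p x)" if "L \<in> T" for L
        using assms that AE_interior_of_closed[OF that] unfolding V_nc_def by blast
      fix L assume L: "L \<in> T"
      note e = someI_ex[OF ex[OF L]]
      show "(if L = K then p else (SOME p. p \<in> P1 \<and> (AE x in lebesgue_on (interior L). v x = p x))) \<in> P1" using p e by simp
      show "AE x in lebesgue_on (interior L). v x = (if L = K then p else (SOME p. p \<in> P1 \<and> (AE x in lebesgue_on (interior L). v x = p x))) x"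
        using p e by (cases "L = K") auto
    qed
    from elem_poly_represents[OF this K] have "elem_poly v K = p" by simp
    then show ?thesis using p by simp
  qed
  then show ?thesis using m by (simp add: represents_def broken_P1_def)
qed

lemma sum_indicator_interior:
  assumes "K \<in> T" "x \<in> interior K"
  shows "(\<Sum>L\<in>T. indicator (interior L) x *\<^sub>R (f L :: 'a :: real_vector)) = f K"
proof -
  have "indicator (interior L) x *\<^sub>R f L = (if L = K then f K else 0)" if "L \<in> T" for L
    using T_disjoint[of L K] that assms by (auto simp: indicator_def)
  then have "(\<Sum>L\<in>T. indicator (interior L) x *\<^sub>R f L) = (\<Sum>L\<in>T. if L = K then f K else 0)"
    by (rule sum.cong[OF refl])
  also have "\<dots> = f K" using assms(1) finite_T by simp
  finally show ?thesis .
qed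

lemma advect_interior:
  assumes "represents v V" "K \<in> T" "x \<in> interior K" shows "advect b M v x = adv V K x"
proof -
  have "V K \<in> P1" using assms by (auto simp: represents_def broken_P1_def)
  then have g: "gradient (elem_poly v K) x = gradient (V K) 0"
    using P1_gradient(1)[of "V K" x] elem_poly_represents[OF assms(1,2)] by simp
  show ?thesis
    unfolding advect_def broken_gradient_def sum_indicator_interior[OF assms(2,3)] adv_def g ..
qed

lemma mesh_size_interior:
  assumes "K \<in> T" "x \<in> interior K" shows "mesh_size M x = diameter K"
  using sum_indicator_interior[OF assms, of "\<lambda>K. diameter K"] by (simp add: mesh_size_def)

lemma borel_indicator_interior_cont:
  assumes "K \<in> T" "continuous_on K F"
  shows "(\<lambda>x. indicator (interior K) x * (F x :: real)) \<in> borel_measurable borel"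
proof -
  have "(\<lambda>x. indicator (interior K) x * (indicator K x * F x)) \<in> borel_measurable borel"
    using continuous_on_compact_lebesgue(1)[OF T_compact[OF assms(1)] assms(2)] by measurable
  moreover have "(\<lambda>x. indicator (interior K) x * (indicator K x * F x)) = (\<lambda>x. indicator (interior K) x * F x)"
    using interior_subset[of K] by (auto simp: indicator_def fun_eq_iff)
  ultimately show ?thesis by simp
qed

lemma borel_to_lebesgue_on: "f \<in> borel_measurable borel \<Longrightarrow> f \<in> borel_measurable (lebesgue_on S)" for f :: "plane \<Rightarrow> real"
  by (intro measurable_restrict_space1 measurable_completion) simp

text \<open>The broken gradient is zero outside the open triangles, so continuity of
  \<open>b\<close> on each triangle is enough for measurability on the whole plane.\<close>

lemma advect_borel:
  assumes "represents v V" shows "advect b M v \<in> borel_measurable borel"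
proof -
  have "advect b M v x = (\<Sum>K\<in>T. indicator (interior K) x * adv V K x)" for x
  proof -
    have "indicator (interior K) x * (b x \<bullet> gradient (elem_poly v K) x) = indicator (interior K) x * adv V K x" if "K \<in> T" for K
    proof -
      have "V K \<in> P1" using assms that by (auto simp: represents_def broken_P1_def)
      then show ?thesis using P1_gradient(1)[of "V K" x] elem_poly_represents[OF assms that] by (simp add: adv_def)
    qed
    then show ?thesis
      unfolding advect_def broken_gradient_def inner_sum_right inner_scaleR_right by (rule sum.cong[OF refl])
  qed
  then have "advect b M v = (\<lambda>x. \<Sum>K\<in>T. indicator (interior K) x * adv V K x)" by blast
  then show ?thesis using borel_indicator_interior_cont[OF _ cont_adv] by (auto intro!: borel_measurable_sum)
qed

lemma mesh_size_borel: "mesh_size M \<in> borel_measurable borel"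
  unfolding mesh_size_def by measurable

lemma domain_split:
  assumes "f \<in> borel_measurable (lebesgue_on \<Omega>)" "\<And>K. K \<in> T \<Longrightarrow> integrable_el K f"
  shows "(LINT x|lebesgue_on \<Omega>. f x) = (\<Sum>K\<in>T. int_el K f)" "integrable (lebesgue_on \<Omega>) f"
  using integral_split[of T \<Omega> f] T_Union closure_subset[of \<Omega>] T_int open_dom assms by auto

lemma T_sets: "K \<in> T \<Longrightarrow> K \<in> sets lebesgue"
  using T_compact by (simp add: borel_compact)

lemma integrable_el_advect:
  assumes "represents v V" "K \<in> T" shows "integrable_el K (advect b M v)"
  using integrable_el_cong[of K "advect b M v" "adv V K", OF advect_interior[OF assms]] continuous_int_el(1)[OF assms(2) cont_adv[OF assms(2)]]
  by simp

lemma patch_split: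
  assumes "f \<in> borel_measurable borel" "\<And>K. K \<in> adj E \<Longrightarrow> integrable_el K f"
  shows "(LINT x|lebesgue_on (edge_patch M E). f x) = (\<Sum>K\<in>adj E. int_el K f)"
proof -
  have e: "edge_patch M E = \<Union>(adj E)" by (simp add: edge_patch_def adj_def)
  have "\<Union>(adj E) \<in> sets lebesgue"
    by (rule sets.finite_Union) (use finite_adj adj_sub T_sets in blast)+
  moreover have "interior K \<subseteq> \<Union>(adj E)" if "K \<in> adj E" for K
    using that interior_subset[of K] by blast
  ultimately show ?thesis unfolding e
    by (intro integral_split(1)[OF adj_sub order_refl] borel_to_lebesgue_on assms)
qed

lemma patch_measure: "measure lebesgue (edge_patch M E) = (\<Sum>K\<in>adj E. measure lebesgue K)"
proof -
  have "\<Union>(adj E) \<in> sets lebesgue"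
    by (rule sets.finite_Union) (use finite_adj adj_sub T_sets in blast)+
  then have "edge_patch M E \<in> sets lebesgue" by (simp add: edge_patch_def adj_def)
  then have "measure lebesgue (edge_patch M E) = (LINT x|lebesgue_on (edge_patch M E). 1)"
    by (simp add: measure_restrict_space)
  also have "\<dots> = (\<Sum>K\<in>adj E. int_el K (\<lambda>x. 1))"
    using adj_sub by (intro patch_split continuous_int_el) auto
  also have "\<dots> = (\<Sum>K\<in>adj E. measure lebesgue K)"
    using adj_sub by (intro sum.cong refl) (use int_el_const[of _ 1] in auto)
  finally show ?thesis .
qed

lemma kappa_interior:
  assumes "represents v V" "K \<in> adj E" "x \<in> interior K" shows "kappa b M E v x = fluct V E K x"
proof -
  have "(LINT y|lebesgue_on (edge_patch M E). advect b M v y) = (\<Sum>K\<in>adj E. int_el K (advect b M v))"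
    using adj_sub integrable_el_advect[OF assms(1)] by (intro patch_split advect_borel[OF assms(1)]) blast
  also have "\<dots> = (\<Sum>K\<in>adj E. int_el K (adv V K))"
    using adj_sub advect_interior[OF assms(1)] by (intro sum.cong refl int_el_cong) auto
  finally show ?thesis
    unfolding kappa_def fluct_def patch_mean_def patch_measure
    using advect_interior[OF assms(1) _ assms(3)] assms(2) adj_sub by auto
qed

lemma S_nc_eq:
  assumes u: "represents u U" and v: "represents v V" shows "S_nc b \<beta> M u v = S_form U V"
proof -
  have k: "kappa b M E w \<in> borel_measurable borel" if "represents w W" for E w W
    unfolding kappa_def using advect_borel[OF that] by measurable
  have integrable_el: "integrable_el K (\<lambda>x. fluct U E K x * fluct V E K x)" if "K \<in> T" for K E
    using that by (intro continuous_int_el continuous_intros cont_fluct)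
  have i: "int_el K (\<lambda>x. kappa b M E u x * kappa b M E v x) = int_el K (\<lambda>x. fluct U E K x * fluct V E K x)"
    "integrable_el K (\<lambda>x. kappa b M E u x * kappa b M E v x)" if "K \<in> adj E" for K E
  proof -
    have e: "kappa b M E u x * kappa b M E v x = fluct U E K x * fluct V E K x" if "x \<in> interior K" for x
      using kappa_interior[OF u \<open>K \<in> adj E\<close> that] kappa_interior[OF v \<open>K \<in> adj E\<close> that] by simp
    show "int_el K (\<lambda>x. kappa b M E u x * kappa b M E v x) = int_el K (\<lambda>x. fluct U E K x * fluct V E K x)"
      using e by (rule int_el_cong)
    show "integrable_el K (\<lambda>x. kappa b M E u x * kappa b M E v x)"
    proof -
      have "integrable_el K (\<lambda>x. kappa b M E u x * kappa b M E v x) \<longleftrightarrow> integrable_el K (\<lambda>x. fluct U E K x * fluct V E K x)"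
        by (rule integrable_el_cong) (rule e)
      then show ?thesis using integrable_el[of K E] \<open>K \<in> adj E\<close> adj_sub by blast
    qed
  qed
  have "l2_inner (edge_patch M E) (kappa b M E u) (kappa b M E v) = (\<Sum>K\<in>adj E. int_el K (\<lambda>x. fluct U E K x * fluct V E K x))" for E
    unfolding l2_inner_def using k[OF u, of E] k[OF v, of E] i
    by (subst patch_split) (auto intro!: sum.cong)
  then show ?thesis unfolding S_nc_def S_form_def by simp
qed

lemma int_el_represents:
  assumes v: "represents v V" and K: "K \<in> T" and f: "f \<in> borel_measurable (lebesgue_on \<Omega>)" "integrable_el K F"
    and e: "\<And>x. x \<in> interior K \<Longrightarrow> v x = V K x \<Longrightarrow> f x = F x"
  shows "int_el K f = int_el K F" "integrable_el K f"
proof -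
  have "AE x in lebesgue. x \<in> interior K \<longrightarrow> v x = V K x"
    using v K by (simp add: represents_def AE_restrict_space_iff)
  then have "AE x in lebesgue. x \<in> interior K \<longrightarrow> f x = F x"
    by eventually_elim (use e in blast)
  then have "AE x in lebesgue_on (interior K). f x = F x" by (simp add: AE_restrict_space_iff)
  moreover have "f \<in> borel_measurable (lebesgue_on (interior K))"
    using f(1) T_int[OF K] measurable_restrict_mono by blast
  ultimately show "int_el K f = int_el K F" "integrable_el K f" using int_el_cong_AE f(2) by blast+
qed

lemma A_nc_eq:
  assumes u: "represents u U" and v: "represents v V" shows "A_nc \<Omega> b \<mu> \<beta> M u v = A_form U V"
proof -
  have bU: "broken_P1 U" and bV: "broken_P1 V" and mu': "u \<in> borel_measurable (lebesgue_on \<Omega>)" and mv': "v \<in> borel_measurable (lebesgue_on \<Omega>)"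
    using u v by (auto simp: represents_def)
  have mm: "\<mu> \<in> borel_measurable (lebesgue_on \<Omega>)" using mu by (simp add: in_Linf_def)
  have a1: "(\<lambda>x. advect b M u x * v x) \<in> borel_measurable (lebesgue_on \<Omega>)"
    using borel_to_lebesgue_on[OF advect_borel[OF u]] mv' by simp
  have 1: "l2_inner \<Omega> (advect b M u) v = (\<Sum>K\<in>T. int_el K (\<lambda>x. adv U K x * V K x))"
  proof -
    have i: "int_el K (\<lambda>x. advect b M u x * v x) = int_el K (\<lambda>x. adv U K x * V K x)" "integrable_el K (\<lambda>x. advect b M u x * v x)" if K: "K \<in> T" for K
    proof -
      have o: "integrable_el K (\<lambda>x. adv U K x * V K x)" by (intro continuous_int_el K continuous_intros cont_adv cont_broken_P1 bV)
      have e: "advect b M u x * v x = adv U K x * V K x" if "x \<in> interior K" "v x = V K x" for x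
        using advect_interior[OF u K that(1)] that(2) by simp
      show "int_el K (\<lambda>x. advect b M u x * v x) = int_el K (\<lambda>x. adv U K x * V K x)" "integrable_el K (\<lambda>x. advect b M u x * v x)"
        using int_el_represents[OF v K a1 o e] by blast+
    qed
    show ?thesis unfolding l2_inner_def using i by (subst domain_split(1)[OF a1]) auto
  qed
  have a2: "(\<lambda>x. \<mu> x * u x * v x) \<in> borel_measurable (lebesgue_on \<Omega>)" using mm mu' mv' by simp
  have 2: "l2_inner \<Omega> (\<lambda>x. \<mu> x * u x) v = (\<Sum>K\<in>T. int_el K (\<lambda>x. \<mu> x * (U K x * V K x)))"
  proof -
    have i: "int_el K (\<lambda>x. \<mu> x * u x * v x) = int_el K (\<lambda>x. \<mu> x * (U K x * V K x)) \<and> integrable_el K (\<lambda>x. \<mu> x * u x * v x)" if K: "K \<in> T" for K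
    proof -
      \<comment> \<open>Each use of \<open>int_el_represents\<close> exchanges one function for its
        polynomial, so the product with two of them passes through this mixed form.\<close>
      have 1: "int_el K (\<lambda>x. \<mu> x * u x * V K x) = int_el K (\<lambda>x. \<mu> x * (U K x * V K x)) \<and> integrable_el K (\<lambda>x. \<mu> x * u x * V K x)"
      proof -
        have "(\<lambda>x. \<mu> x * u x * V K x) \<in> borel_measurable (lebesgue_on \<Omega>)"
          using mm mu' borel_to_lebesgue_on[OF borel_measurable_continuous_onI[OF cont_broken_P1[OF bV K]]] by simp
        then show ?thesis
          using int_el_represents[OF u K, of "\<lambda>x. \<mu> x * u x * V K x" "\<lambda>x. \<mu> x * (U K x * V K x)"]
            integrable_el_mu[OF K continuous_on_mult[OF cont_broken_P1[OF bU K] cont_broken_P1[OF bV K]]] by simp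
      qed
      then show ?thesis
        using int_el_represents[OF v K a2, of "\<lambda>x. \<mu> x * u x * V K x"] by simp
    qed
    then show ?thesis unfolding l2_inner_def by (subst domain_split(1)[OF a2]) auto
  qed
  have j: "jump M E u = b_jump U E" "jump M E v = b_jump V E" "average M E v = b_avg V E" if "E \<in> interior_edges M" for E
    using interior_edge(3,4)[OF that] elem_poly_represents[OF u] elem_poly_represents[OF v]
    by (auto simp: jump_def b_jump_def average_def b_avg_def fun_eq_iff)
  have t: "boundary_trace M E u = b_trace U E" "boundary_trace M E v = b_trace V E" if "E \<in> boundary_edges M" for E
    using boundary_edge(2)[OF that] elem_poly_represents[OF u] elem_poly_represents[OF v]
    by (auto simp: boundary_trace_def b_trace_def fun_eq_iff)
  show ?thesis
    unfolding A_nc_def A_form_def 1 2 S_nc_eq[OF u v] b_n_def[symmetric] using j t by simp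
qed

lemma NLPSD_norm_eq:
  assumes v: "represents v V" shows "NLPSD_norm \<Omega> b \<alpha> \<beta> M v = sqrt (energy V + adv_energy V)"
proof -
  have bV: "broken_P1 V" and mv': "v \<in> borel_measurable (lebesgue_on \<Omega>)" using v by (auto simp: represents_def)
  have nn: "l2_inner S f f \<ge> 0" for S f unfolding l2_inner_def by (rule integral_nonneg_AE) simp
  have sq: "(l2_norm S f)\<^sup>2 = l2_inner S f f" for S f unfolding l2_norm_def using nn by simp
  have a1: "(\<lambda>x. v x * v x) \<in> borel_measurable (lebesgue_on \<Omega>)" using mv' by simp
  have 1: "l2_inner \<Omega> v v = (\<Sum>K\<in>T. int_el K (\<lambda>x. (V K x)\<^sup>2))"
  proof -
    have i: "int_el K (\<lambda>x. v x * v x) = int_el K (\<lambda>x. (V K x)\<^sup>2)" "integrable_el K (\<lambda>x. v x * v x)" if K: "K \<in> T" for K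
    proof -
      have o: "integrable_el K (\<lambda>x. (V K x)\<^sup>2)" by (intro continuous_int_el K continuous_intros cont_broken_P1 bV)
      have e: "v x * v x = (V K x)\<^sup>2" if "x \<in> interior K" "v x = V K x" for x
        using that by (simp add: power2_eq_square)
      show "int_el K (\<lambda>x. v x * v x) = int_el K (\<lambda>x. (V K x)\<^sup>2)" "integrable_el K (\<lambda>x. v x * v x)"
        using int_el_represents[OF v K a1 o e] by blast+
    qed
    show ?thesis unfolding l2_inner_def using i by (subst domain_split(1)[OF a1]) auto
  qed
  let ?g = "\<lambda>x. sqrt (mesh_size M x) * advect b M v x"
  have gm: "(\<lambda>x. ?g x * ?g x) \<in> borel_measurable (lebesgue_on \<Omega>)"
    by (intro borel_to_lebesgue_on borel_measurable_times) (use advect_borel[OF v] mesh_size_borel in \<open>auto intro!: borel_measurable_sqrt\<close>)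
  have 2: "l2_inner \<Omega> ?g ?g = adv_energy V"
  proof -
    have e: "?g x * ?g x = diameter K * (adv V K x)\<^sup>2" if "K \<in> T" "x \<in> interior K" for K x
    proof -
      have "0 \<le> diameter K" using T_compact[OF that(1)] by (intro diameter_ge_0 compact_imp_bounded)
      then show ?thesis using advect_interior[OF v that] mesh_size_interior[OF that]
        by (simp add: power2_eq_square algebra_simps)
    qed
    have i: "int_el K (\<lambda>x. ?g x * ?g x) = diameter K * int_el K (\<lambda>x. (adv V K x)\<^sup>2) \<and> integrable_el K (\<lambda>x. ?g x * ?g x)" if K: "K \<in> T" for K
    proof -
      have "integrable_el K (\<lambda>x. diameter K * (adv V K x)\<^sup>2)" by (intro continuous_int_el K continuous_intros cont_adv)
      then show ?thesis using int_el_cong[OF e[OF K]] integrable_el_cong[OF e[OF K]] by (simp add: int_el_cmult)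
    qed
    show ?thesis unfolding l2_inner_def adv_energy_def using i by (subst domain_split(1)[OF gm]) auto
  qed
  have j: "jump M E v = b_jump V E" if "E \<in> interior_edges M" for E
    using interior_edge(3,4)[OF that] elem_poly_represents[OF v]
    by (auto simp: jump_def b_jump_def fun_eq_iff)
  have t: "boundary_trace M E v = b_trace V E" if "E \<in> boundary_edges M" for E
    using boundary_edge(2)[OF that] elem_poly_represents[OF v]
    by (auto simp: boundary_trace_def b_trace_def fun_eq_iff)
  show ?thesis
    unfolding NLPSD_norm_def energy_def sq 1 2 S_nc_eq[OF v v] b_n_def[symmetric] using j t by simp
qed

text \<open>The value is zero off the open triangles, which is a null set inside the domain; traces
  do not see it because they are taken from \<open>elem_poly\<close>.\<close>

definition glue :: "broken \<Rightarrow> plane \<Rightarrow> real" where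
  "glue V x = (\<Sum>K\<in>T. indicator (interior K) x *\<^sub>R V K x)"

lemma glue_interior: "K \<in> T \<Longrightarrow> x \<in> interior K \<Longrightarrow> glue V x = V K x"
  unfolding glue_def by (rule sum_indicator_interior)

lemma represents_glue:
  assumes "broken_P1 V" shows "represents (glue V) V"
  unfolding represents_def
proof (intro conjI ballI assms)
  have "glue V \<in> borel_measurable borel" unfolding glue_def
    using borel_indicator_interior_cont[OF _ cont_broken_P1[OF assms]] by (auto intro!: borel_measurable_sum)
  then show "glue V \<in> borel_measurable (lebesgue_on \<Omega>)" by (rule borel_to_lebesgue_on)
  show "AE x in lebesgue_on (interior K). glue V x = V K x" if "K \<in> T" for K
    using glue_interior[OF that] by (intro AE_I2) simp
qed

lemma glue_V_nc:
  assumes "broken_P1 V" "\<And>E. E \<in> interior_edges M \<Longrightarrow> edge_integral E (b_jump V E) = 0"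
  shows "glue V \<in> V_nc \<Omega> M"
proof -
  note r = represents_glue[OF assms(1)]
  have gm: "(\<lambda>x. (glue V x)\<^sup>2) \<in> borel_measurable (lebesgue_on \<Omega>)"
    using r unfolding represents_def by (intro borel_measurable_power) blast
  have "integrable_el K (\<lambda>x. (glue V x)\<^sup>2)" if K: "K \<in> T" for K
    by (rule int_el_represents(2)[OF r K gm, of "\<lambda>x. (V K x)\<^sup>2"]) (auto intro!: continuous_int_el K continuous_intros cont_broken_P1 assms)
  then have "integrable (lebesgue_on \<Omega>) (\<lambda>x. (glue V x)\<^sup>2)" using domain_split(2)[OF gm] by blast
  moreover have "jump M E (glue V) = b_jump V E" if "E \<in> interior_edges M" for E
    using interior_edge(3,4)[OF that] elem_poly_represents[OF r] by (auto simp: jump_def b_jump_def fun_eq_iff)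
  moreover have "\<exists>p\<in>P1. AE x in lebesgue_on K. glue V x = p x" if "K \<in> T" for K
    using r that AE_interior_of_closed[OF that] unfolding represents_def broken_P1_def by blast
  ultimately show ?thesis using r assms(2) by (auto simp: V_nc_def in_L2_def represents_def)
qed

end

section \<open>Estimates\<close>

lemma edge_integral_sum:
  assumes "is_segment E" "\<And>i. i \<in> I \<Longrightarrow> continuous_on E (f i)"
  shows "edge_integral E (\<lambda>x. \<Sum>i\<in>I. f i x) = (\<Sum>i\<in>I. edge_integral E (f i))"
  using assms(2)
proof (induction I rule: infinite_finite_induct)
  case (insert i I)
  have c: "continuous_on E (f i)" "continuous_on E (\<lambda>x. \<Sum>i\<in>I. f i x)"
    using insert by (auto intro: continuous_on_sum)
  show ?case using insert edge_integral_add[OF assms(1) c] by simp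
qed (use edge_integral_const[OF assms(1), of 0] in simp_all)

lemma young: "\<epsilon> > 0 \<Longrightarrow> \<bar>x * y\<bar> \<le> x\<^sup>2 / (4 * \<epsilon>) + \<epsilon> * y\<^sup>2" for x y \<epsilon> :: real
proof -
  assume e: "\<epsilon> > 0"
  have "0 \<le> (\<bar>x\<bar> - 2 * \<epsilon> * \<bar>y\<bar>)\<^sup>2" by simp
  then have "4 * \<epsilon> * \<bar>x * y\<bar> \<le> x\<^sup>2 + 4 * \<epsilon>\<^sup>2 * y\<^sup>2"
    by (simp add: power2_eq_square abs_mult algebra_simps)
  also have "\<dots> = 4 * \<epsilon> * (x\<^sup>2 / (4 * \<epsilon>) + \<epsilon> * y\<^sup>2)"
    using e by (simp add: power2_eq_square field_simps)
  finally show ?thesis using e by simp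
qed

lemma square_add_le: "(a + b)\<^sup>2 \<le> 2 * a\<^sup>2 + 2 * b\<^sup>2" for a b :: real
  using zero_le_power2[of "a - b"] by (simp add: power2_eq_square algebra_simps)

lemma square_sum3_le: "card I = 3 \<Longrightarrow> (\<Sum>i\<in>I. f i)\<^sup>2 \<le> 3 * (\<Sum>i\<in>I. (f i)\<^sup>2)" for f :: "_ \<Rightarrow> real"
  using sum_squared_le_sum_of_squares[of f I] by (simp add: mult.commute)

context nc_mesh
begin

abbreviation "edges_of K \<equiv> {E. E edge_of K}"
abbreviation "area K \<equiv> measure lebesgue K"

section \<open>Element geometry, continuity and signs of the edge terms\<close>

lemma card_edges_of: "K \<in> T \<Longrightarrow> card (edges_of K) = 3"
  using card_edges_2_simplex T_simplex by blast

lemma diam_nonneg: "K \<in> T \<Longrightarrow> 0 \<le> diameter K"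
  using T_compact by (intro diameter_ge_0 compact_imp_bounded)

text \<open>The inscribed disc has area at least \<open>r^2\<close>, because
  \<open>pi \<ge> 1\<close>.\<close>

lemma diam_sq_le_area:
  assumes "K \<in> T" shows "(diameter K)\<^sup>2 \<le> s\<^sup>2 * area K"
proof -
  obtain x r where xr: "cball x r \<subseteq> K" "r > 0" "diameter K \<le> s * r" using s(2)[OF assms] by blast
  have "r\<^sup>2 \<le> pi * r\<^sup>2" using pi_ge_two by (simp add: mult_le_cancel_right1)
  also have "\<dots> = measure lebesgue (cball x r)"
    using xr(2) by (simp add: content_cball unit_ball_vol_2)
  also have "\<dots> \<le> area K"
    using xr(1) T_compact[OF assms] by (intro measure_mono_fmeasurable) (auto simp: lmeasurable_compact)
  finally have r: "r\<^sup>2 \<le> area K" .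
  have "(diameter K)\<^sup>2 \<le> (s * r)\<^sup>2" using xr diam_nonneg[OF assms] by (intro power_mono)
  also have "\<dots> \<le> s\<^sup>2 * area K" using r by (simp add: power_mult_distrib mult_left_mono)
  finally show ?thesis .
qed

lemma area_pos: "K \<in> T \<Longrightarrow> 0 < area K"
proof -
  assume K: "K \<in> T"
  obtain x r where xr: "cball x r \<subseteq> K" "r > 0" "diameter K \<le> s * r" using s(2)[OF K] by blast
  have "0 < measure lebesgue (cball x r)" using xr(2) by (simp add: content_cball unit_ball_vol_2)
  also have "\<dots> \<le> area K"
    using xr(1) T_compact[OF K] by (intro measure_mono_fmeasurable) (auto simp: lmeasurable_compact)
  finally show ?thesis .
qed

lemma b_n_bound: "E \<in> edges M \<Longrightarrow> x \<in> E \<Longrightarrow> \<bar>b_n E x\<bar> \<le> Bb"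
proof -
  assume E: "E \<in> edges M" "x \<in> E"
  then have "x \<in> closure \<Omega>" using edges_E edge_facts(5) by blast
  then show ?thesis
    using Cauchy_Schwarz_ineq2[of "b x" "edge_normal M E"] edge_normal_norm[OF E(1)] Bb(1)[of x] by (simp add: b_n_def)
qed

lemma edge_seg: "E \<in> edges M \<Longrightarrow> is_segment E"
  using edges_E edge_facts(1) by blast

lemma cont_b_n: "E \<in> edges M \<Longrightarrow> continuous_on E (b_n E)"
proof -
  assume "E \<in> edges M"
  then have "E \<subseteq> closure \<Omega>" using edges_E edge_facts(5) by blast
  then show ?thesis unfolding b_n_def using bcont by (intro continuous_intros) (auto intro: continuous_on_subset)
qed

lemma cont_neg: "E \<in> edges M \<Longrightarrow> continuous_on E (\<lambda>x. neg_part (b_n E x))"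
  unfolding neg_part_def by (intro continuous_intros cont_b_n) auto

lemma cont_b_trace: "broken_P1 U \<Longrightarrow> E \<in> boundary_edges M \<Longrightarrow> continuous_on S (b_trace U E)"
  unfolding b_trace_def using boundary_edge(2) cont_broken_P1 by blast

lemma cont_b_jump: "broken_P1 U \<Longrightarrow> E \<in> interior_edges M \<Longrightarrow> continuous_on S (b_jump U E)"
  unfolding b_jump_def using interior_edge(3,4) cont_broken_P1 by (intro continuous_on_diff) blast+

lemma cont_b_avg: "broken_P1 U \<Longrightarrow> E \<in> interior_edges M \<Longrightarrow> continuous_on S (b_avg U E)"
  unfolding b_avg_def divide_inverse using interior_edge(3,4) cont_broken_P1
  by (intro continuous_on_mult continuous_on_add continuous_on_const) blast+

lemma be_edges: "E \<in> boundary_edges M \<Longrightarrow> E \<in> edges M" and ie_edges: "E \<in> interior_edges M \<Longrightarrow> E \<in> edges M"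
  using boundary_edge(5) interior_edge(9) by blast+

lemma sum_area_pos: "E \<in> edges M \<Longrightarrow> 0 < (\<Sum>K\<in>adj E. area K)"
proof -
  assume "E \<in> edges M"
  then have "adj E \<noteq> {}" using edges_E by (auto simp: adj_def)
  then show ?thesis using area_pos adj_sub finite_adj by (intro sum_pos) auto
qed

text \<open>Pythagoras: the patch mean is the L2 projection of the advective derivative onto the
  constants on the patch. Mean and fluctuation are therefore each bounded by the whole.\<close>

lemma fluct_square_sum:
  assumes "E \<in> edges M"
  shows "(\<Sum>K\<in>adj E. int_el K (\<lambda>x. (fluct U E K x)\<^sup>2)) =
    (\<Sum>K\<in>adj E. int_el K (\<lambda>x. (adv U K x)\<^sup>2)) - (patch_mean U E)\<^sup>2 * (\<Sum>K\<in>adj E. area K)"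
proof -
  let ?p = "patch_mean U E"
  have "int_el K (\<lambda>x. (fluct U E K x)\<^sup>2) = int_el K (\<lambda>x. (adv U K x)\<^sup>2) - 2 * ?p * int_el K (adv U K) + ?p\<^sup>2 * area K" if "K \<in> adj E" for K
  proof -
    have K: "K \<in> T" using that adj_sub by blast
    have "(\<lambda>x. (fluct U E K x)\<^sup>2) = (\<lambda>x. ((adv U K x)\<^sup>2 - (2 * ?p) * adv U K x) + ?p\<^sup>2)"
      by (simp add: fluct_def power2_eq_square algebra_simps fun_eq_iff)
    moreover have "integrable_el K (\<lambda>x. (adv U K x)\<^sup>2)" "integrable_el K (\<lambda>x. (2 * ?p) * adv U K x)" "integrable_el K (\<lambda>x. ?p\<^sup>2)"
      "integrable_el K (\<lambda>x. (adv U K x)\<^sup>2 - (2 * ?p) * adv U K x)"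
      by (intro continuous_int_el K continuous_intros cont_adv)+
    ultimately show ?thesis by (simp only: int_el_add int_el_diff int_el_cmult int_el_const[OF K]) (simp add: mult.commute)
  qed
  then have "(\<Sum>K\<in>adj E. int_el K (\<lambda>x. (fluct U E K x)\<^sup>2)) =
     (\<Sum>K\<in>adj E. int_el K (\<lambda>x. (adv U K x)\<^sup>2)) - 2 * ?p * (\<Sum>K\<in>adj E. int_el K (adv U K)) + ?p\<^sup>2 * (\<Sum>K\<in>adj E. area K)"
    by (simp add: sum.distrib sum_subtractf sum_distrib_left)
  moreover have "(\<Sum>K\<in>adj E. int_el K (adv U K)) = ?p * (\<Sum>K\<in>adj E. area K)"
    using sum_area_pos[OF assms] by (simp add: patch_mean_def)
  ultimately show ?thesis by (simp add: power2_eq_square)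
qed

lemma fluct_square_nonneg: "0 \<le> (\<Sum>K\<in>adj E. int_el K (\<lambda>x. (fluct U E K x)\<^sup>2))"
  by (intro sum_nonneg int_el_nonneg) simp

lemma patch_mean_square_le:
  "E \<in> edges M \<Longrightarrow> (patch_mean U E)\<^sup>2 * (\<Sum>K\<in>adj E. area K) \<le> (\<Sum>K\<in>adj E. int_el K (\<lambda>x. (adv U K x)\<^sup>2))"
  using fluct_square_sum[of E U] fluct_square_nonneg[of U E] by simp

lemma fluct_square_le:
  "E \<in> edges M \<Longrightarrow> (\<Sum>K\<in>adj E. int_el K (\<lambda>x. (fluct U E K x)\<^sup>2)) \<le> (\<Sum>K\<in>adj E. int_el K (\<lambda>x. (adv U K x)\<^sup>2))"
  using fluct_square_sum[of E U] sum_area_pos[of E] by simp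

lemma S_form_self: "S_form U U = \<beta> * (\<Sum>K\<in>T. \<Sum>E\<in>edges_of K. diameter E * int_el K (\<lambda>x. (fluct U E K x)\<^sup>2))"
proof -
  have "S_form U U = (\<Sum>E\<in>edges M. \<Sum>K\<in>adj E. \<beta> * (diameter E * int_el K (\<lambda>x. (fluct U E K x)\<^sup>2)))"
    unfolding S_form_def by (simp add: sum_distrib_left power2_eq_square mult.assoc)
  also have "\<dots> = \<beta> * (\<Sum>K\<in>T. \<Sum>E\<in>edges_of K. diameter E * int_el K (\<lambda>x. (fluct U E K x)\<^sup>2))"
    unfolding sum_edges_swap by (simp add: sum_distrib_left)
  finally show ?thesis .
qed

lemma edge_diam_nonneg: "E \<in> edges M \<Longrightarrow> 0 \<le> diameter E"
  using edges_E edge_facts(3) by blast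

lemma S_form_nonneg: "0 \<le> S_form U U"
  unfolding S_form_self using beta by (intro mult_nonneg_nonneg sum_nonneg) (auto intro!: mult_nonneg_nonneg int_el_nonneg edge_facts)

lemma adv_energy_nonneg: "0 \<le> adv_energy U"
  unfolding adv_energy_def by (intro sum_nonneg mult_nonneg_nonneg diam_nonneg int_el_nonneg) auto

definition mass :: "broken \<Rightarrow> real" where
  "mass U = (\<Sum>K\<in>T. int_el K (\<lambda>x. (U K x)\<^sup>2))"

definition bdry_energy :: "broken \<Rightarrow> real" where
  "bdry_energy U = (\<Sum>E\<in>boundary_edges M. edge_integral E (\<lambda>x. \<bar>b_n E x\<bar> / 2 * (b_trace U E x)\<^sup>2))"

definition jump_energy :: "broken \<Rightarrow> real" where
  "jump_energy U = (\<Sum>E\<in>interior_edges M. edge_integral E (\<lambda>x. \<bar>b_n E x\<bar> / 2 * (b_jump U E x)\<^sup>2))"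

lemma energy_eq: "energy U = \<alpha> * mass U + bdry_energy U + S_form U U + jump_energy U"
  by (simp add: energy_def mass_def bdry_energy_def jump_energy_def)

lemma mass_nonneg: "0 \<le> mass U"
  unfolding mass_def by (intro sum_nonneg int_el_nonneg) simp

lemma bdry_energy_nonneg: assumes "broken_P1 U" shows "0 \<le> bdry_energy U"
  unfolding bdry_energy_def
proof (rule sum_nonneg)
  fix E assume E: "E \<in> boundary_edges M"
  show "0 \<le> edge_integral E (\<lambda>x. \<bar>b_n E x\<bar> / 2 * (b_trace U E x)\<^sup>2)"
    using E be_edges[OF E] by (intro edge_integral_nonneg edge_seg continuous_intros cont_b_n cont_b_trace assms) auto
qed

lemma jump_energy_nonneg: assumes "broken_P1 U" shows "0 \<le> jump_energy U"
  unfolding jump_energy_def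
proof (rule sum_nonneg)
  fix E assume E: "E \<in> interior_edges M"
  show "0 \<le> edge_integral E (\<lambda>x. \<bar>b_n E x\<bar> / 2 * (b_jump U E x)\<^sup>2)"
    using E ie_edges[OF E] by (intro edge_integral_nonneg edge_seg continuous_intros cont_b_n cont_b_jump assms) auto
qed

text \<open>Each interior edge is counted twice, once with the trace from either side, so that
  jumps, averages and boundary traces are all bounded by one quantity.\<close>

definition trace_energy :: "broken \<Rightarrow> real" where
  "trace_energy U = (\<Sum>K\<in>T. \<Sum>E\<in>edges_of K. edge_integral E (\<lambda>x. (U K x)\<^sup>2))"

lemma trace_energy_eq: "trace_energy U = (\<Sum>E\<in>boundary_edges M. edge_integral E (\<lambda>x. (b_trace U E x)\<^sup>2))
    + (\<Sum>E\<in>interior_edges M. edge_integral E (\<lambda>x. (U (plus_elem M E) x)\<^sup>2) + edge_integral E (\<lambda>x. (U (minus_elem M E) x)\<^sup>2))"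
  unfolding trace_energy_def sum_edges_swap[symmetric] sum_edges_split
  using boundary_edge(1) interior_edge(1,2) by (intro arg_cong2[of _ _ _ _ "(+)"] sum.cong refl) (auto simp: b_trace_def)

lemma edge_terms_le_trace_energy:
  assumes U: "broken_P1 U"
  shows "(\<Sum>E\<in>boundary_edges M. edge_integral E (\<lambda>x. \<bar>b_n E x\<bar> * (b_trace U E x)\<^sup>2)) \<le> Bb * trace_energy U"
    and "(\<Sum>E\<in>interior_edges M. edge_integral E (\<lambda>x. \<bar>b_n E x\<bar> * (b_avg U E x)\<^sup>2)) \<le> Bb * trace_energy U"
    and "bdry_energy U + jump_energy U \<le> Bb * trace_energy U"
proof -
  let ?zb = "\<lambda>E. edge_integral E (\<lambda>x. (b_trace U E x)\<^sup>2)"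
  let ?zi = "\<lambda>E. edge_integral E (\<lambda>x. (U (plus_elem M E) x)\<^sup>2) + edge_integral E (\<lambda>x. (U (minus_elem M E) x)\<^sup>2)"
  have ci: "continuous_on S (U (plus_elem M E))" "continuous_on S (U (minus_elem M E))" if "E \<in> interior_edges M" for E S
    using interior_edge(3,4)[OF that] cont_broken_P1[OF U] by blast+
  have zb: "0 \<le> ?zb E" if E: "E \<in> boundary_edges M" for E
    using E be_edges[OF E] by (intro edge_integral_nonneg edge_seg continuous_intros cont_b_trace U) auto
  have zi: "0 \<le> ?zi E" if E: "E \<in> interior_edges M" for E
    using ie_edges[OF E] by (intro add_nonneg_nonneg edge_integral_nonneg edge_seg continuous_intros ci E) auto
  have Z: "trace_energy U = (\<Sum>E\<in>boundary_edges M. ?zb E) + (\<Sum>E\<in>interior_edges M. ?zi E)" by (rule trace_energy_eq)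
  have sb: "0 \<le> (\<Sum>E\<in>boundary_edges M. ?zb E)" "0 \<le> (\<Sum>E\<in>interior_edges M. ?zi E)"
    using zb zi by (intro sum_nonneg; blast)+
  have b1: "edge_integral E (\<lambda>x. \<bar>b_n E x\<bar> * (b_trace U E x)\<^sup>2) \<le> Bb * ?zb E" if E: "E \<in> boundary_edges M" for E
  proof -
    note e = be_edges[OF E]
    have "edge_integral E (\<lambda>x. \<bar>b_n E x\<bar> * (b_trace U E x)\<^sup>2) \<le> edge_integral E (\<lambda>x. Bb * (b_trace U E x)\<^sup>2)"
      by (intro edge_integral_mono edge_seg e continuous_intros cont_b_n cont_b_trace U E mult_right_mono b_n_bound) auto
    then show ?thesis by (simp add: edge_integral_cmult[OF edge_seg[OF e]])
  qed
  \<comment> \<open>The factor \<open>c\<close> lets one estimate serve both the average, with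
    \<open>c = 1\<close>, and half of the squared jump, with \<open>c = sqrt (1/2)\<close>.\<close>
  have sqi: "edge_integral E (\<lambda>x. \<bar>b_n E x\<bar> * (c * F x)\<^sup>2) \<le> Bb * ?zi E"
    if E: "E \<in> interior_edges M" and F: "continuous_on E F" "\<And>x. (c * F x)\<^sup>2 \<le> (U (plus_elem M E) x)\<^sup>2 + (U (minus_elem M E) x)\<^sup>2" for E F c
  proof -
    note e = ie_edges[OF E]
    have "edge_integral E (\<lambda>x. \<bar>b_n E x\<bar> * (c * F x)\<^sup>2) \<le> edge_integral E (\<lambda>x. Bb * ((U (plus_elem M E) x)\<^sup>2 + (U (minus_elem M E) x)\<^sup>2))"
      by (intro edge_integral_mono edge_seg e continuous_intros cont_b_n F ci E mult_mono b_n_bound) (use Bb in auto)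
    then show ?thesis
      by (simp add: edge_integral_cmult[OF edge_seg[OF e]] edge_integral_add[OF edge_seg[OF e] continuous_on_power[OF ci(1)[OF E]] continuous_on_power[OF ci(2)[OF E]]])
  qed
  have b2: "edge_integral E (\<lambda>x. \<bar>b_n E x\<bar> * (b_avg U E x)\<^sup>2) \<le> Bb * ?zi E" if E: "E \<in> interior_edges M" for E
  proof -
    have "(1 * b_avg U E x)\<^sup>2 \<le> (U (plus_elem M E) x)\<^sup>2 + (U (minus_elem M E) x)\<^sup>2" for x
      using square_add_le[of "U (plus_elem M E) x" "U (minus_elem M E) x"] by (simp add: b_avg_def power_divide) (smt (verit) zero_le_power2)
    from sqi[OF E cont_b_avg[OF U E] this] show ?thesis by simp
  qed
  have b3: "edge_integral E (\<lambda>x. \<bar>b_n E x\<bar> / 2 * (b_jump U E x)\<^sup>2) \<le> Bb * ?zi E" if E: "E \<in> interior_edges M" for E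
  proof -
    have "(sqrt (1/2) * b_jump U E x)\<^sup>2 \<le> (U (plus_elem M E) x)\<^sup>2 + (U (minus_elem M E) x)\<^sup>2" for x
      using square_add_le[of "U (plus_elem M E) x" "- U (minus_elem M E) x"] by (simp add: b_jump_def power_mult_distrib real_sqrt_divide power_divide)
    from sqi[OF E cont_b_jump[OF U E] this] show ?thesis by (simp add: power_mult_distrib real_sqrt_divide power_divide)
  qed
  have b1': "edge_integral E (\<lambda>x. \<bar>b_n E x\<bar> / 2 * (b_trace U E x)\<^sup>2) \<le> Bb * ?zb E" if E: "E \<in> boundary_edges M" for E
  proof -
    have "edge_integral E (\<lambda>x. \<bar>b_n E x\<bar> / 2 * (b_trace U E x)\<^sup>2) = (1/2) * edge_integral E (\<lambda>x. \<bar>b_n E x\<bar> * (b_trace U E x)\<^sup>2)"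
      by (subst edge_integral_cmult[OF edge_seg[OF be_edges[OF E]], symmetric]) simp
    moreover have "0 \<le> edge_integral E (\<lambda>x. \<bar>b_n E x\<bar> * (b_trace U E x)\<^sup>2)"
      by (intro edge_integral_nonneg edge_seg be_edges E continuous_intros cont_b_n cont_b_trace U) auto
    ultimately show ?thesis using b1[OF E] by linarith
  qed
  have "(\<Sum>E\<in>boundary_edges M. edge_integral E (\<lambda>x. \<bar>b_n E x\<bar> * (b_trace U E x)\<^sup>2)) \<le> Bb * (\<Sum>E\<in>boundary_edges M. ?zb E)"
    unfolding sum_distrib_left by (intro sum_mono b1)
  also have "\<dots> \<le> Bb * trace_energy U" using sb Bb(2) by (intro mult_left_mono) (simp_all add: Z)
  finally show "(\<Sum>E\<in>boundary_edges M. edge_integral E (\<lambda>x. \<bar>b_n E x\<bar> * (b_trace U E x)\<^sup>2)) \<le> Bb * trace_energy U" .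
  have "(\<Sum>E\<in>interior_edges M. edge_integral E (\<lambda>x. \<bar>b_n E x\<bar> * (b_avg U E x)\<^sup>2)) \<le> Bb * (\<Sum>E\<in>interior_edges M. ?zi E)"
    unfolding sum_distrib_left by (intro sum_mono b2)
  also have "\<dots> \<le> Bb * trace_energy U" using sb Bb(2) by (intro mult_left_mono) (simp_all add: Z)
  finally show "(\<Sum>E\<in>interior_edges M. edge_integral E (\<lambda>x. \<bar>b_n E x\<bar> * (b_avg U E x)\<^sup>2)) \<le> Bb * trace_energy U" .
  have "bdry_energy U + jump_energy U \<le> Bb * (\<Sum>E\<in>boundary_edges M. ?zb E) + Bb * (\<Sum>E\<in>interior_edges M. ?zi E)"
    unfolding bdry_energy_def jump_energy_def sum_distrib_left by (intro add_mono sum_mono b1' b3)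
  then show "bdry_energy U + jump_energy U \<le> Bb * trace_energy U" by (simp add: Z distrib_left)
qed

text \<open>By Pythagoras a fluctuation is bounded by the full derivative on the patch. Each
  triangle occurs in the patches of its three edges, hence the factor 3.\<close>

lemma S_form_le_adv_energy: "S_form U U \<le> 3 * \<beta> * adv_energy U"
proof -
  have "S_form U U = (\<Sum>E\<in>edges M. (\<beta> * diameter E) * (\<Sum>K\<in>adj E. int_el K (\<lambda>x. (fluct U E K x)\<^sup>2)))"
    by (simp add: S_form_def power2_eq_square)
  also have "\<dots> \<le> (\<Sum>E\<in>edges M. (\<beta> * diameter E) * (\<Sum>K\<in>adj E. int_el K (\<lambda>x. (adv U K x)\<^sup>2)))"
    using beta by (intro sum_mono mult_left_mono fluct_square_le mult_nonneg_nonneg edge_diam_nonneg) auto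
  also have "\<dots> = (\<Sum>K\<in>T. \<Sum>E\<in>edges_of K. (\<beta> * diameter E) * int_el K (\<lambda>x. (adv U K x)\<^sup>2))"
    by (simp add: sum_distrib_left sum_edges_swap)
  also have "\<dots> \<le> (\<Sum>K\<in>T. \<Sum>E\<in>edges_of K. \<beta> * (diameter K * int_el K (\<lambda>x. (adv U K x)\<^sup>2)))"
  proof (intro sum_mono)
    fix K E assume "K \<in> T" "E \<in> edges_of K"
    then have "diameter E \<le> diameter K" using edge_facts(4) by blast
    then have "diameter E * int_el K (\<lambda>x. (adv U K x)\<^sup>2) \<le> diameter K * int_el K (\<lambda>x. (adv U K x)\<^sup>2)"
      by (intro mult_right_mono int_el_nonneg) auto
    then show "(\<beta> * diameter E) * int_el K (\<lambda>x. (adv U K x)\<^sup>2) \<le> \<beta> * (diameter K * int_el K (\<lambda>x. (adv U K x)\<^sup>2))"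
      using beta by (simp add: mult.assoc)
  qed
  also have "\<dots> = (\<Sum>K\<in>T. 3 * (\<beta> * (diameter K * int_el K (\<lambda>x. (adv U K x)\<^sup>2))))"
    using card_edges_of by (intro sum.cong refl) simp
  also have "\<dots> = 3 * \<beta> * adv_energy U" by (simp add: adv_energy_def sum_distrib_left mult.assoc)
  finally show ?thesis .
qed

section \<open>The test function\<close>

definition test_fn :: "broken \<Rightarrow> plane set \<Rightarrow> plane \<Rightarrow> real" where
  "test_fn U K x = (\<Sum>E\<in>edges_of K. (diameter E * patch_mean U E) * cr_basis K E x)"

definition mean_squares :: "broken \<Rightarrow> plane set \<Rightarrow> real" where
  "mean_squares U K = (\<Sum>E\<in>edges_of K. (patch_mean U E)\<^sup>2)"

text \<open>An intermediate quantity: all parts of the norm of \<open>test_fn U\<close> are bounded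
  by it through scaling, and it is bounded by \<open>adv_energy U\<close>.\<close>

definition mean_energy :: "broken \<Rightarrow> real" where
  "mean_energy U = (\<Sum>K\<in>T. diameter K * area K * mean_squares U K)"

lemma cr_basis_in_P1: "K \<in> T \<Longrightarrow> E \<in> edges_of K \<Longrightarrow> cr_basis K E \<in> P1"
  using cr_basis_P1 T_simplex by blast

lemma broken_P1_test_fn: "broken_P1 (test_fn U)"
  unfolding broken_P1_def
proof
  fix K assume K: "K \<in> T"
  have "test_fn U K = (\<lambda>x. \<Sum>E\<in>edges_of K. (diameter E * patch_mean U E) * cr_basis K E x)"
    by (simp add: test_fn_def fun_eq_iff)
  then show "test_fn U K \<in> P1" using P1_sum[of "edges_of K" "\<lambda>E x. (diameter E * patch_mean U E) * cr_basis K E x"] P1_cmult[OF cr_basis_in_P1[OF K]] by simp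
qed

lemma edge_integral_test_fn:
  assumes K: "K \<in> T" and E: "E edge_of K"
  shows "edge_integral E (test_fn U K) = (diameter E * patch_mean U E) * diameter E"
proof -
  note seg = edge_facts(1)[OF K E]
  have "edge_integral E (test_fn U K) = edge_integral E (\<lambda>x. \<Sum>E'\<in>edges_of K. (diameter E' * patch_mean U E') * cr_basis K E' x)"
    by (simp add: test_fn_def[abs_def])
  also have "\<dots> = (\<Sum>E'\<in>edges_of K. edge_integral E (\<lambda>x. (diameter E' * patch_mean U E') * cr_basis K E' x))"
    by (rule edge_integral_sum[OF seg]) (intro continuous_intros P1_continuous cr_basis_in_P1 K)
  also have "\<dots> = (\<Sum>E'\<in>edges_of K. if E' = E then (diameter E * patch_mean U E) * diameter E else 0)"
    using edge_integral_cr_basis[OF T_simplex[OF K] _ E]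
    by (intro sum.cong refl) (auto simp: edge_integral_cmult[OF seg])
  also have "\<dots> = (diameter E * patch_mean U E) * diameter E"
    using finite_edges_of[OF K] E by simp
  finally show ?thesis .
qed

text \<open>The coefficient \<open>diameter E * patch_mean U E\<close> belongs to the edge and not
  to a triangle, so both sides have the same mean value on \<open>E\<close>.\<close>

lemma jump_test_fn: "E \<in> interior_edges M \<Longrightarrow> edge_integral E (b_jump (test_fn U) E) = 0"
proof -
  assume E: "E \<in> interior_edges M"
  note i = interior_edge(3-6)[OF E] and seg = edge_seg[OF ie_edges[OF E]]
  have c: "continuous_on E (test_fn U (plus_elem M E))" "continuous_on E (\<lambda>x. (-1) * test_fn U (minus_elem M E) x)"
    using cont_broken_P1[OF broken_P1_test_fn] i by (auto intro!: continuous_intros)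
  have "edge_integral E (b_jump (test_fn U) E) = edge_integral E (\<lambda>x. test_fn U (plus_elem M E) x + (-1) * test_fn U (minus_elem M E) x)"
    by (simp add: b_jump_def[abs_def])
  also have "\<dots> = edge_integral E (test_fn U (plus_elem M E)) + (-1) * edge_integral E (test_fn U (minus_elem M E))"
    by (simp only: edge_integral_add[OF seg c] edge_integral_cmult[OF seg])
  also have "\<dots> = 0" using edge_integral_test_fn i by simp
  finally show ?thesis .
qed

lemma mean_squares_nonneg: "0 \<le> mean_squares U K" unfolding mean_squares_def by (simp add: sum_nonneg)

lemma test_fn_square_le:
  assumes K: "K \<in> T" and x: "x \<in> K"
  shows "(test_fn U K x)\<^sup>2 \<le> 3 * (diameter K)\<^sup>2 * mean_squares U K"
proof -
  have "(test_fn U K x)\<^sup>2 \<le> 3 * (\<Sum>E\<in>edges_of K. ((diameter E * patch_mean U E) * cr_basis K E x)\<^sup>2)"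
    unfolding test_fn_def by (rule square_sum3_le[OF card_edges_of[OF K]])
  also have "(\<Sum>E\<in>edges_of K. ((diameter E * patch_mean U E) * cr_basis K E x)\<^sup>2) \<le> (\<Sum>E\<in>edges_of K. (diameter K)\<^sup>2 * (patch_mean U E)\<^sup>2)"
  proof (rule sum_mono)
    fix E assume E: "E \<in> edges_of K"
    then have e: "0 \<le> diameter E" "diameter E \<le> diameter K" using edge_facts(3,4)[OF K] by auto
    have "(cr_basis K E x)\<^sup>2 \<le> 1" using cr_basis_bound[OF T_simplex[OF K] _ x] E by (simp add: abs_square_le_1)
    moreover have "(diameter E)\<^sup>2 \<le> (diameter K)\<^sup>2" using e by (intro power_mono)
    ultimately have "((diameter E)\<^sup>2 * (patch_mean U E)\<^sup>2) * (cr_basis K E x)\<^sup>2 \<le> ((diameter K)\<^sup>2 * (patch_mean U E)\<^sup>2) * 1"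
      by (intro mult_mono) auto
    then show "((diameter E * patch_mean U E) * cr_basis K E x)\<^sup>2 \<le> (diameter K)\<^sup>2 * (patch_mean U E)\<^sup>2"
      by (simp add: power_mult_distrib)
  qed
  also have "\<dots> = (diameter K)\<^sup>2 * mean_squares U K" by (simp add: mean_squares_def sum_distrib_left)
  finally show ?thesis by simp
qed

text \<open>Gradients of basis functions are at most \<open>1/r\<close> and edge lengths at most
  \<open>s * r\<close>. The radius cancels, so no power of the mesh size is left.\<close>

lemma adv_test_fn_square_le:
  assumes K: "K \<in> T" and x: "x \<in> K"
  shows "(adv (test_fn U) K x)\<^sup>2 \<le> 3 * Bb\<^sup>2 * s\<^sup>2 * mean_squares U K"
proof -
  obtain y r where yr: "cball y r \<subseteq> K" "r > 0" "diameter K \<le> s * r" using s(2)[OF K] by blast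
  let ?c = "\<lambda>E. diameter E * patch_mean U E"
  have "gradient (test_fn U K) 0 = gradient (\<lambda>x. \<Sum>E\<in>edges_of K. ?c E * cr_basis K E x) 0"
    by (simp add: test_fn_def[abs_def])
  also have "\<dots> = (\<Sum>E\<in>edges_of K. gradient (\<lambda>x. ?c E * cr_basis K E x) 0)"
    by (rule gradient_P1_sum) (intro P1_cmult cr_basis_in_P1 K)
  also have "\<dots> = (\<Sum>E\<in>edges_of K. ?c E *\<^sub>R gradient (cr_basis K E) 0)"
    using cr_basis_in_P1[OF K] by (intro sum.cong refl gradient_P1_linear(2)) auto
  finally have "adv (test_fn U) K x = (\<Sum>E\<in>edges_of K. ?c E * (b x \<bullet> gradient (cr_basis K E) 0))"
    by (simp add: adv_def inner_sum_right)
  then have "(adv (test_fn U) K x)\<^sup>2 \<le> 3 * (\<Sum>E\<in>edges_of K. (?c E * (b x \<bullet> gradient (cr_basis K E) 0))\<^sup>2)"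
    using square_sum3_le[OF card_edges_of[OF K]] by simp
  also have "(\<Sum>E\<in>edges_of K. (?c E * (b x \<bullet> gradient (cr_basis K E) 0))\<^sup>2) \<le> (\<Sum>E\<in>edges_of K. (Bb\<^sup>2 * s\<^sup>2) * (patch_mean U E)\<^sup>2)"
  proof (rule sum_mono)
    fix E assume E: "E \<in> edges_of K"
    then have e: "0 \<le> diameter E" "diameter E \<le> s * r" using edge_facts(3,4)[OF K] yr(3) by force+
    have g: "norm (gradient (cr_basis K E) 0) \<le> 1 / r"
      using P1_gradient_bound[OF cr_basis_in_P1[OF K E] yr(1,2)] cr_basis_bound[OF T_simplex[OF K]] E by blast
    have "\<bar>b x \<bullet> gradient (cr_basis K E) 0\<bar> \<le> norm (b x) * norm (gradient (cr_basis K E) 0)"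
      by (rule Cauchy_Schwarz_ineq2)
    also have "\<dots> \<le> Bb * (1 / r)" using Bb(1)[of x] T_sub[OF K] x g Bb(2) by (intro mult_mono) auto
    finally have "diameter E * \<bar>b x \<bullet> gradient (cr_basis K E) 0\<bar> \<le> (s * r) * (Bb * (1 / r))"
      using e s(1) yr(2) by (intro mult_mono) auto
    then have "\<bar>diameter E * (b x \<bullet> gradient (cr_basis K E) 0)\<bar> \<le> Bb * s" using yr(2) e(1) by (simp add: abs_mult mult.commute)
    then have "(diameter E * (b x \<bullet> gradient (cr_basis K E) 0))\<^sup>2 \<le> (Bb * s)\<^sup>2" by (rule abs_le_square_iff[THEN iffD1, OF order_trans[OF _ abs_ge_self]])
    then have "(diameter E * (b x \<bullet> gradient (cr_basis K E) 0))\<^sup>2 * (patch_mean U E)\<^sup>2 \<le> (Bb * s)\<^sup>2 * (patch_mean U E)\<^sup>2"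
      by (rule mult_right_mono) simp
    then show "(?c E * (b x \<bullet> gradient (cr_basis K E) 0))\<^sup>2 \<le> (Bb\<^sup>2 * s\<^sup>2) * (patch_mean U E)\<^sup>2"
      by (simp add: power_mult_distrib mult_ac)
  qed
  also have "\<dots> = (Bb\<^sup>2 * s\<^sup>2) * mean_squares U K" by (simp add: mean_squares_def sum_distrib_left)
  finally show ?thesis by (simp add: mult.assoc)
qed

lemma int_el_le_const:
  assumes "K \<in> T" "continuous_on K F" "\<And>x. x \<in> K \<Longrightarrow> F x \<le> c"
  shows "int_el K F \<le> area K * c"
proof -
  have "int_el K F \<le> int_el K (\<lambda>x. c)"
    using assms interior_subset by (intro int_el_mono continuous_int_el) auto
  then show ?thesis using int_el_const[OF assms(1)] by simp
qed

lemma mass_test_fn: "mass (test_fn U) \<le> 3 * H * mean_energy U"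
proof -
  have "mass (test_fn U) \<le> (\<Sum>K\<in>T. 3 * H * (diameter K * area K * mean_squares U K))"
    unfolding mass_def
  proof (rule sum_mono)
    fix K assume K: "K \<in> T"
    have "int_el K (\<lambda>x. (test_fn U K x)\<^sup>2) \<le> area K * (3 * (diameter K)\<^sup>2 * mean_squares U K)"
      by (intro int_el_le_const K test_fn_square_le continuous_intros cont_broken_P1 broken_P1_test_fn)
    also have "\<dots> = 3 * diameter K * (diameter K * area K * mean_squares U K)" by (simp add: power2_eq_square)
    also have "\<dots> \<le> 3 * H * (diameter K * area K * mean_squares U K)"
      using H(1)[OF K] diam_nonneg[OF K] area_pos[OF K] mean_squares_nonneg[of U K] by (intro mult_right_mono) auto
    finally show "int_el K (\<lambda>x. (test_fn U K x)\<^sup>2) \<le> 3 * H * (diameter K * area K * mean_squares U K)" .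
  qed
  then show ?thesis by (simp add: mean_energy_def sum_distrib_left)
qed

lemma adv_energy_test_fn: "adv_energy (test_fn U) \<le> 3 * Bb\<^sup>2 * s\<^sup>2 * mean_energy U"
proof -
  have "adv_energy (test_fn U) \<le> (\<Sum>K\<in>T. 3 * Bb\<^sup>2 * s\<^sup>2 * (diameter K * area K * mean_squares U K))"
    unfolding adv_energy_def
  proof (rule sum_mono)
    fix K assume K: "K \<in> T"
    have "int_el K (\<lambda>x. (adv (test_fn U) K x)\<^sup>2) \<le> area K * (3 * Bb\<^sup>2 * s\<^sup>2 * mean_squares U K)"
      by (intro int_el_le_const K adv_test_fn_square_le continuous_intros cont_adv)
    then have "diameter K * int_el K (\<lambda>x. (adv (test_fn U) K x)\<^sup>2) \<le> diameter K * (area K * (3 * Bb\<^sup>2 * s\<^sup>2 * mean_squares U K))"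
      using diam_nonneg[OF K] by (rule mult_left_mono)
    then show "diameter K * int_el K (\<lambda>x. (adv (test_fn U) K x)\<^sup>2) \<le> 3 * Bb\<^sup>2 * s\<^sup>2 * (diameter K * area K * mean_squares U K)"
      by (simp add: mult_ac)
  qed
  then show ?thesis by (simp add: mean_energy_def sum_distrib_left)
qed

text \<open>Each edge contributes a length of at most \<open>h_K\<close> and a squared amplitude of
  order \<open>h_K^2\<close>; shape regularity trades \<open>h_K^2\<close> for the area. The 9 is
  three edges times the 3 of \<open>test_fn_square_le\<close>.\<close>

lemma trace_energy_test_fn: "trace_energy (test_fn U) \<le> 9 * s\<^sup>2 * mean_energy U"
proof -
  have "trace_energy (test_fn U) \<le> (\<Sum>K\<in>T. 9 * s\<^sup>2 * (diameter K * area K * mean_squares U K))"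
    unfolding trace_energy_def
  proof (rule sum_mono)
    fix K assume K: "K \<in> T"
    have "(\<Sum>E\<in>edges_of K. edge_integral E (\<lambda>x. (test_fn U K x)\<^sup>2)) \<le> (\<Sum>E\<in>edges_of K. diameter K * (3 * (diameter K)\<^sup>2 * mean_squares U K))"
    proof (rule sum_mono)
      fix E assume "E \<in> edges_of K"
      then have e: "is_segment E" "E \<subseteq> K" "diameter E \<le> diameter K" using edge_facts[OF K] by auto
      have "edge_integral E (\<lambda>x. (test_fn U K x)\<^sup>2) \<le> edge_integral E (\<lambda>x. 3 * (diameter K)\<^sup>2 * mean_squares U K)"
        using e(2) by (intro edge_integral_mono e test_fn_square_le K continuous_intros cont_broken_P1 broken_P1_test_fn) auto
      also have "\<dots> = diameter E * (3 * (diameter K)\<^sup>2 * mean_squares U K)" by (rule edge_integral_const[OF e(1)])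
      also have "\<dots> \<le> diameter K * (3 * (diameter K)\<^sup>2 * mean_squares U K)"
        using e(3) mean_squares_nonneg[of U K] by (intro mult_right_mono) auto
      finally show "edge_integral E (\<lambda>x. (test_fn U K x)\<^sup>2) \<le> diameter K * (3 * (diameter K)\<^sup>2 * mean_squares U K)" .
    qed
    also have "\<dots> = (9 * diameter K * mean_squares U K) * (diameter K)\<^sup>2" using card_edges_of[OF K] by simp
    also have "\<dots> \<le> (9 * diameter K * mean_squares U K) * (s\<^sup>2 * area K)"
      using diam_sq_le_area[OF K] diam_nonneg[OF K] mean_squares_nonneg[of U K] by (intro mult_left_mono) auto
    finally show "(\<Sum>E\<in>edges_of K. edge_integral E (\<lambda>x. (test_fn U K x)\<^sup>2)) \<le> 9 * s\<^sup>2 * (diameter K * area K * mean_squares U K)"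
      by (simp add: mult_ac)
  qed
  then show ?thesis by (simp add: mean_energy_def sum_distrib_left)
qed

text \<open>A squared patch mean times the patch area is bounded by the integral over the patch, and
  \<open>q\<close> exchanges the diameters of its triangles. The 6 is at most two triangles per edge
  times three edges per triangle.\<close>

lemma mean_energy_le_adv_energy: "mean_energy U \<le> 6 * q * adv_energy U"
proof -
  let ?D = "\<lambda>K. int_el K (\<lambda>x. (adv U K x)\<^sup>2)"
  have D0: "0 \<le> ?D K" for K by (rule int_el_nonneg) simp
  have "mean_energy U = (\<Sum>E\<in>edges M. \<Sum>K\<in>adj E. diameter K * area K * (patch_mean U E)\<^sup>2)"
    unfolding sum_edges_swap by (simp add: mean_energy_def mean_squares_def sum_distrib_left)
  also have "\<dots> \<le> (\<Sum>E\<in>edges M. 2 * q * (\<Sum>K\<in>adj E. diameter K * ?D K))"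
  proof (rule sum_mono)
    fix E assume E: "E \<in> edges M"
    have "diameter K * area K * (patch_mean U E)\<^sup>2 \<le> q * (\<Sum>K\<in>adj E. diameter K * ?D K)" if K: "K \<in> adj E" for K
    proof -
      have KT: "K \<in> T" using K adj_sub by blast
      have "area K \<le> (\<Sum>K\<in>adj E. area K)"
        using K finite_adj by (intro member_le_sum) auto
      then have "area K * (patch_mean U E)\<^sup>2 \<le> (\<Sum>K\<in>adj E. area K) * (patch_mean U E)\<^sup>2" by (rule mult_right_mono) simp
      also have "\<dots> \<le> (\<Sum>K\<in>adj E. ?D K)" using patch_mean_square_le[OF E, of U] by (simp add: mult.commute)
      finally have "diameter K * (area K * (patch_mean U E)\<^sup>2) \<le> diameter K * (\<Sum>K\<in>adj E. ?D K)"
        using diam_nonneg[OF KT] by (rule mult_left_mono)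
      also have "\<dots> = (\<Sum>K'\<in>adj E. diameter K * ?D K')" by (rule sum_distrib_left)
      also have "\<dots> \<le> (\<Sum>K'\<in>adj E. (q * diameter K') * ?D K')"
      proof (intro sum_mono mult_right_mono D0)
        fix K' assume K': "K' \<in> adj E"
        have "E \<subseteq> K \<inter> K'" "E \<noteq> {}" using K K' edge_facts(2,8) by (auto simp: adj_def)
        then show "diameter K \<le> q * diameter K'" using q(2)[OF KT, of K'] K' adj_sub by blast
      qed
      finally show ?thesis by (simp add: sum_distrib_left mult.assoc)
    qed
    then have "(\<Sum>K\<in>adj E. diameter K * area K * (patch_mean U E)\<^sup>2) \<le> real (card (adj E)) * (q * (\<Sum>K\<in>adj E. diameter K * ?D K))"
      by (rule sum_bounded_above)
    also have "\<dots> \<le> 2 * (q * (\<Sum>K\<in>adj E. diameter K * ?D K))"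
      using card_adj[OF E] q(1) D0 diam_nonneg adj_sub
      by (intro mult_right_mono mult_nonneg_nonneg sum_nonneg) auto
    finally show "(\<Sum>K\<in>adj E. diameter K * area K * (patch_mean U E)\<^sup>2) \<le> 2 * q * (\<Sum>K\<in>adj E. diameter K * ?D K)" by simp
  qed
  also have "\<dots> = 2 * q * (\<Sum>K\<in>T. \<Sum>E\<in>edges_of K. diameter K * ?D K)"
    unfolding sum_edges_swap[symmetric] by (simp add: sum_distrib_left)
  also have "(\<Sum>K\<in>T. \<Sum>E\<in>edges_of K. diameter K * ?D K) = 3 * adv_energy U"
    using card_edges_of by (simp add: adv_energy_def sum_distrib_left)
  finally show ?thesis by simp
qed

text \<open>The weighted mean values in the test function reproduce \<open>\<parallel>h\<^sup>1\<^sup>/\<^sup>2 b \<cdot> \<nabla>u\<parallel>\<^sup>2\<close> up to the fluctuations,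
  which the stabilization controls.\<close>

lemma convection_lower_bound:
  "(\<Sum>K\<in>T. int_el K (\<lambda>x. adv U K x * test_fn U K x)) \<ge> adv_energy U / 8 - 13 / (4 * \<beta>) * S_form U U"
proof -
  let ?k = "\<lambda>K E. int_el K (\<lambda>x. (fluct U E K x)\<^sup>2)"
  have per: "int_el K (\<lambda>x. adv U K x * test_fn U K x) \<ge> (1/8) * (diameter K * int_el K (\<lambda>x. (adv U K x)\<^sup>2)) - (13/4) * (\<Sum>E\<in>edges_of K. diameter E * ?k K E)"
    if K: "K \<in> T" for K
  proof -
    have okc: "integrable_el K F" if "continuous_on K F" for F using continuous_int_el(1)[OF K that] .
    have cc: "continuous_on S (cr_basis K E)" if "E \<in> edges_of K" for S E using cr_basis_in_P1[OF K that] by (rule P1_continuous)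
    let ?c = "\<lambda>E. diameter E * patch_mean U E"
    have cont_term: "continuous_on K (\<lambda>x. ?c E * (adv U K x * cr_basis K E x))" if "E \<in> edges_of K" for E
      using that by (intro continuous_intros cont_adv K cc)
    have "int_el K (\<lambda>x. adv U K x * test_fn U K x) = int_el K (\<lambda>x. \<Sum>E\<in>edges_of K. ?c E * (adv U K x * cr_basis K E x))"
      by (rule int_el_cong) (simp add: test_fn_def sum_distrib_left mult_ac)
    also have "\<dots> = (\<Sum>E\<in>edges_of K. int_el K (\<lambda>x. ?c E * (adv U K x * cr_basis K E x)))"
      unfolding int_el_def using okc[OF cont_term] by (intro Bochner_Integration.integral_sum) (simp add: integrable_el_def)
    finally have eq: "int_el K (\<lambda>x. adv U K x * test_fn U K x) = (\<Sum>E\<in>edges_of K. int_el K (\<lambda>x. ?c E * (adv U K x * cr_basis K E x)))" .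
    have tm: "int_el K (\<lambda>x. ?c E * (adv U K x * cr_basis K E x)) \<ge> diameter E * ((patch_mean U E)\<^sup>2 * area K / 4 - 3 * ?k K E)"
      if E: "E \<in> edges_of K" for E
    proof -
      let ?p = "patch_mean U E"
      have ct: "continuous_on K (\<lambda>x. ?p\<^sup>2 * cr_basis K E x)" "continuous_on K (\<lambda>x. 3 * (fluct U E K x)\<^sup>2)"
        "continuous_on K (\<lambda>x. ?p * (adv U K x * cr_basis K E x))"
        by (intro continuous_intros cont_fluct cont_adv K cc E)+
      have "int_el K (\<lambda>x. (?p\<^sup>2 * cr_basis K E x - ?p\<^sup>2 / 12) - 3 * (fluct U E K x)\<^sup>2) \<le> int_el K (\<lambda>x. ?p * (adv U K x * cr_basis K E x))"
      proof (rule int_el_mono)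
        show "integrable_el K (\<lambda>x. (?p\<^sup>2 * cr_basis K E x - ?p\<^sup>2 / 12) - 3 * (fluct U E K x)\<^sup>2)"
          "integrable_el K (\<lambda>x. ?p * (adv U K x * cr_basis K E x))"
          by (intro okc continuous_intros ct)+
        fix x assume "x \<in> interior K"
        then have cb: "\<bar>cr_basis K E x\<bar> \<le> 1" using cr_basis_bound[OF T_simplex[OF K]] E interior_subset by blast
        have "\<bar>?p * fluct U E K x * cr_basis K E x\<bar> \<le> \<bar>?p * fluct U E K x\<bar>"
          using mult_left_mono[OF cb, of "\<bar>?p * fluct U E K x\<bar>"] by (simp add: abs_mult)
        \<comment> \<open>Young's inequality with parameter 3 costs a twelfth of the squared mean.
          Of the third supplied by the integral of the basis function,
          \<open>1/3 - 1/12 = 1/4\<close> remains.\<close>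
        also have "\<dots> \<le> ?p\<^sup>2 / (4 * 3) + 3 * (fluct U E K x)\<^sup>2" by (rule young) simp
        finally have "- (?p\<^sup>2 / 12 + 3 * (fluct U E K x)\<^sup>2) \<le> ?p * fluct U E K x * cr_basis K E x" by simp
        moreover have "?p * (adv U K x * cr_basis K E x) = ?p\<^sup>2 * cr_basis K E x + ?p * fluct U E K x * cr_basis K E x"
          by (simp add: fluct_def power2_eq_square algebra_simps)
        ultimately show "(?p\<^sup>2 * cr_basis K E x - ?p\<^sup>2 / 12) - 3 * (fluct U E K x)\<^sup>2 \<le> ?p * (adv U K x * cr_basis K E x)" by linarith
      qed
      moreover have "int_el K (\<lambda>x. (?p\<^sup>2 * cr_basis K E x - ?p\<^sup>2 / 12) - 3 * (fluct U E K x)\<^sup>2)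
          = ?p\<^sup>2 * (area K / 3) - area K * (?p\<^sup>2 / 12) - 3 * ?k K E"
      proof -
        have i: "int_el K (cr_basis K E) = area K / 3"
          using continuous_int_el(2)[OF K cc[OF E]] integral_cr_basis[OF T_simplex[OF K]] E by simp
        show ?thesis
          by (subst int_el_diff; (subst int_el_diff)?; (intro okc continuous_intros ct)?)
            (simp_all only: int_el_cmult int_el_const[OF K] i)
      qed
      ultimately have "?p\<^sup>2 * area K / 4 - 3 * ?k K E \<le> int_el K (\<lambda>x. ?p * (adv U K x * cr_basis K E x))"
        by (simp add: mult.commute[of "?p\<^sup>2" "area K"])
      then have "diameter E * (?p\<^sup>2 * area K / 4 - 3 * ?k K E) \<le> diameter E * int_el K (\<lambda>x. ?p * (adv U K x * cr_basis K E x))"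
        using edge_facts(3)[OF K] E by (intro mult_left_mono) auto
      also have "\<dots> = int_el K (\<lambda>x. ?c E * (adv U K x * cr_basis K E x))"
        by (simp add: int_el_cmult[symmetric] mult.assoc)
      finally show ?thesis .
    qed
    \<comment> \<open>A longest edge carries the full weight \<open>h_K\<close>; the contributions
      of the other edges are nonnegative and can be added to the bound.\<close>
    obtain E where E: "E \<in> edges_of K" "diameter E = diameter K" using simplex_2_diameter_edge[OF T_simplex[OF K]] by blast
    have "int_el K (\<lambda>x. (adv U K x)\<^sup>2) \<le> int_el K (\<lambda>x. 2 * (patch_mean U E)\<^sup>2 + 2 * (fluct U E K x)\<^sup>2)"
    proof (rule int_el_mono)
      show "integrable_el K (\<lambda>x. (adv U K x)\<^sup>2)" "integrable_el K (\<lambda>x. 2 * (patch_mean U E)\<^sup>2 + 2 * (fluct U E K x)\<^sup>2)"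
        by (intro okc continuous_intros cont_adv cont_fluct K)+
      show "(adv U K x)\<^sup>2 \<le> 2 * (patch_mean U E)\<^sup>2 + 2 * (fluct U E K x)\<^sup>2" for x
        using square_add_le[of "patch_mean U E" "fluct U E K x"] by (simp add: fluct_def)
    qed
    also have "\<dots> = area K * (2 * (patch_mean U E)\<^sup>2) + 2 * ?k K E"
      by (subst int_el_add; (intro okc continuous_intros cont_fluct K)?) (simp add: int_el_cmult int_el_const[OF K])
    finally have "diameter K * int_el K (\<lambda>x. (adv U K x)\<^sup>2) \<le> diameter E * (area K * (2 * (patch_mean U E)\<^sup>2) + 2 * ?k K E)"
      using diam_nonneg[OF K] E(2) by (simp add: mult_left_mono)
    also have "\<dots> \<le> (\<Sum>E\<in>edges_of K. diameter E * (area K * (2 * (patch_mean U E)\<^sup>2) + 2 * ?k K E))"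
    proof (rule member_le_sum[OF E(1) _ finite_edges_of[OF K]])
      fix F assume "F \<in> edges_of K - {E}"
      then have "0 \<le> diameter F" using edge_facts(3)[OF K] by blast
      moreover have "0 \<le> ?k K F" by (rule int_el_nonneg) simp
      ultimately show "0 \<le> diameter F * (area K * (2 * (patch_mean U F)\<^sup>2) + 2 * ?k K F)"
        using area_pos[OF K] by (intro mult_nonneg_nonneg add_nonneg_nonneg) auto
    qed
    finally have big: "diameter K * int_el K (\<lambda>x. (adv U K x)\<^sup>2) \<le> (\<Sum>E\<in>edges_of K. diameter E * (area K * (2 * (patch_mean U E)\<^sup>2) + 2 * ?k K E))" .
    \<comment> \<open>The constants match: \<open>2/8 = 1/4\<close> for the means, and
      \<open>13/4 = 2/8 + 3\<close> for the fluctuations.\<close>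
    have "(1/8) * (diameter K * int_el K (\<lambda>x. (adv U K x)\<^sup>2)) - (13/4) * (\<Sum>E\<in>edges_of K. diameter E * ?k K E)
        \<le> (1/8) * (\<Sum>E\<in>edges_of K. diameter E * (area K * (2 * (patch_mean U E)\<^sup>2) + 2 * ?k K E)) - (13/4) * (\<Sum>E\<in>edges_of K. diameter E * ?k K E)"
      using big by simp
    also have "\<dots> = (\<Sum>E\<in>edges_of K. diameter E * ((patch_mean U E)\<^sup>2 * area K / 4 - 3 * ?k K E))"
      unfolding sum_distrib_left sum_subtractf[symmetric] by (intro sum.cong refl) (simp add: field_simps)
    also have "\<dots> \<le> int_el K (\<lambda>x. adv U K x * test_fn U K x)" unfolding eq by (intro sum_mono tm)
    finally show ?thesis .
  qed
  have "adv_energy U / 8 - 13 / (4 * \<beta>) * S_form U U = (1/8) * adv_energy U - (13/4) * (\<Sum>K\<in>T. \<Sum>E\<in>edges_of K. diameter E * ?k K E)"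
    using beta by (simp add: S_form_self)
  also have "\<dots> = (\<Sum>K\<in>T. (1/8) * (diameter K * int_el K (\<lambda>x. (adv U K x)\<^sup>2)) - (13/4) * (\<Sum>E\<in>edges_of K. diameter E * ?k K E))"
    unfolding adv_energy_def sum_subtractf sum_distrib_left ..
  also have "\<dots> \<le> (\<Sum>K\<in>T. int_el K (\<lambda>x. adv U K x * test_fn U K x))" by (intro sum_mono per)
  finally show ?thesis .
qed

end

section \<open>Stability\<close>

text \<open>\<open>cW\<close> bounds the perturbation terms of \<open>A(u, w)\<close>, weighted by the Young parameter \<open>ceps\<close>; \<open>cR\<close> is the resulting
  loss in terms of \<open>energy\<close>, \<open>cdel\<close> the factor in \<open>v = u + cdel w\<close>, \<open>cN\<close> bounds \<open>|||w|||\<^sup>2\<close> and \<open>cV\<close> bounds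
  \<open>|||v|||\<^sup>2\<close>. None of them depends on the mesh.\<close>

definition cW :: "real \<Rightarrow> real \<Rightarrow> real \<Rightarrow> real \<Rightarrow> real \<Rightarrow> real" where
  "cW \<beta> Bb m H s = 3 * m * H + 27 * Bb * s\<^sup>2 + 9 * \<beta> * Bb\<^sup>2 * s\<^sup>2"

definition ceps :: "real \<Rightarrow> real \<Rightarrow> real \<Rightarrow> real \<Rightarrow> real \<Rightarrow> real \<Rightarrow> real" where
  "ceps \<beta> Bb m H s q = 1 / (96 * q * cW \<beta> Bb m H s + 1)"

definition cR :: "real \<Rightarrow> real \<Rightarrow> real \<Rightarrow> real \<Rightarrow> real \<Rightarrow> real \<Rightarrow> real \<Rightarrow> real" where
  "cR \<alpha> \<beta> Bb m H s q = 13 / (4 * \<beta>) + (m / \<alpha> + 3) / (4 * ceps \<beta> Bb m H s q)"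

definition cdel :: "real \<Rightarrow> real \<Rightarrow> real \<Rightarrow> real \<Rightarrow> real \<Rightarrow> real \<Rightarrow> real \<Rightarrow> real" where
  "cdel \<alpha> \<beta> Bb m H s q = 1 / (2 * cR \<alpha> \<beta> Bb m H s q + 1)"

definition cN :: "real \<Rightarrow> real \<Rightarrow> real \<Rightarrow> real \<Rightarrow> real \<Rightarrow> real" where
  "cN \<alpha> \<beta> Bb H s = 3 * \<alpha> * H + 9 * Bb * s\<^sup>2 + 9 * \<beta> * Bb\<^sup>2 * s\<^sup>2 + 3 * Bb\<^sup>2 * s\<^sup>2"

definition cV :: "real \<Rightarrow> real \<Rightarrow> real \<Rightarrow> real \<Rightarrow> real \<Rightarrow> real \<Rightarrow> real \<Rightarrow> real" where
  "cV \<alpha> \<beta> Bb m H s q = 2 + 2 * (cdel \<alpha> \<beta> Bb m H s q)\<^sup>2 * (6 * q * cN \<alpha> \<beta> Bb H s)"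

text \<open>The smaller coefficient in the bound of \<open>A(u, v)\<close> from below by
  \<open>energy / 2 + cdel / 16 * adv_energy\<close>.\<close>

definition cA :: "real \<Rightarrow> real \<Rightarrow> real \<Rightarrow> real \<Rightarrow> real \<Rightarrow> real \<Rightarrow> real \<Rightarrow> real" where
  "cA \<alpha> \<beta> Bb m H s q = min (1 / 2) (cdel \<alpha> \<beta> Bb m H s q / 16)"

text \<open>The two bounds combined are: \<open>A(u, v)\<close> is at least \<open>cA\<close> times
  the squared norm of \<open>u\<close>, and the norm of \<open>v\<close> is at most
  \<open>sqrt cV\<close> times the norm of \<open>u\<close>.\<close>

definition infsup_const :: "real \<Rightarrow> real \<Rightarrow> real \<Rightarrow> real \<Rightarrow> real \<Rightarrow> real \<Rightarrow> real \<Rightarrow> real" where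
  "infsup_const \<alpha> \<beta> Bb m H s q = cA \<alpha> \<beta> Bb m H s q / sqrt (cV \<alpha> \<beta> Bb m H s q)"

text \<open>The 96 in \<open>ceps\<close> is \<open>16 * 6\<close>: the Young remainders, of size
  \<open>ceps * cW * 6 * q\<close>, may use at most 1/16 of \<open>adv_energy\<close>. The summand 1
  keeps that denominator positive when \<open>q\<close> or \<open>cW\<close> is zero. Likewise
  \<open>cdel\<close> limits the loss \<open>cR\<close> to half of the energy.\<close>

lemma const_bounds:
  assumes "\<alpha> > 0" "\<beta> > 0" "Bb \<ge> 0" "m \<ge> 0" "H \<ge> 0" "s > 0" "q \<ge> 0"
  shows "0 \<le> cW \<beta> Bb m H s" "0 < ceps \<beta> Bb m H s q" "ceps \<beta> Bb m H s q * (cW \<beta> Bb m H s * (6 * q)) \<le> 1 / 16"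
    "0 < cR \<alpha> \<beta> Bb m H s q" "0 < cdel \<alpha> \<beta> Bb m H s q" "cdel \<alpha> \<beta> Bb m H s q * cR \<alpha> \<beta> Bb m H s q \<le> 1 / 2"
    "0 \<le> cN \<alpha> \<beta> Bb H s" "2 \<le> cV \<alpha> \<beta> Bb m H s q" "0 < cA \<alpha> \<beta> Bb m H s q" "0 < infsup_const \<alpha> \<beta> Bb m H s q"
proof -
  show W: "0 \<le> cW \<beta> Bb m H s" unfolding cW_def using assms by simp
  have qW: "0 \<le> q * cW \<beta> Bb m H s" using W assms by simp
  show e: "0 < ceps \<beta> Bb m H s q" unfolding ceps_def using qW by simp
  show "ceps \<beta> Bb m H s q * (cW \<beta> Bb m H s * (6 * q)) \<le> 1 / 16"
    unfolding ceps_def using qW by (simp add: divide_le_eq)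
  show R: "0 < cR \<alpha> \<beta> Bb m H s q" unfolding cR_def using assms e by (simp add: add_pos_pos add_nonneg_pos)
  then show d: "0 < cdel \<alpha> \<beta> Bb m H s q" unfolding cdel_def by simp
  show "cdel \<alpha> \<beta> Bb m H s q * cR \<alpha> \<beta> Bb m H s q \<le> 1 / 2" unfolding cdel_def using R by (simp add: divide_le_eq)
  show N: "0 \<le> cN \<alpha> \<beta> Bb H s" unfolding cN_def using assms by simp
  show V: "2 \<le> cV \<alpha> \<beta> Bb m H s q" unfolding cV_def using N assms by simp
  show A: "0 < cA \<alpha> \<beta> Bb m H s q" unfolding cA_def using d by simp
  show "0 < infsup_const \<alpha> \<beta> Bb m H s q" unfolding infsup_const_def using A V by simp
qed

lemma edge_integral_abs_le:
  assumes "is_segment E" "continuous_on E f" "continuous_on E g" "\<And>x. x \<in> E \<Longrightarrow> \<bar>f x\<bar> \<le> g x"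
  shows "\<bar>edge_integral E f\<bar> \<le> edge_integral E g"
proof -
  have "edge_integral E f \<le> edge_integral E g"
    using assms(4) by (intro edge_integral_mono assms) (auto dest: abs_le_D1)
  moreover have "edge_integral E (\<lambda>x. (-1) * f x) \<le> edge_integral E g"
    using assms(4) by (intro edge_integral_mono assms continuous_intros) (auto dest: abs_le_D2)
  ultimately show ?thesis by (simp only: edge_integral_cmult[OF assms(1)])
qed

context nc_mesh
begin

section \<open>Young bounds for the single terms of the bilinear form\<close>

lemma int_el_mu_abs_le:
  assumes K: "K \<in> T" and F: "continuous_on K F" and G: "continuous_on K G" "\<And>x. x \<in> interior K \<Longrightarrow> \<bar>F x\<bar> \<le> G x"
  shows "\<bar>int_el K (\<lambda>x. \<mu> x * F x)\<bar> \<le> m * int_el K G"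
proof -
  have "\<bar>int_el K (\<lambda>x. \<mu> x * F x)\<bar> \<le> (LINT x|lebesgue_on (interior K). \<bar>\<mu> x * F x\<bar>)"
    unfolding int_el_def by (rule integral_abs_bound)
  also have "\<dots> \<le> (LINT x|lebesgue_on (interior K). m * G x)"
  proof (rule integral_mono_AE)
    show "integrable (lebesgue_on (interior K)) (\<lambda>x. \<bar>\<mu> x * F x\<bar>)"
      using integrable_el_mu[OF K F] unfolding integrable_el_def by (rule integrable_abs)
    show "integrable (lebesgue_on (interior K)) (\<lambda>x. m * G x)"
      using continuous_int_el(1)[OF K G(1)] unfolding integrable_el_def by simp
    have "AE x in lebesgue. x \<in> \<Omega> \<longrightarrow> \<bar>\<mu> x\<bar> \<le> m"
      using m(1) open_dom by (simp add: AE_restrict_space_iff)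
    then have "AE x in lebesgue. x \<in> interior K \<longrightarrow> \<bar>\<mu> x * F x\<bar> \<le> m * G x"
    proof eventually_elim
      case (elim x)
      show ?case
      proof
        assume x: "x \<in> interior K"
        then have "\<bar>\<mu> x\<bar> \<le> m" using elim T_int[OF K] by blast
        then show "\<bar>\<mu> x * F x\<bar> \<le> m * G x" unfolding abs_mult using G(2)[OF x] m(2) by (intro mult_mono) auto
      qed
    qed
    then show "AE x in lebesgue_on (interior K). \<bar>\<mu> x * F x\<bar> \<le> m * G x" by (simp add: AE_restrict_space_iff)
  qed
  also have "\<dots> = m * int_el K G" by (simp add: int_el_def)
  finally show ?thesis .
qed

lemma sum_abs_le: "(\<And>i. i \<in> I \<Longrightarrow> \<bar>f i\<bar> \<le> g i) \<Longrightarrow> \<bar>\<Sum>i\<in>I. f i\<bar> \<le> (\<Sum>i\<in>I. g i)" for f g :: "'i \<Rightarrow> real"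
  by (rule order_trans[OF sum_abs sum_mono])

lemma reaction_le:
  assumes U: "broken_P1 U" and W: "broken_P1 W" and e: "\<epsilon> > 0"
  shows "\<bar>\<Sum>K\<in>T. int_el K (\<lambda>x. \<mu> x * (U K x * W K x))\<bar> \<le> m / (4 * \<epsilon>) * mass U + \<epsilon> * m * mass W"
proof -
  have "\<bar>\<Sum>K\<in>T. int_el K (\<lambda>x. \<mu> x * (U K x * W K x))\<bar> \<le> (\<Sum>K\<in>T. m / (4 * \<epsilon>) * int_el K (\<lambda>x. (U K x)\<^sup>2) + \<epsilon> * m * int_el K (\<lambda>x. (W K x)\<^sup>2))"
  proof (rule sum_abs_le)
    fix K assume K: "K \<in> T"
    have c: "continuous_on K (\<lambda>x. (1 / (4 * \<epsilon>)) * (U K x)\<^sup>2)" "continuous_on K (\<lambda>x. \<epsilon> * (W K x)\<^sup>2)"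
      by (intro continuous_intros cont_broken_P1 U W K)+
    have "\<bar>int_el K (\<lambda>x. \<mu> x * (U K x * W K x))\<bar> \<le> m * int_el K (\<lambda>x. (1 / (4 * \<epsilon>)) * (U K x)\<^sup>2 + \<epsilon> * (W K x)\<^sup>2)"
    proof (rule int_el_mu_abs_le[OF K])
      show "\<bar>U K x * W K x\<bar> \<le> (1 / (4 * \<epsilon>)) * (U K x)\<^sup>2 + \<epsilon> * (W K x)\<^sup>2" for x
        using young[OF e, of "U K x" "W K x"] by simp
    qed (intro continuous_intros cont_broken_P1 U W K c)+
    also have "\<dots> = m / (4 * \<epsilon>) * int_el K (\<lambda>x. (U K x)\<^sup>2) + \<epsilon> * m * int_el K (\<lambda>x. (W K x)\<^sup>2)"
      unfolding int_el_add[OF continuous_int_el(1)[OF K c(1)] continuous_int_el(1)[OF K c(2)]] int_el_cmult by (simp add: algebra_simps)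
    finally show "\<bar>int_el K (\<lambda>x. \<mu> x * (U K x * W K x))\<bar> \<le> m / (4 * \<epsilon>) * int_el K (\<lambda>x. (U K x)\<^sup>2) + \<epsilon> * m * int_el K (\<lambda>x. (W K x)\<^sup>2)" .
  qed
  also have "\<dots> = m / (4 * \<epsilon>) * mass U + \<epsilon> * m * mass W"
    by (simp add: mass_def sum.distrib sum_distrib_left)
  finally show ?thesis .
qed

lemma S_form_abs_le:
  assumes e: "\<epsilon> > 0"
  shows "\<bar>S_form U W\<bar> \<le> 1 / (4 * \<epsilon>) * S_form U U + \<epsilon> * S_form W W"
proof -
  have "\<bar>S_form U W\<bar> \<le> (\<Sum>E\<in>edges M. (\<beta> * diameter E) * (\<Sum>K\<in>adj E. (1 / (4 * \<epsilon>)) * int_el K (\<lambda>x. fluct U E K x * fluct U E K x) + \<epsilon> * int_el K (\<lambda>x. fluct W E K x * fluct W E K x)))"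
    unfolding S_form_def
  proof (rule sum_abs_le)
    fix E assume E: "E \<in> edges M"
    have n: "0 \<le> \<beta> * diameter E" using beta edge_diam_nonneg[OF E] by simp
    have "\<bar>\<Sum>K\<in>adj E. int_el K (\<lambda>x. fluct U E K x * fluct W E K x)\<bar> \<le> (\<Sum>K\<in>adj E. (1 / (4 * \<epsilon>)) * int_el K (\<lambda>x. fluct U E K x * fluct U E K x) + \<epsilon> * int_el K (\<lambda>x. fluct W E K x * fluct W E K x))"
    proof (rule sum_abs_le)
      fix K assume "K \<in> adj E"
      then have K: "K \<in> T" using adj_sub by blast
      have c: "integrable_el K (\<lambda>x. (1 / (4 * \<epsilon>)) * (fluct U E K x * fluct U E K x))" "integrable_el K (\<lambda>x. \<epsilon> * (fluct W E K x * fluct W E K x))"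
        "integrable_el K (\<lambda>x. fluct U E K x * fluct W E K x)" "integrable_el K (\<lambda>x. (-1) * (fluct U E K x * fluct W E K x))"
        by (intro continuous_int_el K continuous_intros cont_fluct)+
      have y: "\<bar>fluct U E K x * fluct W E K x\<bar> \<le> (1 / (4 * \<epsilon>)) * (fluct U E K x * fluct U E K x) + \<epsilon> * (fluct W E K x * fluct W E K x)" for x
        using young[OF e, of "fluct U E K x" "fluct W E K x"] by (simp add: power2_eq_square)
      have "int_el K (\<lambda>x. fluct U E K x * fluct W E K x) \<le> int_el K (\<lambda>x. (1 / (4 * \<epsilon>)) * (fluct U E K x * fluct U E K x) + \<epsilon> * (fluct W E K x * fluct W E K x))"
        by (rule int_el_mono[OF c(3) integrable_el_add[OF c(1,2)]]) (rule abs_le_D1[OF y])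
      moreover have "int_el K (\<lambda>x. (-1) * (fluct U E K x * fluct W E K x)) \<le> int_el K (\<lambda>x. (1 / (4 * \<epsilon>)) * (fluct U E K x * fluct U E K x) + \<epsilon> * (fluct W E K x * fluct W E K x))"
        by (rule int_el_mono[OF c(4) integrable_el_add[OF c(1,2)]]) (use abs_le_D2[OF y] in simp)
      ultimately show "\<bar>int_el K (\<lambda>x. fluct U E K x * fluct W E K x)\<bar> \<le> (1 / (4 * \<epsilon>)) * int_el K (\<lambda>x. fluct U E K x * fluct U E K x) + \<epsilon> * int_el K (\<lambda>x. fluct W E K x * fluct W E K x)"
        unfolding int_el_add[OF c(1,2)] int_el_cmult by linarith
    qed
    then show "\<bar>(\<beta> * diameter E) * (\<Sum>K\<in>adj E. int_el K (\<lambda>x. fluct U E K x * fluct W E K x))\<bar> \<le> (\<beta> * diameter E) * (\<Sum>K\<in>adj E. (1 / (4 * \<epsilon>)) * int_el K (\<lambda>x. fluct U E K x * fluct U E K x) + \<epsilon> * int_el K (\<lambda>x. fluct W E K x * fluct W E K x))"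
      unfolding abs_mult[of "\<beta> * diameter E"] abs_of_nonneg[OF n] using n by (rule mult_left_mono)
  qed
  also have "\<dots> = 1 / (4 * \<epsilon>) * S_form U U + \<epsilon> * S_form W W"
    unfolding S_form_def sum.distrib sum_distrib_left[symmetric] distrib_left
    by (simp add: sum.distrib sum_distrib_left mult_ac)
  finally show ?thesis .
qed

text \<open>Separating the coefficient \<open>a\<close> from the weight \<open>w\<close> covers all
  three edge terms: \<open>neg_part (b_n E x)\<close> and \<open>b_n E x\<close> against
  \<open>\<bar>b_n E x\<bar>\<close>, and half of the absolute value against itself.\<close>

lemma edge_young:
  assumes seg: "is_segment E" and c: "continuous_on E a" "continuous_on E w" "continuous_on E f" "continuous_on E g"
    and w: "\<And>x. \<bar>a x\<bar> \<le> w x" and e: "\<epsilon> > 0"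
  shows "\<bar>edge_integral E (\<lambda>x. a x * f x * g x)\<bar>
    \<le> 1 / (4 * \<epsilon>) * edge_integral E (\<lambda>x. w x * (f x)\<^sup>2) + \<epsilon> * edge_integral E (\<lambda>x. w x * (g x)\<^sup>2)"
proof -
  have k: "continuous_on E (\<lambda>x. 1 / (4 * \<epsilon>) * (w x * (f x)\<^sup>2))" "continuous_on E (\<lambda>x. \<epsilon> * (w x * (g x)\<^sup>2))"
    by (intro continuous_intros c)+
  have "\<bar>edge_integral E (\<lambda>x. a x * f x * g x)\<bar> \<le> edge_integral E (\<lambda>x. 1 / (4 * \<epsilon>) * (w x * (f x)\<^sup>2) + \<epsilon> * (w x * (g x)\<^sup>2))"
  proof (rule edge_integral_abs_le[OF seg])
    fix x
    have "\<bar>a x\<bar> * \<bar>f x * g x\<bar> \<le> w x * ((f x)\<^sup>2 / (4 * \<epsilon>) + \<epsilon> * (g x)\<^sup>2)"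
      using order_trans[OF abs_ge_zero w] by (intro mult_mono young[OF e] w) auto
    then show "\<bar>a x * f x * g x\<bar> \<le> 1 / (4 * \<epsilon>) * (w x * (f x)\<^sup>2) + \<epsilon> * (w x * (g x)\<^sup>2)"
      by (simp add: abs_mult algebra_simps)
  qed (intro continuous_intros c k)+
  then show ?thesis by (simp only: edge_integral_add[OF seg k] edge_integral_cmult[OF seg])
qed

text \<open>The energies carry half of the absolute normal component as weight, while two of the
  Young bounds produce the full one; this is the origin of the factors 2 below.\<close>

lemma edge_integral_double:
  "is_segment E \<Longrightarrow> edge_integral E (\<lambda>x. \<bar>b_n E x\<bar> * f x) = 2 * edge_integral E (\<lambda>x. \<bar>b_n E x\<bar> / 2 * f x)"
  by (subst edge_integral_cmult[symmetric]) simp_all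

lemma boundary_le:
  assumes U: "broken_P1 U" and W: "broken_P1 W" and e: "\<epsilon> > 0"
  shows "\<bar>\<Sum>E\<in>boundary_edges M. edge_integral E (\<lambda>x. neg_part (b_n E x) * b_trace U E x * b_trace W E x)\<bar>
    \<le> 2 / (4 * \<epsilon>) * bdry_energy U + \<epsilon> * (Bb * trace_energy W)"
proof -
  have "\<bar>\<Sum>E\<in>boundary_edges M. edge_integral E (\<lambda>x. neg_part (b_n E x) * b_trace U E x * b_trace W E x)\<bar>
    \<le> (\<Sum>E\<in>boundary_edges M. 1 / (4 * \<epsilon>) * edge_integral E (\<lambda>x. \<bar>b_n E x\<bar> * (b_trace U E x)\<^sup>2) + \<epsilon> * edge_integral E (\<lambda>x. \<bar>b_n E x\<bar> * (b_trace W E x)\<^sup>2))"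
    by (intro sum_abs_le edge_young edge_seg be_edges cont_neg continuous_on_rabs cont_b_n cont_b_trace U W e) (auto simp: neg_part_def)
  also have "\<dots> = 1 / (4 * \<epsilon>) * (\<Sum>E\<in>boundary_edges M. edge_integral E (\<lambda>x. \<bar>b_n E x\<bar> * (b_trace U E x)\<^sup>2))
      + \<epsilon> * (\<Sum>E\<in>boundary_edges M. edge_integral E (\<lambda>x. \<bar>b_n E x\<bar> * (b_trace W E x)\<^sup>2))"
    by (simp only: sum.distrib sum_distrib_left)
  also have "(\<Sum>E\<in>boundary_edges M. edge_integral E (\<lambda>x. \<bar>b_n E x\<bar> * (b_trace U E x)\<^sup>2)) = 2 * bdry_energy U"
    unfolding bdry_energy_def sum_distrib_left by (intro sum.cong refl edge_integral_double edge_seg be_edges)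
  also have "1 / (4 * \<epsilon>) * (2 * bdry_energy U) + \<epsilon> * (\<Sum>E\<in>boundary_edges M. edge_integral E (\<lambda>x. \<bar>b_n E x\<bar> * (b_trace W E x)\<^sup>2))
      \<le> 2 / (4 * \<epsilon>) * bdry_energy U + \<epsilon> * (Bb * trace_energy W)"
    using edge_terms_le_trace_energy(1)[OF W] e by simp
  finally show ?thesis .
qed

lemma jump_average_le:
  assumes U: "broken_P1 U" and W: "broken_P1 W" and e: "\<epsilon> > 0"
  shows "\<bar>\<Sum>E\<in>interior_edges M. edge_integral E (\<lambda>x. b_n E x * b_jump U E x * b_avg W E x)\<bar>
    \<le> 2 / (4 * \<epsilon>) * jump_energy U + \<epsilon> * (Bb * trace_energy W)"
proof -
  have "\<bar>\<Sum>E\<in>interior_edges M. edge_integral E (\<lambda>x. b_n E x * b_jump U E x * b_avg W E x)\<bar>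
    \<le> (\<Sum>E\<in>interior_edges M. 1 / (4 * \<epsilon>) * edge_integral E (\<lambda>x. \<bar>b_n E x\<bar> * (b_jump U E x)\<^sup>2) + \<epsilon> * edge_integral E (\<lambda>x. \<bar>b_n E x\<bar> * (b_avg W E x)\<^sup>2))"
    by (intro sum_abs_le edge_young edge_seg ie_edges continuous_on_rabs cont_b_n cont_b_jump cont_b_avg U W e) auto
  also have "\<dots> = 1 / (4 * \<epsilon>) * (\<Sum>E\<in>interior_edges M. edge_integral E (\<lambda>x. \<bar>b_n E x\<bar> * (b_jump U E x)\<^sup>2))
      + \<epsilon> * (\<Sum>E\<in>interior_edges M. edge_integral E (\<lambda>x. \<bar>b_n E x\<bar> * (b_avg W E x)\<^sup>2))"
    by (simp only: sum.distrib sum_distrib_left)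
  also have "(\<Sum>E\<in>interior_edges M. edge_integral E (\<lambda>x. \<bar>b_n E x\<bar> * (b_jump U E x)\<^sup>2)) = 2 * jump_energy U"
    unfolding jump_energy_def sum_distrib_left by (intro sum.cong refl edge_integral_double edge_seg ie_edges)
  also have "1 / (4 * \<epsilon>) * (2 * jump_energy U) + \<epsilon> * (\<Sum>E\<in>interior_edges M. edge_integral E (\<lambda>x. \<bar>b_n E x\<bar> * (b_avg W E x)\<^sup>2))
      \<le> 2 / (4 * \<epsilon>) * jump_energy U + \<epsilon> * (Bb * trace_energy W)"
    using edge_terms_le_trace_energy(2)[OF W] e by simp
  finally show ?thesis .
qed

lemma jump_jump_le:
  assumes U: "broken_P1 U" and W: "broken_P1 W" and e: "\<epsilon> > 0"
  shows "\<bar>\<Sum>E\<in>interior_edges M. edge_integral E (\<lambda>x. \<bar>b_n E x\<bar> / 2 * b_jump U E x * b_jump W E x)\<bar>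
    \<le> 1 / (4 * \<epsilon>) * jump_energy U + \<epsilon> * (Bb * trace_energy W)"
proof -
  have c: "continuous_on E (\<lambda>x. \<bar>b_n E x\<bar> / 2)" if "E \<in> interior_edges M" for E
    by (intro continuous_intros cont_b_n ie_edges that) simp
  have "\<bar>\<Sum>E\<in>interior_edges M. edge_integral E (\<lambda>x. \<bar>b_n E x\<bar> / 2 * b_jump U E x * b_jump W E x)\<bar>
    \<le> (\<Sum>E\<in>interior_edges M. 1 / (4 * \<epsilon>) * edge_integral E (\<lambda>x. \<bar>b_n E x\<bar> / 2 * (b_jump U E x)\<^sup>2) + \<epsilon> * edge_integral E (\<lambda>x. \<bar>b_n E x\<bar> / 2 * (b_jump W E x)\<^sup>2))"
    by (intro sum_abs_le edge_young edge_seg ie_edges c cont_b_jump U W e) auto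
  also have "\<dots> = 1 / (4 * \<epsilon>) * jump_energy U + \<epsilon> * jump_energy W"
    by (simp only: jump_energy_def sum.distrib sum_distrib_left)
  also have "\<dots> \<le> 1 / (4 * \<epsilon>) * jump_energy U + \<epsilon> * (Bb * trace_energy W)"
    using edge_terms_le_trace_energy(3)[OF W] bdry_energy_nonneg[OF W] e by simp
  finally show ?thesis .
qed

abbreviation "cR' \<equiv> cR \<alpha> \<beta> Bb m H s q"
abbreviation "cdel' \<equiv> cdel \<alpha> \<beta> Bb m H s q"
abbreviation "ceps' \<equiv> ceps \<beta> Bb m H s q"
abbreviation "cW' \<equiv> cW \<beta> Bb m H s"

lemmas const_bounds_mesh = const_bounds[OF alpha beta Bb(2) m(2) H(2) s(1) q(1)]

lemma S_form_test_fn: "S_form (test_fn U) (test_fn U) \<le> 9 * \<beta> * Bb\<^sup>2 * s\<^sup>2 * mean_energy U"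
proof -
  have "S_form (test_fn U) (test_fn U) \<le> 3 * \<beta> * adv_energy (test_fn U)" by (rule S_form_le_adv_energy)
  also have "\<dots> \<le> 3 * \<beta> * (3 * Bb\<^sup>2 * s\<^sup>2 * mean_energy U)" using adv_energy_test_fn beta by (intro mult_left_mono) auto
  finally show ?thesis by (simp add: mult_ac)
qed

text \<open>Half of the \<open>1/8\<close> from \<open>convection_lower_bound\<close> is kept. The
  other half absorbs the Young remainders in the test function, which amount to at most
  \<open>ceps * cW * mean_energy U\<close>; all terms in \<open>U\<close> itself are collected in
  \<open>cR\<close>.\<close>

lemma A_form_test_fn_ge:
  assumes U: "broken_P1 U"
  shows "A_form U (test_fn U) \<ge> adv_energy U / 16 - cR' * energy U"
proof -
  let ?e = ceps' and ?W = "test_fn U"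
  note e = const_bounds_mesh(2) and W = broken_P1_test_fn[of U]
  have S: "S_form U U \<le> energy U" and aL: "\<alpha> * mass U \<le> energy U"
    using mass_nonneg[of U] bdry_energy_nonneg[OF U] jump_energy_nonneg[OF U] S_form_nonneg[of U] alpha by (simp_all add: energy_eq)
  have "A_form U ?W \<ge> (adv_energy U / 8 - 13 / (4 * \<beta>) * S_form U U)
      - (m / (4 * ?e) * mass U + ?e * m * mass ?W) - (2 / (4 * ?e) * bdry_energy U + ?e * (Bb * trace_energy ?W))
      - (2 / (4 * ?e) * jump_energy U + ?e * (Bb * trace_energy ?W)) - (1 / (4 * ?e) * jump_energy U + ?e * (Bb * trace_energy ?W))
      - (1 / (4 * ?e) * S_form U U + ?e * S_form ?W ?W)"
    using convection_lower_bound[of U] reaction_le[OF U W e] boundary_le[OF U W e] jump_average_le[OF U W e]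
      jump_jump_le[OF U W e] S_form_abs_le[OF e, of U ?W]
    unfolding A_form_def by linarith
  moreover have "m / (4 * ?e) * mass U + 2 / (4 * ?e) * bdry_energy U + 2 / (4 * ?e) * jump_energy U + 1 / (4 * ?e) * jump_energy U + 1 / (4 * ?e) * S_form U U
     \<le> (m / \<alpha> + 3) / (4 * ?e) * energy U"
  proof -
    have "m * mass U + 2 * bdry_energy U + 3 * jump_energy U + S_form U U \<le> (m / \<alpha>) * (\<alpha> * mass U) + 3 * (bdry_energy U + jump_energy U + S_form U U)"
      using alpha bdry_energy_nonneg[OF U] S_form_nonneg[of U] by simp
    also have "\<dots> \<le> (m / \<alpha>) * energy U + 3 * energy U"
      using aL alpha m(2) mass_nonneg[of U] by (intro add_mono mult_left_mono) (auto simp: energy_eq)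
    finally have "(m * mass U + 2 * bdry_energy U + 3 * jump_energy U + S_form U U) / (4 * ?e) \<le> ((m / \<alpha>) * energy U + 3 * energy U) / (4 * ?e)"
      using e by (intro divide_right_mono) auto
    then show ?thesis by (simp add: add_divide_distrib distrib_right)
  qed
  moreover have "13 / (4 * \<beta>) * S_form U U \<le> 13 / (4 * \<beta>) * energy U" using S beta by (intro mult_left_mono) auto
  \<comment> \<open>The boundary, jump-average and jump-jump estimates each leave one trace term of
    the test function, hence the factor 3.\<close>
  moreover have "?e * m * mass ?W + 3 * (?e * (Bb * trace_energy ?W)) + ?e * S_form ?W ?W \<le> adv_energy U / 16"
  proof -
    have "m * mass ?W + 3 * (Bb * trace_energy ?W) + S_form ?W ?W \<le> m * (3 * H * mean_energy U) + 3 * (Bb * (9 * s\<^sup>2 * mean_energy U)) + 9 * \<beta> * Bb\<^sup>2 * s\<^sup>2 * mean_energy U"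
      using mass_test_fn[of U] trace_energy_test_fn[of U] S_form_test_fn[of U] m(2) Bb(2) by (intro add_mono mult_left_mono) auto
    also have "\<dots> = cW' * mean_energy U" by (simp add: cW_def algebra_simps)
    also have "\<dots> \<le> cW' * (6 * q * adv_energy U)" by (intro mult_left_mono mean_energy_le_adv_energy const_bounds_mesh)
    finally have "?e * (m * mass ?W + 3 * (Bb * trace_energy ?W) + S_form ?W ?W) \<le> ?e * (cW' * (6 * q * adv_energy U))"
      using e by (intro mult_left_mono) auto
    also have "\<dots> = (?e * (cW' * (6 * q))) * adv_energy U" by (simp add: mult_ac)
    also have "\<dots> \<le> (1 / 16) * adv_energy U" by (intro mult_right_mono const_bounds_mesh adv_energy_nonneg)
    finally show ?thesis by (simp add: algebra_simps)
  qed
  ultimately have "A_form U ?W \<ge> adv_energy U / 8 - 13 / (4 * \<beta>) * energy U - (m / \<alpha> + 3) / (4 * ?e) * energy U - adv_energy U / 16"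
    by linarith
  then show ?thesis by (simp add: cR_def distrib_right)
qed

text \<open>\<open>triangle_coercivity\<close> for the square of the polynomial, whose gradient is
  twice the polynomial times its gradient, so that half of it is the convection term. The inward
  fluxes become outer normal integrals with a minus sign and change sides.\<close>

lemma element_coercivity:
  assumes K: "K \<in> T" and U: "broken_P1 U"
  shows "int_el K (\<lambda>x. adv U K x * U K x) + int_el K (\<lambda>x. \<mu> x * (U K x * U K x))
    \<ge> \<alpha> * int_el K (\<lambda>x. (U K x)\<^sup>2) + 1/2 * (\<Sum>E\<in>edges_of K. edge_integral E (\<lambda>x. (b x \<bullet> outer_normal K E) * (U K x)\<^sup>2))"
proof -
  obtain P Q R where v: "vertices K P Q R" using simplex_2_vertices[OF T_simplex[OF K]] .
  note t = verticesD(1)[OF v] and KE = verticesD(2)[OF v]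
  have p: "U K \<in> P1" using U K by (simp add: broken_P1_def)
  let ?g = "gradient (U K) 0"
  let ?f = "\<lambda>x. (U K x)\<^sup>2"
  let ?F = "\<lambda>x. (2 * U K x) *\<^sub>R ?g"
  have Ck: "C_k k ?f" for k
  proof -
    obtain a c where "U K = (\<lambda>x. a \<bullet> x + c)" using p by (auto simp: P1_def)
    then show ?thesis unfolding power2_eq_square using C_k_mult[OF C_k_affine C_k_affine] by simp
  qed
  have G: "GDERIV ?f x :> ?F x" for x
    unfolding power2_eq_square
    by (rule GDERIV_subst[OF GDERIV_mult[OF P1_gradient(2)[OF p] P1_gradient(2)[OF p]]])
      (simp add: scaleR_add_left[symmetric])
  have Fc: "continuous_on UNIV ?F" by (intro continuous_intros P1_continuous p)
  have mui: "integrable (lebesgue_on (interior K)) (\<lambda>x. \<mu> x * ?f x)"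
    using integrable_el_mu[OF K continuous_on_power[OF P1_continuous[OF p]]] by (simp add: integrable_el_def)
  have "1/2 * (LINT x|lebesgue_on K. b x \<bullet> ?F x)
      + 1/2 * (tri_flux P Q R b ?f + tri_flux Q R P b ?f + tri_flux R P Q b ?f)
      + (LINT x|lebesgue_on (interior K). \<mu> x * ?f x)
     \<ge> \<alpha> * (LINT x|lebesgue_on K. ?f x)"
    by (rule triangle_coercivity[OF open_dom bW mu coer t KE T_int[OF K] b_cont[OF K] Ck _ G Fc mui]) simp
  moreover have "(LINT x|lebesgue_on K. b x \<bullet> ?F x) = 2 * int_el K (\<lambda>x. adv U K x * U K x)"
  proof -
    have "(LINT x|lebesgue_on K. b x \<bullet> ?F x) = int_el K (\<lambda>x. b x \<bullet> ?F x)"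
      by (intro continuous_int_el(2)[symmetric] K continuous_intros b_cont P1_continuous p)
    also have "\<dots> = int_el K (\<lambda>x. 2 * (adv U K x * U K x))" by (rule int_el_cong) (simp add: adv_def mult_ac)
    finally show ?thesis by (simp only: int_el_cmult)
  qed
  moreover have "(LINT x|lebesgue_on K. ?f x) = int_el K ?f"
    by (intro continuous_int_el(2)[symmetric] K continuous_intros P1_continuous p)
  moreover have "(LINT x|lebesgue_on (interior K). \<mu> x * ?f x) = int_el K (\<lambda>x. \<mu> x * (U K x * U K x))"
    by (simp add: int_el_def power2_eq_square)
  moreover have "tri_flux P Q R b ?f + tri_flux Q R P b ?f + tri_flux R P Q b ?f
     = - (\<Sum>E\<in>edges_of K. edge_integral E (\<lambda>x. (b x \<bullet> outer_normal K E) * ?f x))"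
    unfolding sum_vertices_edges[OF v] tri_flux_eq_edge_integral[OF v]
      tri_flux_eq_edge_integral[OF vertices_cyc[OF v]] tri_flux_eq_edge_integral[OF vertices_cyc[OF vertices_cyc[OF v]]]
    by simp
  ultimately show ?thesis by simp
qed

text \<open>The element fluxes combine edge by edge. On an interior edge, half of the jump of the
  square is jump times average, which cancels against the consistency term. On a boundary edge, half
  of \<open>b_n\<close> plus its negative part is half of its absolute value.\<close>

lemma A_form_coercive:
  assumes U: "broken_P1 U" shows "A_form U U \<ge> energy U"
proof -
  let ?n = "\<lambda>K E. edge_integral E (\<lambda>x. (b x \<bullet> outer_normal K E) * (U K x)\<^sup>2)"
  have "(\<Sum>K\<in>T. int_el K (\<lambda>x. adv U K x * U K x) + int_el K (\<lambda>x. \<mu> x * (U K x * U K x)))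
      \<ge> (\<Sum>K\<in>T. \<alpha> * int_el K (\<lambda>x. (U K x)\<^sup>2) + 1/2 * (\<Sum>E\<in>edges_of K. ?n K E))"
    by (intro sum_mono element_coercivity U)
  then have 1: "(\<Sum>K\<in>T. int_el K (\<lambda>x. adv U K x * U K x)) + (\<Sum>K\<in>T. int_el K (\<lambda>x. \<mu> x * (U K x * U K x)))
      \<ge> \<alpha> * mass U + 1/2 * (\<Sum>K\<in>T. \<Sum>E\<in>edges_of K. ?n K E)"
    by (simp add: sum.distrib mass_def sum_distrib_left)
  have "(\<Sum>K\<in>T. \<Sum>E\<in>edges_of K. ?n K E) = (\<Sum>E\<in>boundary_edges M. \<Sum>K\<in>adj E. ?n K E) + (\<Sum>E\<in>interior_edges M. \<Sum>K\<in>adj E. ?n K E)"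
    unfolding sum_edges_swap[symmetric] sum_edges_split ..
  moreover have "1/2 * (\<Sum>K\<in>adj E. ?n K E) + edge_integral E (\<lambda>x. neg_part (b_n E x) * b_trace U E x * b_trace U E x)
      = edge_integral E (\<lambda>x. \<bar>b_n E x\<bar> / 2 * (b_trace U E x)\<^sup>2)" if E: "E \<in> boundary_edges M" for E
  proof -
    note seg = edge_seg[OF be_edges[OF E]] and ed = be_edges[OF E]
    have c: "continuous_on E (\<lambda>x. 1/2 * (b_n E x * (b_trace U E x)\<^sup>2))" "continuous_on E (\<lambda>x. neg_part (b_n E x) * b_trace U E x * b_trace U E x)"
      by (intro continuous_intros cont_b_n cont_neg cont_b_trace U E ed)+
    have "(\<Sum>K\<in>adj E. ?n K E) = edge_integral E (\<lambda>x. b_n E x * (b_trace U E x)\<^sup>2)"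
      unfolding boundary_edge(1)[OF E] by (simp add: b_n_def b_trace_def boundary_edge(4)[OF E])
    then have "1/2 * (\<Sum>K\<in>adj E. ?n K E) + edge_integral E (\<lambda>x. neg_part (b_n E x) * b_trace U E x * b_trace U E x)
       = edge_integral E (\<lambda>x. 1/2 * (b_n E x * (b_trace U E x)\<^sup>2) + neg_part (b_n E x) * b_trace U E x * b_trace U E x)"
      unfolding edge_integral_add[OF seg c] edge_integral_cmult[OF seg] by simp
    also have "\<dots> = edge_integral E (\<lambda>x. \<bar>b_n E x\<bar> / 2 * (b_trace U E x)\<^sup>2)"
      by (rule edge_integral_cong[OF seg]) (simp add: neg_part_def power2_eq_square field_simps)
    finally show ?thesis .
  qed
  then have 2: "1/2 * (\<Sum>E\<in>boundary_edges M. \<Sum>K\<in>adj E. ?n K E) + (\<Sum>E\<in>boundary_edges M. edge_integral E (\<lambda>x. neg_part (b_n E x) * b_trace U E x * b_trace U E x)) = bdry_energy U"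
    unfolding bdry_energy_def sum_distrib_left sum.distrib[symmetric] by (rule sum.cong[OF refl])
  have "1/2 * (\<Sum>K\<in>adj E. ?n K E) = edge_integral E (\<lambda>x. b_n E x * b_jump U E x * b_avg U E x)" if E: "E \<in> interior_edges M" for E
  proof -
    note seg = edge_seg[OF ie_edges[OF E]] and ed = ie_edges[OF E]
    have ci: "continuous_on E (U (plus_elem M E))" "continuous_on E (U (minus_elem M E))"
      using interior_edge(3,4)[OF E] cont_broken_P1[OF U] by blast+
    have c: "continuous_on E (\<lambda>x. b_n E x * (U (plus_elem M E) x)\<^sup>2)" "continuous_on E (\<lambda>x. - b_n E x * (U (minus_elem M E) x)\<^sup>2)"
      by (intro continuous_intros cont_b_n ci ed)+
    have "(\<Sum>K\<in>adj E. ?n K E) = edge_integral E (\<lambda>x. b_n E x * (U (plus_elem M E) x)\<^sup>2) + edge_integral E (\<lambda>x. - b_n E x * (U (minus_elem M E) x)\<^sup>2)"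
      unfolding interior_edge(1)[OF E] using interior_edge(2)[OF E]
      by (simp add: b_n_def interior_edge(8)[OF E] interior_edge(7)[OF E])
    also have "\<dots> = edge_integral E (\<lambda>x. b_n E x * (U (plus_elem M E) x)\<^sup>2 + - b_n E x * (U (minus_elem M E) x)\<^sup>2)"
      by (rule edge_integral_add[OF seg c, symmetric])
    also have "\<dots> = edge_integral E (\<lambda>x. 2 * (b_n E x * b_jump U E x * b_avg U E x))"
      by (rule edge_integral_cong[OF seg]) (simp add: b_jump_def b_avg_def power2_eq_square algebra_simps)
    finally show ?thesis by (simp add: edge_integral_cmult[OF seg])
  qed
  then have 3: "1/2 * (\<Sum>E\<in>interior_edges M. \<Sum>K\<in>adj E. ?n K E) = (\<Sum>E\<in>interior_edges M. edge_integral E (\<lambda>x. b_n E x * b_jump U E x * b_avg U E x))"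
    unfolding sum_distrib_left by (rule sum.cong[OF refl])
  have 4: "(\<Sum>E\<in>interior_edges M. edge_integral E (\<lambda>x. \<bar>b_n E x\<bar> / 2 * b_jump U E x * b_jump U E x)) = jump_energy U"
    by (simp add: jump_energy_def power2_eq_square mult.assoc)
  \<comment> \<open>Here \<open>calculation\<close> is the splitting of the sum of all element
    fluxes into boundary and interior edges.\<close>
  show ?thesis
    using 1 calculation 2 3 4 unfolding A_form_def energy_eq by (simp add: distrib_left)
qed

section \<open>Linearity in the test function and the norm of a combination\<close>

lemma adv_linear:
  assumes V: "broken_P1 V" and W: "broken_P1 W" and K: "K \<in> T"
  shows "adv (\<lambda>K x. V K x + d * W K x) K x = adv V K x + d * adv W K x"
proof -
  have p: "V K \<in> P1" "W K \<in> P1" using V W K by (auto simp: broken_P1_def)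
  then show ?thesis
    unfolding adv_def by (simp add: gradient_P1_linear(1)[OF p(1) P1_cmult[OF p(2)]] gradient_P1_linear(2)[OF p(2) p(2)] inner_add_right)
qed

lemma broken_P1_linear: "broken_P1 V \<Longrightarrow> broken_P1 W \<Longrightarrow> broken_P1 (\<lambda>K x. V K x + d * W K x)"
  unfolding broken_P1_def by (auto intro!: P1_add P1_cmult)

lemma fluct_linear:
  assumes V: "broken_P1 V" and W: "broken_P1 W" and K: "K \<in> T"
  shows "fluct (\<lambda>K x. V K x + d * W K x) E K x = fluct V E K x + d * fluct W E K x"
proof -
  have "int_el K (adv (\<lambda>K x. V K x + d * W K x) K) = int_el K (adv V K) + d * int_el K (adv W K)" if K: "K \<in> T" for K
  proof -
    have c: "integrable_el K (adv V K)" "integrable_el K (\<lambda>x. d * adv W K x)" by (intro continuous_int_el K continuous_intros cont_adv)+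
    have "int_el K (adv (\<lambda>K x. V K x + d * W K x) K) = int_el K (\<lambda>x. adv V K x + d * adv W K x)"
      by (rule int_el_cong) (rule adv_linear[OF V W K])
    then show ?thesis unfolding int_el_add[OF c] int_el_cmult .
  qed
  then have "(\<Sum>K\<in>adj E. int_el K (adv (\<lambda>K x. V K x + d * W K x) K)) = (\<Sum>K\<in>adj E. int_el K (adv V K) + d * int_el K (adv W K))"
    using adj_sub by (intro sum.cong refl) auto
  then have "patch_mean (\<lambda>K x. V K x + d * W K x) E = patch_mean V E + d * patch_mean W E"
    unfolding patch_mean_def by (simp add: sum.distrib sum_distrib_left[symmetric] add_divide_distrib)
  then show ?thesis unfolding fluct_def adv_linear[OF V W K] by (simp add: algebra_simps)
qed

lemma int_el_linear:
  assumes "integrable_el K F" "integrable_el K G" "\<And>x. x \<in> interior K \<Longrightarrow> X x = F x + d * G x"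
  shows "int_el K X = int_el K F + d * int_el K G"
  using assms int_el_cong[of K X "\<lambda>x. F x + d * G x"] by (simp add: int_el_add integrable_el_cmult int_el_cmult)

lemma edge_integral_linear:
  assumes "is_segment E" "continuous_on E f" "continuous_on E g" "\<And>x. h x = f x + d * g x"
  shows "edge_integral E h = edge_integral E f + d * edge_integral E g"
proof -
  have "continuous_on E (\<lambda>x. d * g x)" by (intro continuous_intros assms)
  moreover have "h = (\<lambda>x. f x + d * g x)" using assms(4) by blast
  ultimately show ?thesis by (simp add: edge_integral_add[OF assms(1,2)] edge_integral_cmult[OF assms(1)])
qed

lemma A_form_linear:
  assumes U: "broken_P1 U" and V: "broken_P1 V" and W: "broken_P1 W"
  shows "A_form U (\<lambda>K x. V K x + d * W K x) = A_form U V + d * A_form U W"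
proof -
  let ?X = "\<lambda>K x. V K x + d * W K x"
  have 1: "int_el K (\<lambda>x. adv U K x * ?X K x) = int_el K (\<lambda>x. adv U K x * V K x) + d * int_el K (\<lambda>x. adv U K x * W K x)" if K: "K \<in> T" for K
    by (rule int_el_linear; (intro continuous_int_el K continuous_intros cont_adv cont_broken_P1 V W)?) (simp add: algebra_simps)
  have 2: "int_el K (\<lambda>x. \<mu> x * (U K x * ?X K x)) = int_el K (\<lambda>x. \<mu> x * (U K x * V K x)) + d * int_el K (\<lambda>x. \<mu> x * (U K x * W K x))" if K: "K \<in> T" for K
    by (rule int_el_linear; (intro integrable_el_mu K continuous_intros cont_broken_P1 U V W)?) (simp add: algebra_simps)
  have 3: "edge_integral E (\<lambda>x. neg_part (b_n E x) * b_trace U E x * b_trace ?X E x) =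
      edge_integral E (\<lambda>x. neg_part (b_n E x) * b_trace U E x * b_trace V E x) + d * edge_integral E (\<lambda>x. neg_part (b_n E x) * b_trace U E x * b_trace W E x)"
    if E: "E \<in> boundary_edges M" for E
    by (rule edge_integral_linear; (intro edge_seg be_edges continuous_intros cont_neg cont_b_trace U V W E)?) (simp add: b_trace_def algebra_simps)
  have 4: "edge_integral E (\<lambda>x. b_n E x * b_jump U E x * b_avg ?X E x) =
      edge_integral E (\<lambda>x. b_n E x * b_jump U E x * b_avg V E x) + d * edge_integral E (\<lambda>x. b_n E x * b_jump U E x * b_avg W E x)"
    if E: "E \<in> interior_edges M" for E
    by (rule edge_integral_linear; (intro edge_seg ie_edges continuous_intros cont_b_n cont_b_jump cont_b_avg U V W E)?) (simp add: b_avg_def field_simps)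
  have 5: "edge_integral E (\<lambda>x. \<bar>b_n E x\<bar> / 2 * b_jump U E x * b_jump ?X E x) =
      edge_integral E (\<lambda>x. \<bar>b_n E x\<bar> / 2 * b_jump U E x * b_jump V E x) + d * edge_integral E (\<lambda>x. \<bar>b_n E x\<bar> / 2 * b_jump U E x * b_jump W E x)"
    if E: "E \<in> interior_edges M" for E
  proof (rule edge_integral_linear)
    show "continuous_on E (\<lambda>x. \<bar>b_n E x\<bar> / 2 * b_jump U E x * b_jump V E x)" "continuous_on E (\<lambda>x. \<bar>b_n E x\<bar> / 2 * b_jump U E x * b_jump W E x)"
      by (intro continuous_intros cont_b_n cont_b_jump ie_edges U V W E; simp)+
  qed (auto simp: edge_seg ie_edges E b_jump_def field_simps)
  have 6: "int_el K (\<lambda>x. fluct U E K x * fluct ?X E K x) = int_el K (\<lambda>x. fluct U E K x * fluct V E K x) + d * int_el K (\<lambda>x. fluct U E K x * fluct W E K x)" if "K \<in> adj E" for K E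
  proof -
    have K: "K \<in> T" using that adj_sub by blast
    show ?thesis
      by (rule int_el_linear; (intro continuous_int_el K continuous_intros cont_fluct)?) (simp add: fluct_linear[OF V W K] algebra_simps)
  qed
  have S: "S_form U ?X = S_form U V + d * S_form U W"
    unfolding S_form_def by (simp add: 6 sum.distrib sum_distrib_left[symmetric] distrib_left) (simp add: sum_distrib_left mult_ac)
  have s: "(\<Sum>i\<in>I. f i) = (\<Sum>i\<in>I. g i) + d * (\<Sum>i\<in>I. h i)" if "\<And>i. i \<in> I \<Longrightarrow> f i = g i + d * h i"
    for I and f g h :: "plane set \<Rightarrow> real"
    unfolding sum_distrib_left sum.distrib[symmetric] using that by (rule sum.cong[OF refl])
  have S1: "(\<Sum>K\<in>T. int_el K (\<lambda>x. adv U K x * ?X K x)) = (\<Sum>K\<in>T. int_el K (\<lambda>x. adv U K x * V K x)) + d * (\<Sum>K\<in>T. int_el K (\<lambda>x. adv U K x * W K x))"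
    by (rule s) (rule 1)
  have S2: "(\<Sum>K\<in>T. int_el K (\<lambda>x. \<mu> x * (U K x * ?X K x))) = (\<Sum>K\<in>T. int_el K (\<lambda>x. \<mu> x * (U K x * V K x))) + d * (\<Sum>K\<in>T. int_el K (\<lambda>x. \<mu> x * (U K x * W K x)))"
    by (rule s) (rule 2)
  have S3: "(\<Sum>E\<in>boundary_edges M. edge_integral E (\<lambda>x. neg_part (b_n E x) * b_trace U E x * b_trace ?X E x)) =
      (\<Sum>E\<in>boundary_edges M. edge_integral E (\<lambda>x. neg_part (b_n E x) * b_trace U E x * b_trace V E x)) + d * (\<Sum>E\<in>boundary_edges M. edge_integral E (\<lambda>x. neg_part (b_n E x) * b_trace U E x * b_trace W E x))"
    by (rule s) (rule 3)
  have S4: "(\<Sum>E\<in>interior_edges M. edge_integral E (\<lambda>x. b_n E x * b_jump U E x * b_avg ?X E x)) =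
      (\<Sum>E\<in>interior_edges M. edge_integral E (\<lambda>x. b_n E x * b_jump U E x * b_avg V E x)) + d * (\<Sum>E\<in>interior_edges M. edge_integral E (\<lambda>x. b_n E x * b_jump U E x * b_avg W E x))"
    by (rule s) (rule 4)
  have S5: "(\<Sum>E\<in>interior_edges M. edge_integral E (\<lambda>x. \<bar>b_n E x\<bar> / 2 * b_jump U E x * b_jump ?X E x)) =
      (\<Sum>E\<in>interior_edges M. edge_integral E (\<lambda>x. \<bar>b_n E x\<bar> / 2 * b_jump U E x * b_jump V E x)) + d * (\<Sum>E\<in>interior_edges M. edge_integral E (\<lambda>x. \<bar>b_n E x\<bar> / 2 * b_jump U E x * b_jump W E x))"
    by (rule s) (rule 5)
  show ?thesis
    unfolding A_form_def S S1 S2 S3 S4 S5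
    unfolding distrib_left right_diff_distrib by linarith
qed

lemma square_linear_le: "(a + d * c)\<^sup>2 \<le> 2 * a\<^sup>2 + (2 * d\<^sup>2) * c\<^sup>2" for a c d :: real
  using square_add_le[of a "d * c"] by (simp add: power_mult_distrib)

lemma int_el_square_linear:
  assumes K: "K \<in> T" and c: "continuous_on K F" "continuous_on K G" and e: "\<And>x. x \<in> interior K \<Longrightarrow> X x = F x + d * G x"
  shows "int_el K (\<lambda>x. (X x)\<^sup>2) \<le> 2 * int_el K (\<lambda>x. (F x)\<^sup>2) + (2 * d\<^sup>2) * int_el K (\<lambda>x. (G x)\<^sup>2)"
proof -
  have k: "integrable_el K (\<lambda>x. 2 * (F x)\<^sup>2)" "integrable_el K (\<lambda>x. (2 * d\<^sup>2) * (G x)\<^sup>2)" "integrable_el K (\<lambda>x. (F x + d * G x)\<^sup>2)"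
    by (intro continuous_int_el K continuous_intros c)+
  have "int_el K (\<lambda>x. (X x)\<^sup>2) = int_el K (\<lambda>x. (F x + d * G x)\<^sup>2)" using e by (intro int_el_cong) simp
  also have "\<dots> \<le> int_el K (\<lambda>x. 2 * (F x)\<^sup>2 + (2 * d\<^sup>2) * (G x)\<^sup>2)"
    by (rule int_el_mono[OF k(3) integrable_el_add[OF k(1,2)]]) (rule square_linear_le)
  finally show ?thesis unfolding int_el_add[OF k(1,2)] int_el_cmult .
qed

lemma edge_square_linear:
  assumes seg: "is_segment E" and c: "continuous_on E w" "continuous_on E F" "continuous_on E G" and w: "\<And>x. 0 \<le> w x"
  shows "edge_integral E (\<lambda>x. w x * (F x + d * G x)\<^sup>2) \<le> 2 * edge_integral E (\<lambda>x. w x * (F x)\<^sup>2) + (2 * d\<^sup>2) * edge_integral E (\<lambda>x. w x * (G x)\<^sup>2)"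
proof -
  have k: "continuous_on E (\<lambda>x. 2 * (w x * (F x)\<^sup>2))" "continuous_on E (\<lambda>x. (2 * d\<^sup>2) * (w x * (G x)\<^sup>2))"
    by (intro continuous_intros c)+
  have "edge_integral E (\<lambda>x. w x * (F x + d * G x)\<^sup>2) \<le> edge_integral E (\<lambda>x. 2 * (w x * (F x)\<^sup>2) + (2 * d\<^sup>2) * (w x * (G x)\<^sup>2))"
  proof (rule edge_integral_mono[OF seg])
    show "w x * (F x + d * G x)\<^sup>2 \<le> 2 * (w x * (F x)\<^sup>2) + (2 * d\<^sup>2) * (w x * (G x)\<^sup>2)" for x
      using mult_left_mono[OF square_linear_le[of "F x" d "G x"] w[of x]] by (simp add: algebra_simps)
  qed (intro continuous_intros c k)+
  then show ?thesis unfolding edge_integral_add[OF seg k] edge_integral_cmult[OF seg] .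
qed

text \<open>Every summand of the squared norm is a nonnegatively weighted integral of the square of
  a linear quantity, so \<open>square_linear_le\<close> applies to each of them.\<close>

lemma norm_linear:
  fixes d :: real
  assumes V: "broken_P1 V" and W: "broken_P1 W"
  defines "X \<equiv> \<lambda>K x. V K x + d * W K x"
  shows "energy X + adv_energy X \<le> 2 * (energy V + adv_energy V) + 2 * d\<^sup>2 * (energy W + adv_energy W)"
proof -
  have L: "mass X \<le> 2 * mass V + (2 * d\<^sup>2) * mass W"
    unfolding mass_def sum_distrib_left sum.distrib[symmetric]
    by (intro sum_mono int_el_square_linear) (auto simp: X_def intro!: cont_broken_P1 V W)
  have B: "adv_energy X \<le> 2 * adv_energy V + (2 * d\<^sup>2) * adv_energy W"
    unfolding adv_energy_def sum_distrib_left sum.distrib[symmetric]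
  proof (rule sum_mono)
    fix K assume K: "K \<in> T"
    have "int_el K (\<lambda>x. (adv X K x)\<^sup>2) \<le> 2 * int_el K (\<lambda>x. (adv V K x)\<^sup>2) + (2 * d\<^sup>2) * int_el K (\<lambda>x. (adv W K x)\<^sup>2)"
      unfolding X_def by (rule int_el_square_linear[OF K cont_adv[OF K] cont_adv[OF K]]) (rule adv_linear[OF V W K])
    then have "diameter K * int_el K (\<lambda>x. (adv X K x)\<^sup>2) \<le> diameter K * (2 * int_el K (\<lambda>x. (adv V K x)\<^sup>2) + (2 * d\<^sup>2) * int_el K (\<lambda>x. (adv W K x)\<^sup>2))"
      using diam_nonneg[OF K] by (rule mult_left_mono)
    then show "diameter K * int_el K (\<lambda>x. (adv X K x)\<^sup>2) \<le> 2 * (diameter K * int_el K (\<lambda>x. (adv V K x)\<^sup>2)) + 2 * d\<^sup>2 * (diameter K * int_el K (\<lambda>x. (adv W K x)\<^sup>2))"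
      by (simp add: algebra_simps)
  qed
  have S: "S_form X X \<le> 2 * S_form V V + (2 * d\<^sup>2) * S_form W W"
  proof -
    have "(\<Sum>K\<in>T. \<Sum>E\<in>edges_of K. diameter E * int_el K (\<lambda>x. (fluct X E K x)\<^sup>2))
       \<le> (\<Sum>K\<in>T. \<Sum>E\<in>edges_of K. 2 * (diameter E * int_el K (\<lambda>x. (fluct V E K x)\<^sup>2)) + (2 * d\<^sup>2) * (diameter E * int_el K (\<lambda>x. (fluct W E K x)\<^sup>2)))"
    proof (intro sum_mono)
      fix K E assume K: "K \<in> T" and E: "E \<in> edges_of K"
      have "int_el K (\<lambda>x. (fluct X E K x)\<^sup>2) \<le> 2 * int_el K (\<lambda>x. (fluct V E K x)\<^sup>2) + (2 * d\<^sup>2) * int_el K (\<lambda>x. (fluct W E K x)\<^sup>2)"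
        unfolding X_def by (rule int_el_square_linear[OF K cont_fluct[OF K] cont_fluct[OF K]]) (rule fluct_linear[OF V W K])
      then have "diameter E * int_el K (\<lambda>x. (fluct X E K x)\<^sup>2) \<le> diameter E * (2 * int_el K (\<lambda>x. (fluct V E K x)\<^sup>2) + (2 * d\<^sup>2) * int_el K (\<lambda>x. (fluct W E K x)\<^sup>2))"
        using edge_facts(3)[OF K] E by (intro mult_left_mono) auto
      then show "diameter E * int_el K (\<lambda>x. (fluct X E K x)\<^sup>2) \<le> 2 * (diameter E * int_el K (\<lambda>x. (fluct V E K x)\<^sup>2)) + (2 * d\<^sup>2) * (diameter E * int_el K (\<lambda>x. (fluct W E K x)\<^sup>2))"
        by (simp add: algebra_simps)
    qed
    from mult_left_mono[OF this less_imp_le[OF beta]] show ?thesis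
      unfolding S_form_self by (simp add: sum.distrib sum_distrib_left distrib_left mult_ac)
  qed
  have bdry_energy: "bdry_energy X \<le> 2 * bdry_energy V + (2 * d\<^sup>2) * bdry_energy W"
    unfolding bdry_energy_def sum_distrib_left sum.distrib[symmetric]
  proof (rule sum_mono)
    fix E assume E: "E \<in> boundary_edges M"
    show "edge_integral E (\<lambda>x. \<bar>b_n E x\<bar> / 2 * (b_trace X E x)\<^sup>2) \<le> 2 * edge_integral E (\<lambda>x. \<bar>b_n E x\<bar> / 2 * (b_trace V E x)\<^sup>2) + 2 * d\<^sup>2 * edge_integral E (\<lambda>x. \<bar>b_n E x\<bar> / 2 * (b_trace W E x)\<^sup>2)"
    proof -
      have "b_trace X E x = b_trace V E x + d * b_trace W E x" for x by (simp add: b_trace_def X_def)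
      moreover have "continuous_on E (\<lambda>x. \<bar>b_n E x\<bar> / 2)" by (intro continuous_intros cont_b_n be_edges E) simp
      ultimately show ?thesis
        using edge_square_linear[OF edge_seg[OF be_edges[OF E]] _ cont_b_trace[OF V E] cont_b_trace[OF W E], of "\<lambda>x. \<bar>b_n E x\<bar> / 2" d] by simp
    qed
  qed
  have jump_energy: "jump_energy X \<le> 2 * jump_energy V + (2 * d\<^sup>2) * jump_energy W"
    unfolding jump_energy_def sum_distrib_left sum.distrib[symmetric]
  proof (rule sum_mono)
    fix E assume E: "E \<in> interior_edges M"
    show "edge_integral E (\<lambda>x. \<bar>b_n E x\<bar> / 2 * (b_jump X E x)\<^sup>2) \<le> 2 * edge_integral E (\<lambda>x. \<bar>b_n E x\<bar> / 2 * (b_jump V E x)\<^sup>2) + 2 * d\<^sup>2 * edge_integral E (\<lambda>x. \<bar>b_n E x\<bar> / 2 * (b_jump W E x)\<^sup>2)"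
    proof -
      have "b_jump X E x = b_jump V E x + d * b_jump W E x" for x by (simp add: b_jump_def X_def algebra_simps)
      moreover have "continuous_on E (\<lambda>x. \<bar>b_n E x\<bar> / 2)" by (intro continuous_intros cont_b_n ie_edges E) simp
      ultimately show ?thesis
        using edge_square_linear[OF edge_seg[OF ie_edges[OF E]] _ cont_b_jump[OF V E] cont_b_jump[OF W E], of "\<lambda>x. \<bar>b_n E x\<bar> / 2" d] by simp
    qed
  qed
  have "\<alpha> * mass X \<le> \<alpha> * (2 * mass V + (2 * d\<^sup>2) * mass W)" using L alpha by (intro mult_left_mono) auto
  then have "energy X + adv_energy X \<le> \<alpha> * (2 * mass V + (2 * d\<^sup>2) * mass W) + (2 * bdry_energy V + (2 * d\<^sup>2) * bdry_energy W) + (2 * S_form V V + (2 * d\<^sup>2) * S_form W W)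
     + (2 * jump_energy V + (2 * d\<^sup>2) * jump_energy W) + (2 * adv_energy V + (2 * d\<^sup>2) * adv_energy W)"
    using bdry_energy S jump_energy B unfolding energy_eq by linarith
  then show ?thesis unfolding energy_eq by (simp add: algebra_simps)
qed

lemma norm_test_fn:
  "energy (test_fn U) + adv_energy (test_fn U) \<le> cN \<alpha> \<beta> Bb H s * (6 * q) * adv_energy U"
proof -
  have "\<alpha> * mass (test_fn U) \<le> \<alpha> * (3 * H * mean_energy U)" using mass_test_fn[of U] alpha by (intro mult_left_mono) auto
  moreover have "bdry_energy (test_fn U) + jump_energy (test_fn U) \<le> Bb * (9 * s\<^sup>2 * mean_energy U)"
    using edge_terms_le_trace_energy(3)[OF broken_P1_test_fn] mult_left_mono[OF trace_energy_test_fn[of U] Bb(2)] by (rule order_trans)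
  ultimately have "energy (test_fn U) + adv_energy (test_fn U) \<le> cN \<alpha> \<beta> Bb H s * mean_energy U"
    using S_form_test_fn[of U] adv_energy_test_fn[of U] unfolding energy_eq cN_def by (simp add: algebra_simps)
  also have "\<dots> \<le> cN \<alpha> \<beta> Bb H s * (6 * q * adv_energy U)" by (intro mult_left_mono mean_energy_le_adv_energy const_bounds_mesh)
  finally show ?thesis by (simp add: mult_ac)
qed

section \<open>Definiteness of the norm and the inf-sup bound on one mesh\<close>

lemma mass_represents:
  assumes "represents v V" shows "(LINT x|lebesgue_on \<Omega>. (v x)\<^sup>2) = mass V"
proof -
  have m: "(\<lambda>x. (v x)\<^sup>2) \<in> borel_measurable (lebesgue_on \<Omega>)"
    using assms unfolding represents_def by (intro borel_measurable_power) blast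
  have V: "broken_P1 V" using assms by (simp add: represents_def)
  have i: "int_el K (\<lambda>x. (v x)\<^sup>2) = int_el K (\<lambda>x. (V K x)\<^sup>2)" "integrable_el K (\<lambda>x. (v x)\<^sup>2)" if K: "K \<in> T" for K
  proof -
    have o: "integrable_el K (\<lambda>x. (V K x)\<^sup>2)" by (intro continuous_int_el K continuous_intros cont_broken_P1 V)
    have e: "(v x)\<^sup>2 = (V K x)\<^sup>2" if "x \<in> interior K" "v x = V K x" for x using that by simp
    show "int_el K (\<lambda>x. (v x)\<^sup>2) = int_el K (\<lambda>x. (V K x)\<^sup>2)" "integrable_el K (\<lambda>x. (v x)\<^sup>2)"
      using int_el_represents[OF assms K m o e] by blast+
  qed
  then show ?thesis unfolding mass_def using domain_split(1)[OF m] by simp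
qed

text \<open>The L2 part with its factor \<open>\<alpha> > 0\<close> is definite, and the other
  summands are nonnegative.\<close>

lemma norm_pos:
  assumes v: "v \<in> V_nc_nonzero \<Omega> M" and r: "represents v V" shows "energy V + adv_energy V > 0"
proof (rule ccontr)
  assume n: "\<not> energy V + adv_energy V > 0"
  have V: "broken_P1 V" using r by (simp add: represents_def)
  have "\<alpha> * mass V \<le> 0"
    using n bdry_energy_nonneg[OF V] jump_energy_nonneg[OF V] S_form_nonneg[of V] adv_energy_nonneg[of V] unfolding energy_eq by linarith
  then have "mass V = 0" using alpha mass_nonneg[of V] by (simp add: mult_le_0_iff)
  then have "(LINT x|lebesgue_on \<Omega>. (v x)\<^sup>2) = 0" using mass_represents[OF r] by simp
  moreover have "integrable (lebesgue_on \<Omega>) (\<lambda>x. (v x)\<^sup>2)" using v by (auto simp: V_nc_nonzero_def V_nc_def in_L2_def)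
  ultimately have "AE x in lebesgue_on \<Omega>. (v x)\<^sup>2 = 0"
    using integral_nonneg_eq_0_iff_AE[of "lebesgue_on \<Omega>" "\<lambda>x. (v x)\<^sup>2"] by simp
  then show False using v by (simp add: V_nc_nonzero_def)
qed

text \<open>Linearity at zero with \<open>d = 1\<close> says that the value equals its own
  double.\<close>

lemma A_form_zero: "broken_P1 U \<Longrightarrow> A_form U (\<lambda>K x. 0) = 0"
  using A_form_linear[of U "\<lambda>K x. 0" "\<lambda>K x. 0" 1] by (simp add: broken_P1_def P1_const)

lemma inf_sup_witness:
  assumes u: "u \<in> V_nc_nonzero \<Omega> M"
  shows "\<exists>v\<in>V_nc_nonzero \<Omega> M. infsup_const \<alpha> \<beta> Bb m H s q \<le>
    A_nc \<Omega> b \<mu> \<beta> M u v / (NLPSD_norm \<Omega> b \<alpha> \<beta> M u * NLPSD_norm \<Omega> b \<alpha> \<beta> M v)"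
proof -
  define U where "U = elem_poly u"
  have uV: "u \<in> V_nc \<Omega> M" using u by (simp add: V_nc_nonzero_def)
  have ru: "represents u U" unfolding U_def by (rule represents_elem_poly[OF uV])
  then have U: "broken_P1 U" by (simp add: represents_def)
  let ?d = cdel'
  define V where "V = (\<lambda>K x. U K x + ?d * test_fn U K x)"
  have V: "broken_P1 V" unfolding V_def by (rule broken_P1_linear[OF U broken_P1_test_fn])
  let ?n = "energy U + adv_energy U" and ?cA = "cA \<alpha> \<beta> Bb m H s q" and ?cV = "cV \<alpha> \<beta> Bb m H s q"
  have R0: "0 \<le> energy U" using mass_nonneg[of U] bdry_energy_nonneg[OF U] jump_energy_nonneg[OF U] S_form_nonneg[of U] alpha by (simp add: energy_eq)
  have n0: "?n > 0" by (rule norm_pos[OF u ru])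
  have "A_form U V = A_form U U + ?d * A_form U (test_fn U)" unfolding V_def by (rule A_form_linear[OF U U broken_P1_test_fn])
  also have "\<dots> \<ge> energy U + ?d * (adv_energy U / 16 - cR' * energy U)"
    using const_bounds_mesh(5) by (intro add_mono A_form_coercive U mult_left_mono A_form_test_fn_ge) auto
  finally have a1: "A_form U V \<ge> energy U + ?d * (adv_energy U / 16 - cR' * energy U)" .
  \<comment> \<open>The choice of \<open>cdel\<close> limits the loss caused by the test function to
    half of the energy.\<close>
  have "(?d * cR') * energy U \<le> 1/2 * energy U" by (intro mult_right_mono const_bounds_mesh R0)
  then have "A_form U V \<ge> 1/2 * energy U + (?d / 16) * adv_energy U" using a1 by (simp add: algebra_simps)
  moreover have "?cA * energy U \<le> 1/2 * energy U" by (rule mult_right_mono[OF _ R0]) (simp add: cA_def)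
  moreover have "?cA * adv_energy U \<le> (?d / 16) * adv_energy U" by (rule mult_right_mono[OF _ adv_energy_nonneg]) (simp add: cA_def)
  ultimately have a: "A_form U V \<ge> ?cA * ?n" by (simp add: distrib_left)
  then have apos: "A_form U V > 0" using const_bounds_mesh(9) n0 by (meson less_le_trans mult_pos_pos)
  have "energy V + adv_energy V \<le> 2 * ?n + 2 * ?d\<^sup>2 * (energy (test_fn U) + adv_energy (test_fn U))" unfolding V_def by (rule norm_linear[OF U broken_P1_test_fn])
  also have "\<dots> \<le> 2 * ?n + 2 * ?d\<^sup>2 * (cN \<alpha> \<beta> Bb H s * (6 * q) * ?n)"
  proof -
    have "cN \<alpha> \<beta> Bb H s * (6 * q) * adv_energy U \<le> cN \<alpha> \<beta> Bb H s * (6 * q) * ?n"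
      using const_bounds_mesh(7) q(1) R0 by (intro mult_left_mono) auto
    then have "energy (test_fn U) + adv_energy (test_fn U) \<le> cN \<alpha> \<beta> Bb H s * (6 * q) * ?n" using norm_test_fn[of U] by linarith
    then show ?thesis by (intro add_left_mono mult_left_mono) auto
  qed
  also have "\<dots> = ?cV * ?n" by (simp add: cV_def algebra_simps)
  finally have nV: "energy V + adv_energy V \<le> ?cV * ?n" .
  define v where "v = glue V"
  have rv: "represents v V" unfolding v_def by (rule represents_glue[OF V])
  have "edge_integral E (b_jump V E) = 0" if E: "E \<in> interior_edges M" for E
  proof -
    note seg = edge_seg[OF ie_edges[OF E]]
    have "jump M E u = b_jump U E" using interior_edge(3,4)[OF E] elem_poly_represents[OF ru] by (auto simp: jump_def b_jump_def fun_eq_iff)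
    then have jU: "edge_integral E (b_jump U E) = 0" using uV E by (auto simp: V_nc_def)
    have c: "continuous_on E (b_jump U E)" "continuous_on E (\<lambda>x. ?d * b_jump (test_fn U) E x)"
      by (intro continuous_intros cont_b_jump U broken_P1_test_fn E)+
    have "edge_integral E (b_jump V E) = edge_integral E (\<lambda>x. b_jump U E x + ?d * b_jump (test_fn U) E x)"
      by (rule edge_integral_cong[OF seg]) (simp add: b_jump_def V_def algebra_simps)
    also have "\<dots> = 0" unfolding edge_integral_add[OF seg c] edge_integral_cmult[OF seg] using jU jump_test_fn[OF E] by simp
    finally show ?thesis .
  qed
  then have vV: "v \<in> V_nc \<Omega> M" unfolding v_def by (rule glue_V_nc[OF V])
  \<comment> \<open>Otherwise the zero family would represent \<open>v\<close> as well, and the form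
    would vanish, against its positivity.\<close>
  have "\<not> (AE x in lebesgue_on \<Omega>. v x = 0)"
  proof
    assume z: "AE x in lebesgue_on \<Omega>. v x = 0"
    have r0: "represents v (\<lambda>K x. 0)"
      unfolding represents_def
    proof (intro conjI ballI)
      show "v \<in> borel_measurable (lebesgue_on \<Omega>)" using rv by (simp add: represents_def)
      show "broken_P1 (\<lambda>K x. 0)" by (simp add: broken_P1_def P1_const)
      fix K assume K: "K \<in> T"
      have "AE x in lebesgue. x \<in> \<Omega> \<longrightarrow> v x = 0" using z open_dom by (simp add: AE_restrict_space_iff)
      then have "AE x in lebesgue. x \<in> interior K \<longrightarrow> v x = 0" by eventually_elim (use T_int[OF K] in blast)
      then show "AE x in lebesgue_on (interior K). v x = 0" by (simp add: AE_restrict_space_iff)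
    qed
    have "A_form U V = A_form U (\<lambda>K x. 0)" using A_nc_eq[OF ru rv] A_nc_eq[OF ru r0] by simp
    then show False using A_form_zero[OF U] apos by simp
  qed
  then have vN: "v \<in> V_nc_nonzero \<Omega> M" using vV by (simp add: V_nc_nonzero_def)
  have nVpos: "energy V + adv_energy V > 0" by (rule norm_pos[OF vN rv])
  have "sqrt ?n * (sqrt ?cV * sqrt ?n) = sqrt ?cV * (sqrt ?n * sqrt ?n)" by (simp only: mult_ac)
  then have e: "sqrt ?n * (sqrt ?cV * sqrt ?n) = sqrt ?cV * ?n" using n0 by simp
  have "infsup_const \<alpha> \<beta> Bb m H s q = ?cA * ?n / (sqrt ?n * (sqrt ?cV * sqrt ?n))"
    unfolding e infsup_const_def using n0 by (intro nonzero_mult_divide_mult_cancel_right[symmetric]) simp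
  also have "\<dots> \<le> A_form U V / (sqrt ?n * (sqrt ?cV * sqrt ?n))"
    using a n0 const_bounds_mesh(8) by (intro divide_right_mono) auto
  \<comment> \<open>As \<open>A_form U V\<close> is positive, passing from the upper bound for the
    norm of \<open>v\<close> to the norm itself can only increase the quotient.\<close>
  also have "\<dots> \<le> A_form U V / (sqrt ?n * sqrt (energy V + adv_energy V))"
  proof (rule divide_left_mono)
    have "sqrt (energy V + adv_energy V) \<le> sqrt ?cV * sqrt ?n" using nV by (simp add: real_sqrt_mult[symmetric])
    then show "sqrt ?n * sqrt (energy V + adv_energy V) \<le> sqrt ?n * (sqrt ?cV * sqrt ?n)" using n0 by (intro mult_left_mono) auto
  qed (use apos n0 nVpos const_bounds_mesh(8) in auto)
  finally show ?thesis
    unfolding A_nc_eq[OF ru rv, symmetric] NLPSD_norm_eq[OF ru, symmetric] NLPSD_norm_eq[OF rv, symmetric] using vN by blast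
qed

text \<open>One witness per \<open>u\<close> bounds the supremum from below; in \<open>ereal\<close>
  the supremum exists without a proof that the quotients are bounded.\<close>

theorem inf_sup:
  "(INF u\<in>V_nc_nonzero \<Omega> M. SUP v\<in>V_nc_nonzero \<Omega> M.
     ereal (A_nc \<Omega> b \<mu> \<beta> M u v / (NLPSD_norm \<Omega> b \<alpha> \<beta> M u * NLPSD_norm \<Omega> b \<alpha> \<beta> M v)))
   \<ge> ereal (infsup_const \<alpha> \<beta> Bb m H s q)"
proof (rule INF_greatest)
  fix u assume "u \<in> V_nc_nonzero \<Omega> M"
  from inf_sup_witness[OF this] obtain v where "v \<in> V_nc_nonzero \<Omega> M"
    "infsup_const \<alpha> \<beta> Bb m H s q \<le> A_nc \<Omega> b \<mu> \<beta> M u v / (NLPSD_norm \<Omega> b \<alpha> \<beta> M u * NLPSD_norm \<Omega> b \<alpha> \<beta> M v)"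
    by blast
  then show "ereal (infsup_const \<alpha> \<beta> Bb m H s q) \<le> (SUP v\<in>V_nc_nonzero \<Omega> M.
     ereal (A_nc \<Omega> b \<mu> \<beta> M u v / (NLPSD_norm \<Omega> b \<alpha> \<beta> M u * NLPSD_norm \<Omega> b \<alpha> \<beta> M v)))"
    by (intro SUP_upper2[of v]) auto
qed

end

text \<open>The inscribed diameter is a supremum, so a ball with \<open>2 * r\<close> above half of
  it is taken, which gives the factor 4. The summand 1 makes the constant positive for every
  \<open>\<sigma>\<close>, as required of \<open>s\<close>.\<close>

lemma shape_regular_ball:
  assumes K: "2 simplex K" and d: "diameter K \<le> \<sigma> * inscribed_diameter K"
  shows "\<exists>x r. cball x r \<subseteq> K \<and> r > 0 \<and> diameter K \<le> (4 * \<bar>\<sigma>\<bar> + 1) * r"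
proof -
  obtain P Q R where v: "vertices K P Q R" using simplex_2_vertices[OF K] .
  have bd: "bounded K" using compact_simplex[OF K] compact_imp_bounded by blast
  have "P \<in> K" "Q \<in> K" unfolding verticesD(2)[OF v] by (simp_all add: hull_inc)
  then have "dist P Q \<le> diameter K" using diameter_bounded_bound[OF bd] by blast
  moreover have "dist P Q > 0" using tri_neq(1)[OF verticesD(1)[OF v]] by simp
  ultimately have dp: "diameter K > 0" by linarith
  let ?S = "{2 * r | r x. 0 \<le> r \<and> cball x r \<subseteq> K}"
  have "0 \<in> ?S" using \<open>P \<in> K\<close> by (intro CollectI exI[of _ 0] exI[of _ P]) simp
  then have ne: "?S \<noteq> {}" by blast
  have bdd: "bdd_above ?S"
  proof (rule bdd_aboveI[of _ "diameter K"])
    fix y assume "y \<in> ?S"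
    then obtain r x where r: "y = 2 * r" "0 \<le> r" "cball x r \<subseteq> K" by blast
    have "diameter (cball x r) \<le> diameter K" using r(3) bd by (rule diameter_subset)
    then show "y \<le> diameter K" using r by simp
  qed
  have i0: "0 \<le> inscribed_diameter K" unfolding inscribed_diameter_def using \<open>0 \<in> ?S\<close> bdd by (rule cSup_upper)
  have "diameter K \<le> \<bar>\<sigma>\<bar> * inscribed_diameter K" using d i0 mult_right_mono[OF abs_ge_self[of \<sigma>] i0] by linarith
  then have ip: "0 < inscribed_diameter K" using dp i0 by (cases "inscribed_diameter K = 0") auto
  then have "inscribed_diameter K / 2 < Sup ?S" unfolding inscribed_diameter_def by simp
  then obtain y where "y \<in> ?S" "inscribed_diameter K / 2 < y" using less_cSup_iff[OF ne bdd] by blast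
  then obtain r x where r: "inscribed_diameter K < 4 * r" "cball x r \<subseteq> K" by auto
  have rp: "r > 0" using r(1) ip by linarith
  have "\<bar>\<sigma>\<bar> * inscribed_diameter K \<le> \<bar>\<sigma>\<bar> * (4 * r)" using r(1) by (intro mult_left_mono) auto
  then have "diameter K \<le> \<bar>\<sigma>\<bar> * (4 * r)" using \<open>diameter K \<le> \<bar>\<sigma>\<bar> * inscribed_diameter K\<close> by linarith
  also have "\<dots> \<le> (4 * \<bar>\<sigma>\<bar> + 1) * r" using rp by (simp add: algebra_simps)
  finally show ?thesis using r(2) rp by blast
qed

theorem theorem4p1:
  fixes \<Omega> :: "plane set" and b :: "plane \<Rightarrow> plane" and \<mu> :: "plane \<Rightarrow> real"
    and \<alpha> \<beta> :: real and \<F> :: "mesh set"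
  assumes "polygonal_domain \<Omega>"
    and "in_W1inf \<Omega> b" and "continuous_on (closure \<Omega>) b"
    and "in_Linf \<Omega> \<mu>"
    and "\<alpha> > 0" and "AE x in lebesgue_on \<Omega>. \<mu> x - 1/2 * weak_div \<Omega> b x \<ge> \<alpha>"
    and "\<And>M. M \<in> \<F> \<Longrightarrow> mesh_of \<Omega> M"
    and "shape_regular \<F>" and "locally_quasi_uniform \<F>"
    and "\<beta> > 0" and "beta_scaling b \<beta> \<F>"
  shows "\<exists>\<nu>>0. \<forall>M\<in>\<F>.
    (INF u\<in>V_nc_nonzero \<Omega> M. SUP v\<in>V_nc_nonzero \<Omega> M.
       ereal (A_nc \<Omega> b \<mu> \<beta> M u v / (NLPSD_norm \<Omega> b \<alpha> \<beta> M u * NLPSD_norm \<Omega> b \<alpha> \<beta> M v)))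
    \<ge> ereal \<nu>"
proof -
  have bd: "bounded (closure \<Omega>)" using assms(1) by (simp add: polygonal_domain_def bounded_closure)
  then have "compact (b ` closure \<Omega>)"
    using assms(3) by (intro compact_continuous_image) (auto simp: compact_eq_bounded_closed)
  then obtain B where "\<forall>y\<in>b ` closure \<Omega>. norm y \<le> B" using compact_imp_bounded bounded_iff by metis
  then have Bb: "norm (b x) \<le> max B 0" if "x \<in> closure \<Omega>" for x using that by (auto simp: le_max_iff_disj)
  obtain m where m: "m \<ge> 0" "AE x in lebesgue_on \<Omega>. \<bar>\<mu> x\<bar> \<le> m" using in_Linf_bounded[OF assms(4)] by blast
  obtain \<sigma> where \<sigma>: "\<And>M K. M \<in> \<F> \<Longrightarrow> K \<in> triangles M \<Longrightarrow> diameter K \<le> \<sigma> * inscribed_diameter K"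
    using assms(8) unfolding shape_regular_def by blast
  obtain q where q: "\<And>M K K'. M \<in> \<F> \<Longrightarrow> K \<in> triangles M \<Longrightarrow> K' \<in> triangles M \<Longrightarrow> K \<inter> K' \<noteq> {} \<Longrightarrow> diameter K \<le> q * diameter K'"
    using assms(9) unfolding locally_quasi_uniform_def by blast
  \<comment> \<open>All triangles lie in the closure of the domain, so its diameter bounds the mesh
    size over the whole family. The maxima with 0 below provide the sign conditions of the locale,
    which the obtained \<open>B\<close> and \<open>q\<close> need not satisfy.\<close>
  let ?H = "diameter (closure \<Omega>)" and ?s = "4 * \<bar>\<sigma>\<bar> + 1"
  have loc: "nc_mesh \<Omega> b \<mu> \<alpha> \<beta> M (max B 0) m ?H ?s (max q 0)" if M: "M \<in> \<F>" for M
  proof -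
    have T: "\<Union>(triangles M) = closure \<Omega>" "\<And>K. K \<in> triangles M \<Longrightarrow> 2 simplex K"
      using assms(7)[OF M] by (auto simp: mesh_of_def)
    show ?thesis
    proof
      show "diameter K \<le> ?H" if "K \<in> triangles M" for K
        using that T(1) bd by (intro diameter_subset) auto
      show "0 \<le> ?H" using bd by (rule diameter_ge_0)
      show "\<exists>x r. cball x r \<subseteq> K \<and> r > 0 \<and> diameter K \<le> ?s * r" if "K \<in> triangles M" for K
        using shape_regular_ball[OF T(2)[OF that] \<sigma>[OF M that]] .
      show "diameter K \<le> max q 0 * diameter K'" if "K \<in> triangles M" "K' \<in> triangles M" "K \<inter> K' \<noteq> {}" for K K'
      proof -
        have "0 \<le> diameter K'" using compact_simplex[OF T(2)[OF that(2)]] by (intro diameter_ge_0 compact_imp_bounded)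
        then have "q * diameter K' \<le> max q 0 * diameter K'" by (intro mult_right_mono) auto
        then show ?thesis using q[OF M that] by linarith
      qed
    qed (use assms Bb m M in auto)
  qed
  have "0 < infsup_const \<alpha> \<beta> (max B 0) m ?H ?s (max q 0)"
    using assms(5,10) m(1) diameter_ge_0[OF bd] by (intro const_bounds) auto
  then show ?thesis using nc_mesh.inf_sup[OF loc] by blast
qed

end
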